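(* Let $\mathcal{C}$ be a small category. The adjunction $\mathcal{T}_{\mathcal{C}}\dashv\int_{\mathcal{C}}$, with right adjoint the category of elements functor $\int_{\mathcal{C}}\colon[\mathcal{C}^{\mathrm{op}},\mathrm{Set}]_{\mathrm{proj}}\to(\mathrm{Cat}_{/\mathcal{C}})_{\mathrm{discfib}}$ and left adjoint $\mathcal{T}_{\mathcal{C}}\colon(\mathrm{Cat}_{/\mathcal{C}})_{\mathrm{discfib}}\to[\mathcal{C}^{\mathrm{op}},\mathrm{Set}]_{\mathrm{proj}}$, is a Quillen equivalence.
   Context: $\mathrm{Cat}_{/\mathcal{C}}$ is the slice of the category of small categories over $\mathcal{C}$. A functor $P\colon\mathcal{P}\to\mathcal{C}$ is a discrete fibration if for every $a\in\mathcal{P}$ and $f\colon c\to Pa$ there is a unique $g\colon a'\to a$ in $\mathcal{P}$ with $Pg=f$. $(\mathrm{Cat}_{/\mathcal{C}})_{\mathrm{discfib}}$ is the (unique) model structure on $\mathrm{Cat}_{/\mathcal{C}}$ in which the cofibrations are all morphisms and the fibrant objects are the discrete fibrations; its weak equivalences between fibrant objects are the isomorphisms and all morphisms between fibrant objects are fibrations. $[\mathcal{C}^{\mathrm{op}},\mathrm{Set}]_{\mathrm{proj}}$ is the model structure whose weak equivalences are the level-wise isomorphisms and in which all maps are both cofibrations and fibrations. $\int_{\mathcal{C}}$: for $F\colon\mathcal{C}^{\mathrm{op}}\to\mathrm{Set}$, the category $\int_{\mathcal{C}}F$ has objects the pairs $(c,x)$ with $c\in\mathcal{C}$, $x\in Fc$,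 and morphisms $(c,x)\to(d,y)$ the morphisms $f\colon c\to d$ in $\mathcal{C}$ with $x=Ff(y)$; it lies over $\mathcal{C}$ by projection to the first coordinate. For $\alpha\colon F\Rightarrow G$, $\int_{\mathcal{C}}\alpha$ sends $(c,x)$ to $(c,\alpha_c(x))$ and $f$ to $f$. $\mathcal{T}_{\mathcal{C}}$: for $P\colon\mathcal{P}\to\mathcal{C}$ and $c\in\mathcal{C}$, the comma category $c\downarrow P$ has objects $(a,f)$ with $a\in\mathcal{P}$, $f\colon c\to Pa$, and morphisms $(a',f')\to(a,f)$ the $g\colon a'\to a$ with $f=(Pg)f'$. $\mathcal{T}_{\mathcal{C}}P\colon\mathcal{C}^{\mathrm{op}}\to\mathrm{Set}$ sends $c$ to the set of connected components $\pi_0(c\downarrow P)$, and $c\to d$ to the map $\pi_0(d\downarrow P)\to\pi_0(c\downarrow P)$ induced by precomposition; a functor $F$ over $\mathcal{C}$ is sent to the induced maps $\pi_0(c\downarrow P)\to\pi_0(c\downarrow Q)$. *)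

theory Defs
  imports Main "HOL-Library.FuncSet"
begin

section \<open>Categories, functors, natural transformations\<close>

record ('o, 'm) cat =
  Obj :: "'o set"
  Arr :: "'m set"
  Dom :: "'m \<Rightarrow> 'o"
  Cod :: "'m \<Rightarrow> 'o"
  Ident :: "'o \<Rightarrow> 'm"
  Comp :: "'m \<Rightarrow> 'm \<Rightarrow> 'm"  \<comment> \<open>\<open>Comp K g f\<close> is \<open>g\<close> after \<open>f\<close>\<close>

definition hom :: "('o, 'm) cat \<Rightarrow> 'o \<Rightarrow> 'o \<Rightarrow> 'm set" where
  "hom K a b = {f \<in> Arr K. Dom K f = a \<and> Cod K f = b}"

locale category =
  fixes K :: "('o, 'm) cat"
  assumes dom_obj: "f \<in> Arr K \<Longrightarrow> Dom K f \<in> Obj K"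
    and cod_obj: "f \<in> Arr K \<Longrightarrow> Cod K f \<in> Obj K"
    and ident_hom: "a \<in> Obj K \<Longrightarrow> Ident K a \<in> hom K a a"
    and comp_hom: "f \<in> hom K a b \<Longrightarrow> g \<in> hom K b c \<Longrightarrow> Comp K g f \<in> hom K a c"
    and ident_left: "f \<in> hom K a b \<Longrightarrow> Comp K (Ident K b) f = f"
    and ident_right: "f \<in> hom K a b \<Longrightarrow> Comp K f (Ident K a) = f"
    and assoc: "f \<in> hom K a b \<Longrightarrow> g \<in> hom K b c \<Longrightarrow> h \<in> hom K c d \<Longrightarrow>
      Comp K h (Comp K g f) = Comp K (Comp K h g) f"

definition is_iso :: "('o, 'm) cat \<Rightarrow> 'm \<Rightarrow> bool" where
  "is_iso K f \<longleftrightarrow> f \<in> Arr K \<and>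
    (\<exists>g \<in> hom K (Cod K f) (Dom K f).
      Comp K g f = Ident K (Dom K f) \<and> Comp K f g = Ident K (Cod K f))"

definition initial :: "('o, 'm) cat \<Rightarrow> 'o \<Rightarrow> bool" where
  "initial K i \<longleftrightarrow> i \<in> Obj K \<and> (\<forall>x \<in> Obj K. \<exists>!f. f \<in> hom K i x)"

definition terminal :: "('o, 'm) cat \<Rightarrow> 'o \<Rightarrow> bool" where
  "terminal K t \<longleftrightarrow> t \<in> Obj K \<and> (\<forall>x \<in> Obj K. \<exists>!f. f \<in> hom K x t)"

definition op_cat :: "('o, 'm) cat \<Rightarrow> ('o, 'm) cat" where
  "op_cat K = \<lparr>Obj = Obj K, Arr = Arr K, Dom = Cod K, Cod = Dom K,
    Ident = Ident K, Comp = (\<lambda>g f. Comp K f g)\<rparr>"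

record ('o, 'm, 'p, 'n) fctr =
  fobj :: "'o \<Rightarrow> 'p"
  farr :: "'m \<Rightarrow> 'n"

locale is_functor = A: category A + B: category B
  for A :: "('o, 'm) cat" and B :: "('p, 'n) cat" +
  fixes F :: "('o, 'm, 'p, 'n) fctr"
  assumes map_obj: "a \<in> Obj A \<Longrightarrow> fobj F a \<in> Obj B"
    and map_hom: "f \<in> hom A a b \<Longrightarrow> farr F f \<in> hom B (fobj F a) (fobj F b)"
    and map_ident: "a \<in> Obj A \<Longrightarrow> farr F (Ident A a) = Ident B (fobj F a)"
    and map_comp: "f \<in> hom A a b \<Longrightarrow> g \<in> hom A b c \<Longrightarrow>
      farr F (Comp A g f) = Comp B (farr F g) (farr F f)"

text \<open>HOL functions are total.  Where categories, functors or natural transformations are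
  themselves objects or arrows of a category, their values outside the carriers are normalised
  to \<open>undefined\<close>, so that HOL equality is the intended equality.\<close>

definition ext_cat :: "('o, 'm) cat \<Rightarrow> bool" where
  "ext_cat K \<longleftrightarrow> Dom K \<in> extensional (Arr K) \<and> Cod K \<in> extensional (Arr K) \<and>
    Ident K \<in> extensional (Obj K) \<and>
    (\<forall>g f. \<not> (f \<in> Arr K \<and> g \<in> Arr K \<and> Dom K g = Cod K f) \<longrightarrow> Comp K g f = undefined)"

definition ext_functor :: "('o, 'm) cat \<Rightarrow> ('o, 'm, 'p, 'n) fctr \<Rightarrow> bool" where
  "ext_functor A F \<longleftrightarrow> fobj F \<in> extensional (Obj A) \<and> farr F \<in> extensional (Arr A)"

definition natural ::
  "('o, 'm) cat \<Rightarrow> ('p, 'n) cat \<Rightarrow> ('o, 'm, 'p, 'n) fctr \<Rightarrow> ('o, 'm, 'p, 'n) fctr \<Rightarrow>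
    ('o \<Rightarrow> 'n) \<Rightarrow> bool" where
  "natural A B F G \<alpha> \<longleftrightarrow>
    (\<forall>a \<in> Obj A. \<alpha> a \<in> hom B (fobj F a) (fobj G a)) \<and>
    (\<forall>f \<in> Arr A. Comp B (\<alpha> (Cod A f)) (farr F f) = Comp B (farr G f) (\<alpha> (Dom A f)))"

text \<open>An arrow that carries its source and target along with the underlying map.\<close>

datatype ('o, 'f) mor = Mor (src: 'o) (mp: 'f) (tgt: 'o)

definition functor_cat ::
  "('o, 'm) cat \<Rightarrow> ('p, 'n) cat \<Rightarrow>
    (('o, 'm, 'p, 'n) fctr, (('o, 'm, 'p, 'n) fctr, 'o \<Rightarrow> 'n) mor) cat" where
  "functor_cat A B = \<lparr>
    Obj = {F. is_functor A B F \<and> ext_functor A F},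
    Arr = {Mor F \<alpha> G | F \<alpha> G. is_functor A B F \<and> ext_functor A F \<and>
      is_functor A B G \<and> ext_functor A G \<and> natural A B F G \<alpha> \<and> \<alpha> \<in> extensional (Obj A)},
    Dom = src, Cod = tgt,
    Ident = (\<lambda>F. Mor F (\<lambda>a \<in> Obj A. Ident B (fobj F a)) F),
    Comp = (\<lambda>\<beta> \<alpha>. Mor (src \<alpha>) (\<lambda>a \<in> Obj A. Comp B (mp \<beta> a) (mp \<alpha> a)) (tgt \<beta>))\<rparr>"

definition slice :: "('o, 'm) cat \<Rightarrow> 'o \<Rightarrow> ('m, ('m, 'm) mor) cat" where
  "slice K c = \<lparr>
    Obj = {p \<in> Arr K. Cod K p = c},
    Arr = {Mor p h q | p h q. p \<in> Arr K \<and> Cod K p = c \<and> q \<in> Arr K \<and> Cod K q = c \<and>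
      h \<in> hom K (Dom K p) (Dom K q) \<and> Comp K q h = p},
    Dom = src, Cod = tgt,
    Ident = (\<lambda>p. Mor p (Ident K (Dom K p)) p),
    Comp = (\<lambda>g f. Mor (src f) (Comp K (mp g) (mp f)) (tgt g))\<rparr>"


section \<open>Small sets and small categories\<close>

text \<open>A universe is a collection of subsets of a fixed type, the small sets, closed under the
  operations below.  The elements of a Grothendieck universe containing an infinite set, regarded
  as subsets of a type with as many elements as the universe, form an instance, and so do all
  subsets of any infinite type.\<close>

definition universe :: "'u set set \<Rightarrow> bool" where
  "universe U \<longleftrightarrow> infinite (UNIV :: 'u set) \<and>
    (\<forall>A. finite A \<longrightarrow> A \<in> U) \<and>
    (\<forall>A B. A \<in> U \<longrightarrow> B \<subseteq> A \<longrightarrow> B \<in> U) \<and>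
    (\<forall>A (B :: 'u \<Rightarrow> 'u set). A \<in> U \<longrightarrow> (\<forall>a \<in> A. B a \<in> U) \<longrightarrow> (\<Union>a \<in> A. B a) \<in> U)"

lemma universe_UNIV: "infinite (UNIV :: 'u set) \<Longrightarrow> universe (UNIV :: 'u set set)"
  by (simp add: universe_def)

definition Set_cat :: "'u set set \<Rightarrow> ('u set, ('u set, 'u \<Rightarrow> 'u) mor) cat" where
  "Set_cat U = \<lparr>
    Obj = U,
    Arr = {Mor A f B | A f B. A \<in> U \<and> B \<in> U \<and> f \<in> A \<rightarrow>\<^sub>E B},
    Dom = src, Cod = tgt,
    Ident = (\<lambda>A. Mor A (\<lambda>x \<in> A. x) A),
    Comp = (\<lambda>g f. Mor (src f) (\<lambda>x \<in> src f. mp g (mp f x)) (tgt g))\<rparr>"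

type_synonym 'u scat = "('u, 'u) cat"
type_synonym 'u sfun = "('u, 'u, 'u, 'u) fctr"

definition small_category :: "'u set set \<Rightarrow> 'u scat \<Rightarrow> bool" where
  "small_category U A \<longleftrightarrow> category A \<and> ext_cat A \<and> Obj A \<in> U \<and> Arr A \<in> U"

definition Cat_cat :: "'u set set \<Rightarrow> ('u scat, ('u scat, 'u sfun) mor) cat" where
  "Cat_cat U = \<lparr>
    Obj = {A. small_category U A},
    Arr = {Mor A F B | A F B. small_category U A \<and> small_category U B \<and>
      is_functor A B F \<and> ext_functor A F},
    Dom = src, Cod = tgt,
    Ident = (\<lambda>A. Mor A \<lparr>fobj = (\<lambda>a \<in> Obj A. a), farr = (\<lambda>f \<in> Arr A. f)\<rparr> A),
    Comp = (\<lambda>G F. Mor (src F)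
      \<lparr>fobj = (\<lambda>a \<in> Obj (src F). fobj (mp G) (fobj (mp F) a)),
       farr = (\<lambda>f \<in> Arr (src F). farr (mp G) (farr (mp F) f))\<rparr> (tgt G))\<rparr>"

text \<open>An object \<open>p\<close> of \<open>Cat_over U C\<close> is a functor \<open>Mor P F C\<close>: the category over \<open>C\<close> is
  \<open>src p\<close> and its structure functor is \<open>mp p\<close>.\<close>

type_synonym 'u over = "('u scat, 'u sfun) mor"

abbreviation Cat_over :: "'u set set \<Rightarrow> 'u scat \<Rightarrow> ('u over, ('u over, 'u over) mor) cat" where
  "Cat_over U C \<equiv> slice (Cat_cat U) C"

type_synonym 'u psh = "('u, 'u, 'u set, ('u set, 'u \<Rightarrow> 'u) mor) fctr"
type_synonym 'u pshmor = "('u psh, 'u \<Rightarrow> ('u set, 'u \<Rightarrow> 'u) mor) mor"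

abbreviation presheaves :: "'u set set \<Rightarrow> 'u scat \<Rightarrow> ('u psh, 'u pshmor) cat" where
  "presheaves U C \<equiv> functor_cat (op_cat C) (Set_cat U)"


section \<open>Model structures and Quillen equivalences\<close>

record 'm model =
  Weq :: "'m set"
  Cofib :: "'m set"
  Fib :: "'m set"

definition has_lifting :: "('o, 'm) cat \<Rightarrow> 'm \<Rightarrow> 'm \<Rightarrow> bool" where
  "has_lifting K i p \<longleftrightarrow>
    (\<forall>u \<in> hom K (Dom K i) (Dom K p). \<forall>v \<in> hom K (Cod K i) (Cod K p).
      Comp K p u = Comp K v i \<longrightarrow>
      (\<exists>h \<in> hom K (Cod K i) (Dom K p). Comp K h i = u \<and> Comp K p h = v))"

definition retract_of :: "('o, 'm) cat \<Rightarrow> 'm \<Rightarrow> 'm \<Rightarrow> bool" where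
  "retract_of K f g \<longleftrightarrow>
    (\<exists>i \<in> hom K (Dom K f) (Dom K g). \<exists>r \<in> hom K (Dom K g) (Dom K f).
     \<exists>j \<in> hom K (Cod K f) (Cod K g). \<exists>s \<in> hom K (Cod K g) (Cod K f).
      Comp K r i = Ident K (Dom K f) \<and> Comp K s j = Ident K (Cod K f) \<and>
      Comp K g i = Comp K j f \<and> Comp K f r = Comp K s g)"

definition retract_closed :: "('o, 'm) cat \<Rightarrow> 'm set \<Rightarrow> bool" where
  "retract_closed K S \<longleftrightarrow> (\<forall>f \<in> Arr K. \<forall>g \<in> S. retract_of K f g \<longrightarrow> f \<in> S)"

definition two_of_three :: "('o, 'm) cat \<Rightarrow> 'm set \<Rightarrow> bool" where
  "two_of_three K W \<longleftrightarrow>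
    (\<forall>f \<in> Arr K. \<forall>g \<in> Arr K. Dom K g = Cod K f \<longrightarrow>
      (f \<in> W \<and> g \<in> W \<longrightarrow> Comp K g f \<in> W) \<and>
      (f \<in> W \<and> Comp K g f \<in> W \<longrightarrow> g \<in> W) \<and>
      (g \<in> W \<and> Comp K g f \<in> W \<longrightarrow> f \<in> W))"

definition factorizes :: "('o, 'm) cat \<Rightarrow> 'm set \<Rightarrow> 'm set \<Rightarrow> bool" where
  "factorizes K L R \<longleftrightarrow>
    (\<forall>f \<in> Arr K. \<exists>i \<in> L. \<exists>p \<in> R. Cod K i = Dom K p \<and> Comp K p i = f)"

definition model_structure :: "('o, 'm) cat \<Rightarrow> 'm model \<Rightarrow> bool" where
  "model_structure K M \<longleftrightarrow> category K \<and>
    Weq M \<subseteq> Arr K \<and> Cofib M \<subseteq> Arr K \<and> Fib M \<subseteq> Arr K \<and>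
    two_of_three K (Weq M) \<and>
    retract_closed K (Weq M) \<and> retract_closed K (Cofib M) \<and> retract_closed K (Fib M) \<and>
    (\<forall>i \<in> Cofib M \<inter> Weq M. \<forall>p \<in> Fib M. has_lifting K i p) \<and>
    (\<forall>i \<in> Cofib M. \<forall>p \<in> Fib M \<inter> Weq M. has_lifting K i p) \<and>
    factorizes K (Cofib M \<inter> Weq M) (Fib M) \<and>
    factorizes K (Cofib M) (Fib M \<inter> Weq M)"

definition cofibrant :: "('o, 'm) cat \<Rightarrow> 'm model \<Rightarrow> 'o \<Rightarrow> bool" where
  "cofibrant K M x \<longleftrightarrow> (\<exists>i f. initial K i \<and> f \<in> hom K i x \<and> f \<in> Cofib M)"

definition fibrant :: "('o, 'm) cat \<Rightarrow> 'm model \<Rightarrow> 'o \<Rightarrow> bool" where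
  "fibrant K M x \<longleftrightarrow> (\<exists>t f. terminal K t \<and> f \<in> hom K x t \<and> f \<in> Fib M)"

text \<open>\<open>\<phi> x y\<close> is the bijection from arrows \<open>L x \<rightarrow> y\<close> to arrows \<open>x \<rightarrow> R y\<close>, natural in both
  variables.\<close>

definition adjunction ::
  "('o, 'm) cat \<Rightarrow> ('p, 'n) cat \<Rightarrow> ('o, 'm, 'p, 'n) fctr \<Rightarrow> ('p, 'n, 'o, 'm) fctr \<Rightarrow>
    ('o \<Rightarrow> 'p \<Rightarrow> 'n \<Rightarrow> 'm) \<Rightarrow> bool" where
  "adjunction A B L R \<phi> \<longleftrightarrow> is_functor A B L \<and> is_functor B A R \<and>
    (\<forall>x \<in> Obj A. \<forall>y \<in> Obj B. bij_betw (\<phi> x y) (hom B (fobj L x) y) (hom A x (fobj R y))) \<and>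
    (\<forall>x \<in> Obj A. \<forall>x' \<in> Obj A. \<forall>y \<in> Obj B. \<forall>y' \<in> Obj B.
      \<forall>h \<in> hom A x' x. \<forall>f \<in> hom B (fobj L x) y. \<forall>k \<in> hom B y y'.
        \<phi> x' y' (Comp B k (Comp B f (farr L h))) = Comp A (farr R k) (Comp A (\<phi> x y f) h))"

definition quillen_adjunction ::
  "('o, 'm) cat \<Rightarrow> 'm model \<Rightarrow> ('p, 'n) cat \<Rightarrow> 'n model \<Rightarrow>
    ('o, 'm, 'p, 'n) fctr \<Rightarrow> ('p, 'n, 'o, 'm) fctr \<Rightarrow> ('o \<Rightarrow> 'p \<Rightarrow> 'n \<Rightarrow> 'm) \<Rightarrow> bool" where
  "quillen_adjunction A M B N L R \<phi> \<longleftrightarrow>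
    model_structure A M \<and> model_structure B N \<and> adjunction A B L R \<phi> \<and>
    (\<forall>f \<in> Cofib M. farr L f \<in> Cofib N) \<and>
    (\<forall>f \<in> Cofib M \<inter> Weq M. farr L f \<in> Cofib N \<inter> Weq N)"

definition quillen_equivalence ::
  "('o, 'm) cat \<Rightarrow> 'm model \<Rightarrow> ('p, 'n) cat \<Rightarrow> 'n model \<Rightarrow>
    ('o, 'm, 'p, 'n) fctr \<Rightarrow> ('p, 'n, 'o, 'm) fctr \<Rightarrow> ('o \<Rightarrow> 'p \<Rightarrow> 'n \<Rightarrow> 'm) \<Rightarrow> bool" where
  "quillen_equivalence A M B N L R \<phi> \<longleftrightarrow>
    quillen_adjunction A M B N L R \<phi> \<and>
    (\<forall>x \<in> Obj A. \<forall>y \<in> Obj B. cofibrant A M x \<longrightarrow> fibrant B N y \<longrightarrow>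
      (\<forall>f \<in> hom B (fobj L x) y. f \<in> Weq N \<longleftrightarrow> \<phi> x y f \<in> Weq M))"


section \<open>The two model structures\<close>

definition discrete_fibration ::
  "('o, 'm) cat \<Rightarrow> ('p, 'n) cat \<Rightarrow> ('o, 'm, 'p, 'n) fctr \<Rightarrow> bool" where
  "discrete_fibration P C F \<longleftrightarrow> is_functor P C F \<and>
    (\<forall>a \<in> Obj P. \<forall>f \<in> Arr C. Cod C f = fobj F a \<longrightarrow>
      (\<exists>!g. g \<in> Arr P \<and> Cod P g = a \<and> farr F g = f))"

definition discfib_model :: "'u set set \<Rightarrow> 'u scat \<Rightarrow> ('u over, 'u over) mor model" where
  "discfib_model U C = (THE M. model_structure (Cat_over U C) M \<and>
    Cofib M = Arr (Cat_over U C) \<and>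
    (\<forall>p \<in> Obj (Cat_over U C).
      fibrant (Cat_over U C) M p \<longleftrightarrow> discrete_fibration (src p) C (mp p)))"

definition proj_model :: "'u set set \<Rightarrow> 'u scat \<Rightarrow> 'u pshmor model" where
  "proj_model U C = \<lparr>
    Weq = {\<alpha> \<in> Arr (presheaves U C). \<forall>c \<in> Obj C. is_iso (Set_cat U) (mp \<alpha> c)},
    Cofib = Arr (presheaves U C),
    Fib = Arr (presheaves U C)\<rparr>"


section \<open>The category of elements\<close>

text \<open>Small categories have objects and arrows in the type \<open>'u\<close>, so pairs and triples of
  elements of \<open>'u\<close> are coded as elements of \<open>'u\<close>, by a chosen injection
  \<open>'u \<times> 'u \<Rightarrow> 'u\<close>, which exists as soon as \<open>'u\<close> is infinite.\<close>

definition upair :: "'u \<Rightarrow> 'u \<Rightarrow> 'u" where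
  "upair x y = (SOME c :: 'u \<times> 'u \<Rightarrow> 'u. inj c) (x, y)"

definition ufst :: "'u \<Rightarrow> 'u" where
  "ufst z = (SOME x. \<exists>y. z = upair x y)"

definition usnd :: "'u \<Rightarrow> 'u" where
  "usnd z = (SOME y. \<exists>x. z = upair x y)"

text \<open>Code of the arrow \<open>f\<close> regarded as an arrow from \<open>s\<close> to \<open>t\<close>.\<close>

definition utriple :: "'u \<Rightarrow> 'u \<Rightarrow> 'u \<Rightarrow> 'u" where
  "utriple s f t = upair s (upair f t)"

definition usrc :: "'u \<Rightarrow> 'u" where "usrc m = ufst m"
definition uarr :: "'u \<Rightarrow> 'u" where "uarr m = ufst (usnd m)"
definition utgt :: "'u \<Rightarrow> 'u" where "utgt m = usnd (usnd m)"

definition el_obj :: "'u scat \<Rightarrow> 'u psh \<Rightarrow> 'u set" where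
  "el_obj C F = {upair c x | c x. c \<in> Obj C \<and> x \<in> fobj F c}"

definition el_arr :: "'u scat \<Rightarrow> 'u psh \<Rightarrow> 'u set" where
  "el_arr C F = {utriple (upair c x) f (upair d y) | c x f d y.
    f \<in> hom C c d \<and> x \<in> fobj F c \<and> y \<in> fobj F d \<and> x = mp (farr F f) y}"

definition el_cat :: "'u scat \<Rightarrow> 'u psh \<Rightarrow> 'u scat" where
  "el_cat C F = \<lparr>
    Obj = el_obj C F,
    Arr = el_arr C F,
    Dom = (\<lambda>m \<in> el_arr C F. usrc m),
    Cod = (\<lambda>m \<in> el_arr C F. utgt m),
    Ident = (\<lambda>z \<in> el_obj C F. utriple z (Ident C (ufst z)) z),
    Comp = (\<lambda>n m. if m \<in> el_arr C F \<and> n \<in> el_arr C F \<and> usrc n = utgt m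
      then utriple (usrc m) (Comp C (uarr n) (uarr m)) (utgt n) else undefined)\<rparr>"

definition int_obj :: "'u scat \<Rightarrow> 'u psh \<Rightarrow> 'u over" where
  "int_obj C F = Mor (el_cat C F)
    \<lparr>fobj = (\<lambda>z \<in> el_obj C F. ufst z), farr = (\<lambda>m \<in> el_arr C F. uarr m)\<rparr> C"

definition int_arr :: "'u scat \<Rightarrow> 'u pshmor \<Rightarrow> ('u over, 'u over) mor" where
  "int_arr C \<alpha> =
    (let F = src \<alpha>; G = tgt \<alpha>;
         e = (\<lambda>z. upair (ufst z) (mp (mp \<alpha> (ufst z)) (usnd z)))
     in Mor (int_obj C F)
          (Mor (el_cat C F)
            \<lparr>fobj = (\<lambda>z \<in> el_obj C F. e z),
             farr = (\<lambda>m \<in> el_arr C F. utriple (e (usrc m)) (uarr m) (e (utgt m)))\<rparr>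
            (el_cat C G))
          (int_obj C G))"

definition int_functor ::
  "'u scat \<Rightarrow> ('u psh, 'u pshmor, 'u over, ('u over, 'u over) mor) fctr" where
  "int_functor C = \<lparr>fobj = int_obj C, farr = int_arr C\<rparr>"


section \<open>Its left adjoint\<close>

definition comma :: "'u over \<Rightarrow> 'u \<Rightarrow> ('u \<times> 'u, ('u \<times> 'u, 'u) mor) cat" where
  "comma p c = (let P = src p; F = mp p; C = tgt p;
      obs = {(a, f). a \<in> Obj P \<and> f \<in> hom C c (fobj F a)}
    in \<lparr>Obj = obs,
        Arr = {Mor (a', f') g (a, f) | a' f' g a f. (a', f') \<in> obs \<and> (a, f) \<in> obs \<and>
          g \<in> hom P a' a \<and> f = Comp C (farr F g) f'},
        Dom = src, Cod = tgt,
        Ident = (\<lambda>x. Mor x (Ident P (fst x)) x),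
        Comp = (\<lambda>h g. Mor (src g) (Comp P (mp h) (mp g)) (tgt h))\<rparr>)"

text \<open>Two objects lie in the same connected component if they are joined by a zigzag of arrows.\<close>

definition connected_rel :: "('o, 'm) cat \<Rightarrow> ('o \<times> 'o) set" where
  "connected_rel K = {(x, y). x \<in> Obj K \<and> y \<in> Obj K \<and>
    (x, y) \<in> ({(Dom K f, Cod K f) | f. f \<in> Arr K} \<union> {(Cod K f, Dom K f) | f. f \<in> Arr K})\<^sup>*}"

definition pi0 :: "('o, 'm) cat \<Rightarrow> 'o set set" where
  "pi0 K = Obj K // connected_rel K"

text \<open>The map \<open>pi0 A \<Rightarrow> pi0 B\<close> induced by a functor \<open>A \<Rightarrow> B\<close> with object part \<open>t\<close>; the component of
  \<open>x\<close> goes to the component of \<open>t x\<close>.\<close>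

definition pi0_map :: "('p, 'n) cat \<Rightarrow> ('o \<Rightarrow> 'p) \<Rightarrow> 'o set \<Rightarrow> 'p set" where
  "pi0_map B t X = connected_rel B `` (t ` X)"

text \<open>A component of a comma category is a set of pairs.  To make the set of components a set of
  elements of \<open>'u\<close>, a component is coded by (the code of) a chosen element of it; this is injective
  because distinct components are disjoint.  \<open>coded\<close> transports a map of components along this
  coding.\<close>

definition code0 :: "('u \<times> 'u) set \<Rightarrow> 'u" where
  "code0 X = (case (SOME x. x \<in> X) of (a, f) \<Rightarrow> upair a f)"

definition T_set :: "'u over \<Rightarrow> 'u \<Rightarrow> 'u set" where
  "T_set p c = code0 ` pi0 (comma p c)"

definition coded ::
  "'u over \<Rightarrow> 'u \<Rightarrow> 'u over \<Rightarrow> 'u \<Rightarrow> ('u \<times> 'u \<Rightarrow> 'u \<times> 'u) \<Rightarrow> ('u set, 'u \<Rightarrow> 'u) mor" where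
  "coded p c q d t = Mor (T_set p c)
    (\<lambda>z \<in> T_set p c. code0 (pi0_map (comma q d) t (inv_into (pi0 (comma p c)) code0 z)))
    (T_set q d)"

definition T_obj :: "'u scat \<Rightarrow> 'u over \<Rightarrow> 'u psh" where
  "T_obj C p = \<lparr>
    fobj = (\<lambda>c \<in> Obj C. T_set p c),
    farr = (\<lambda>f \<in> Arr C. coded p (Cod C f) p (Dom C f) (\<lambda>(a, g). (a, Comp C g f)))\<rparr>"

definition T_arr :: "'u scat \<Rightarrow> ('u over, 'u over) mor \<Rightarrow> 'u pshmor" where
  "T_arr C h = (let p = src h; q = tgt h; H = mp (mp h) in
    Mor (T_obj C p)
      (\<lambda>c \<in> Obj C. coded p c q c (\<lambda>(a, g). (fobj H a, g)))
      (T_obj C q))"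

definition T_functor ::
  "'u scat \<Rightarrow> ('u over, ('u over, 'u over) mor, 'u psh, 'u pshmor) fctr" where
  "T_functor C = \<lparr>fobj = T_obj C, farr = T_arr C\<rparr>"

end

theory Submission
  imports Defs
begin

(* Let D be the class of discrete fibrations over C, and call an arrow over C a local equivalence
   if precomposition with it is bijective on arrows into every object of D.  An arrow from P to
   the category of elements of F is the same as a section a |-> s a in F (P a) that is compatible
   with restriction along the arrows of P.  Hence the components of the pairs (a, id) define a
   universal arrow from P to the category of elements of T P, which gives the adjunction.  The
   right adjoint is fully faithful with essential image D, so every unit is a local equivalence.

   Any model structure in which all maps are cofibrations and the fibrant objects are those of D
   has the local equivalences as weak equivalences: weak equivalences between fibrant objects are
   isomorphisms, and every local equivalence into an object of D is weak.  Conversely, local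
   equivalences and the maps with the right lifting property against them form such a structure
   as soon as every arrow x -> y factors accordingly.  The middle object is a full subcategory of
   the fibre product of y with the reflection of x, over C.

   On presheaves the weak equivalences are the isomorphisms, so that a transpose R f o eta is a
   local equivalence iff R f is one, iff R f is an isomorphism, iff f is one. *)

section \<open>Local equivalences and their model structure\<close>

text \<open>The obstacle is the factorization. \<open>discfib_model\<close> is a \<open>THE\<close>,
  so the structure has to be constructed as well as shown to be unique, and every x -> y must split
  into a local equivalence followed by an arrow that lifts against all of them. With e the
  reflection of x, the projection to y of the fibre product P of y and e over C does lift against
  local equivalences, but x -> P need not be one: arrows from x to an object of D extend to P, by
  way of e, yet the extension need not be unique. The middle object is therefore cut down to the
  largest full subcategory of P that contains the image of x and on which extensions are unique. A
  largest one exists because functors over C into a discrete fibration are determined on objects, so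
  that uniqueness passes to unions of object sets. Maximality then gives the lifting: a candidate
  diagonal into P is built from the bottom edge of the square and an extension to e, and adding its
  image to the subcategory preserves uniqueness, so the image was already inside.\<close>

lemma bij_betw_iff_ex1: "bij_betw f A B \<longleftrightarrow> f \<in> A \<rightarrow> B \<and> (\<forall>b\<in>B. \<exists>!a. a \<in> A \<and> f a = b)"
  unfolding bij_betw_def inj_on_def by (auto; metis imageE)

definition local_equivs :: "('o, 'm) cat \<Rightarrow> 'o set \<Rightarrow> 'm set" where
  "local_equivs K D = {f \<in> Arr K. \<forall>z\<in>D.
    bij_betw (\<lambda>u. Comp K u f) (hom K (Cod K f) z) (hom K (Dom K f) z)}"

definition rlp :: "('o, 'm) cat \<Rightarrow> 'm set \<Rightarrow> 'm set" where
  "rlp K S = {p \<in> Arr K. \<forall>i\<in>S. has_lifting K i p}"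

text \<open>With every arrow a cofibration, the trivial cofibrations are all of the weak
  equivalences, so the fibrations can only be their right lifting class.\<close>

definition local_model :: "('o, 'm) cat \<Rightarrow> 'o set \<Rightarrow> 'm model" where
  "local_model K D = \<lparr>Weq = local_equivs K D, Cofib = Arr K, Fib = rlp K (local_equivs K D)\<rparr>"

lemma hom_arr: "f \<in> Arr K \<Longrightarrow> f \<in> hom K (Dom K f) (Cod K f)"
  by (simp add: hom_def)

lemma homD: "f \<in> hom K a b \<Longrightarrow> f \<in> Arr K" "f \<in> hom K a b \<Longrightarrow> Dom K f = a"
  "f \<in> hom K a b \<Longrightarrow> Cod K f = b"
  by (auto simp: hom_def)

lemma has_liftingI:
  assumes "\<And>u v. u \<in> hom K (Dom K i) (Dom K p) \<Longrightarrow> v \<in> hom K (Cod K i) (Cod K p) \<Longrightarrow>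
    Comp K p u = Comp K v i \<Longrightarrow>
    \<exists>h \<in> hom K (Cod K i) (Dom K p). Comp K h i = u \<and> Comp K p h = v"
  shows "has_lifting K i p"
  using assms by (auto simp: has_lifting_def)

lemma has_liftingE:
  assumes "has_lifting K i p" "i \<in> hom K a b" "p \<in> hom K c d" "u \<in> hom K a c" "v \<in> hom K b d"
    "Comp K p u = Comp K v i"
  obtains h where "h \<in> hom K b c" "Comp K h i = u" "Comp K p h = v"
proof -
  have "\<exists>h\<in>hom K b c. Comp K h i = u \<and> Comp K p h = v"
    using assms(1,4-6) homD[OF assms(2)] homD[OF assms(3)] unfolding has_lifting_def by blast
  then show ?thesis using that by blast
qed

lemma rlpD: "p \<in> rlp K S \<Longrightarrow> i \<in> S \<Longrightarrow> has_lifting K i p"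
  by (simp add: rlp_def)

section \<open>Isomorphisms, retracts and lifting in a category\<close>

context category
begin

lemma hom_obj: "f \<in> hom K a b \<Longrightarrow> a \<in> Obj K" "f \<in> hom K a b \<Longrightarrow> b \<in> Obj K"
  using dom_obj cod_obj by (auto simp: hom_def)

lemma is_isoI:
  assumes "f \<in> hom K a b" "g \<in> hom K b a" "Comp K g f = Ident K a" "Comp K f g = Ident K b"
  shows "is_iso K f"
  using assms by (auto simp: is_iso_def hom_def)

lemma is_isoE:
  assumes "is_iso K f" "f \<in> hom K a b"
  obtains g where "g \<in> hom K b a" "Comp K g f = Ident K a" "Comp K f g = Ident K b"
  using assms by (auto simp: is_iso_def hom_def)

lemma is_iso_ident: "a \<in> Obj K \<Longrightarrow> is_iso K (Ident K a)"
  by (rule is_isoI[where g="Ident K a" and a=a and b=a]) (auto intro: ident_hom ident_left)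

text \<open>A left inverse g and a right inverse h coincide, since both equal the composite g f
  h.\<close>

lemma is_iso_two_sided:
  assumes f: "f \<in> hom K a b" and g: "g \<in> hom K b a" and h: "h \<in> hom K b a"
    and "Comp K g f = Ident K a" "Comp K f h = Ident K b"
  shows "is_iso K f"
proof -
  have "g = Comp K g (Comp K f h)" using assms ident_right by simp
  also have "\<dots> = h" using assms assoc[OF h f g] ident_left[OF h] by simp
  finally show ?thesis using assms by (auto intro: is_isoI)
qed

lemma is_iso_comp:
  assumes "is_iso K f" "is_iso K g" and f: "f \<in> hom K a b" and g: "g \<in> hom K b c"
  shows "is_iso K (Comp K g f)"
proof -
  obtain f' where f': "f' \<in> hom K b a" "Comp K f' f = Ident K a" "Comp K f f' = Ident K b"
    using is_isoE assms by metis
  obtain g' where g': "g' \<in> hom K c b" "Comp K g' g = Ident K b" "Comp K g g' = Ident K c"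
    using is_isoE assms by metis
  show ?thesis
  proof (rule is_isoI)
    show "Comp K g f \<in> hom K a c" "Comp K f' g' \<in> hom K c a"
      using f g f' g' comp_hom by auto
    show "Comp K (Comp K f' g') (Comp K g f) = Ident K a"
      using assoc[OF comp_hom[OF f g] g'(1) f'(1)] assoc[OF f g g'(1)] f' g' ident_left[OF f]
      by simp
    show "Comp K (Comp K g f) (Comp K f' g') = Ident K c"
      using assoc[OF comp_hom[OF g'(1) f'(1)] f g] assoc[OF g'(1) f'(1) f] f' g'
        ident_left[OF g'(1)] by simp
  qed
qed

lemma is_iso_cancel_right:
  assumes "is_iso K f" "is_iso K (Comp K g f)" and f: "f \<in> hom K a b" and g: "g \<in> hom K b c"
  shows "is_iso K g"
proof -
  obtain f' where f': "f' \<in> hom K b a" "Comp K f' f = Ident K a" "Comp K f f' = Ident K b"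
    using is_isoE assms by metis
  have "is_iso K f'" using f f' by (auto intro: is_isoI)
  then have "is_iso K (Comp K (Comp K g f) f')"
    using is_iso_comp assms f'(1) comp_hom by metis
  then show ?thesis using assoc[OF f'(1) f g] f' ident_right[OF g] by simp
qed

lemma is_iso_cancel_left:
  assumes "is_iso K g" "is_iso K (Comp K g f)" and f: "f \<in> hom K a b" and g: "g \<in> hom K b c"
  shows "is_iso K f"
proof -
  obtain g' where g': "g' \<in> hom K c b" "Comp K g' g = Ident K b" "Comp K g g' = Ident K c"
    using is_isoE assms by metis
  have "is_iso K g'" using g g' by (auto intro: is_isoI)
  then have "is_iso K (Comp K g' (Comp K g f))"
    using is_iso_comp assms g'(1) comp_hom by metis
  then show ?thesis using assoc[OF f g g'(1)] g' ident_left[OF f] by simp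
qed

lemma is_iso_retract:
  assumes "is_iso K g" "f \<in> Arr K" "retract_of K f g" "g \<in> Arr K"
  shows "is_iso K f"
proof -
  obtain i r j s where
    i: "i \<in> hom K (Dom K f) (Dom K g)" and r: "r \<in> hom K (Dom K g) (Dom K f)" and
    j: "j \<in> hom K (Cod K f) (Cod K g)" and s: "s \<in> hom K (Cod K g) (Cod K f)" and
    e: "Comp K r i = Ident K (Dom K f)" "Comp K s j = Ident K (Cod K f)"
      "Comp K g i = Comp K j f" "Comp K f r = Comp K s g"
    using assms(3) by (auto simp: retract_of_def)
  note f = hom_arr[OF assms(2)] and g = hom_arr[OF assms(4)]
  obtain g' where g': "g' \<in> hom K (Cod K g) (Dom K g)" "Comp K g' g = Ident K (Dom K g)"
    "Comp K g g' = Ident K (Cod K g)" using is_isoE assms(1) g by metis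
  \<comment> \<open>The inverse of g is carried over to f by the retract data: j into the codomain
    of g, back along the inverse, then r.\<close>
  let ?f' = "Comp K r (Comp K g' j)"
  have f': "?f' \<in> hom K (Cod K f) (Dom K f)" using r g' j comp_hom by blast
  have "Comp K ?f' f = Comp K r (Comp K g' (Comp K j f))"
    using assoc[OF f comp_hom[OF j g'(1)] r] assoc[OF f j g'(1)] by simp
  also have "\<dots> = Comp K r (Comp K (Comp K g' g) i)" using e assoc[OF i g g'(1)] by simp
  also have "\<dots> = Ident K (Dom K f)" using g' e ident_left[OF i] by simp
  finally have 1: "Comp K ?f' f = Ident K (Dom K f)" .
  have "Comp K f ?f' = Comp K (Comp K f r) (Comp K g' j)"
    using assoc[OF comp_hom[OF j g'(1)] r f] by simp
  also have "\<dots> = Comp K s (Comp K (Comp K g g') j)"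
    using e assoc[OF comp_hom[OF j g'(1)] g s] assoc[OF j g'(1) g] by simp
  also have "\<dots> = Ident K (Cod K f)" using g' e ident_left[OF j] by simp
  finally show ?thesis using 1 f f' is_isoI by blast
qed

lemma iso_has_lifting_right:
  assumes "is_iso K p" "i \<in> Arr K"
  shows "has_lifting K i p"
proof (rule has_liftingI)
  fix u v assume u: "u \<in> hom K (Dom K i) (Dom K p)" and v: "v \<in> hom K (Cod K i) (Cod K p)"
    and eq: "Comp K p u = Comp K v i"
  note i = hom_arr[OF assms(2)]
  have p: "p \<in> hom K (Dom K p) (Cod K p)" using assms by (simp add: is_iso_def hom_arr)
  obtain q where q: "q \<in> hom K (Cod K p) (Dom K p)" "Comp K q p = Ident K (Dom K p)"
    "Comp K p q = Ident K (Cod K p)" using is_isoE assms(1) p by metis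
  have "Comp K (Comp K q v) i = Comp K q (Comp K p u)"
    using assoc[OF i v q(1)] eq by simp
  also have "\<dots> = u" using assoc[OF u p q(1)] q ident_left[OF u] by simp
  finally have "Comp K (Comp K q v) i = u" .
  moreover have "Comp K p (Comp K q v) = v" using assoc[OF v q(1) p] q ident_left[OF v] by simp
  ultimately show "\<exists>h \<in> hom K (Cod K i) (Dom K p). Comp K h i = u \<and> Comp K p h = v"
    using comp_hom[OF v q(1)] by blast
qed

lemma iso_has_lifting_left:
  assumes "is_iso K i" "p \<in> Arr K"
  shows "has_lifting K i p"
proof (rule has_liftingI)
  fix u v assume u: "u \<in> hom K (Dom K i) (Dom K p)" and v: "v \<in> hom K (Cod K i) (Cod K p)"
    and eq: "Comp K p u = Comp K v i"
  note p = hom_arr[OF assms(2)]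
  have i: "i \<in> hom K (Dom K i) (Cod K i)" using assms by (simp add: is_iso_def hom_arr)
  obtain q where q: "q \<in> hom K (Cod K i) (Dom K i)" "Comp K q i = Ident K (Dom K i)"
    "Comp K i q = Ident K (Cod K i)" using is_isoE assms(1) i by metis
  have "Comp K p (Comp K u q) = Comp K (Comp K v i) q"
    using assoc[OF q(1) u p] eq by simp
  also have "\<dots> = v" using assoc[OF q(1) i v] q ident_right[OF v] by simp
  finally have "Comp K p (Comp K u q) = v" .
  moreover have "Comp K (Comp K u q) i = u" using assoc[OF i q(1) u] q ident_right[OF u] by simp
  ultimately show "\<exists>h \<in> hom K (Cod K i) (Dom K p). Comp K h i = u \<and> Comp K p h = v"
    using comp_hom[OF q(1) u] by blast
qed

text \<open>A diagonal of the square with p on both sides and identities on top and bottom is an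
  inverse of p. This is how trivial fibrations become isomorphisms once every arrow is a
  cofibration.\<close>

lemma self_lifting_iso:
  assumes "p \<in> Arr K" "has_lifting K p p"
  shows "is_iso K p"
proof -
  have "Comp K p (Ident K (Dom K p)) = Comp K (Ident K (Cod K p)) p"
    using ident_left ident_right hom_arr[OF assms(1)] by simp
  then obtain h where "h \<in> hom K (Cod K p) (Dom K p)" "Comp K h p = Ident K (Dom K p)"
    "Comp K p h = Ident K (Cod K p)"
    using assms dom_obj cod_obj ident_hom unfolding has_lifting_def by meson
  then show ?thesis using is_isoI hom_arr assms(1) by metis
qed

text \<open>A lifting problem for f is pushed along i and j to one for g, solved there, and the
  solution is brought back along r.\<close>

lemma retract_rlp:
  assumes "g \<in> rlp K S" "S \<subseteq> Arr K" "f \<in> Arr K" "retract_of K f g"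
  shows "f \<in> rlp K S"
proof -
  have g: "g \<in> hom K (Dom K g) (Cod K g)" using assms by (simp add: rlp_def hom_arr)
  note f = hom_arr[OF assms(3)]
  obtain i r j s where
    i: "i \<in> hom K (Dom K f) (Dom K g)" and r: "r \<in> hom K (Dom K g) (Dom K f)" and
    j: "j \<in> hom K (Cod K f) (Cod K g)" and s: "s \<in> hom K (Cod K g) (Cod K f)" and
    e: "Comp K r i = Ident K (Dom K f)" "Comp K s j = Ident K (Cod K f)"
      "Comp K g i = Comp K j f" "Comp K f r = Comp K s g"
    using assms(4) by (auto simp: retract_of_def)
  have "has_lifting K l f" if lS: "l \<in> S" for l
  proof (rule has_liftingI)
    fix u v assume u: "u \<in> hom K (Dom K l) (Dom K f)" and v: "v \<in> hom K (Cod K l) (Cod K f)"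
      and eq: "Comp K f u = Comp K v l"
    have l: "l \<in> hom K (Dom K l) (Cod K l)" using lS assms by (auto simp: hom_arr)
    have "Comp K g (Comp K i u) = Comp K (Comp K j f) u" using assoc[OF u i g] e by simp
    also have "\<dots> = Comp K (Comp K j v) l" using assoc[OF u f j] assoc[OF l v j] eq by simp
    finally obtain h where h: "h \<in> hom K (Cod K l) (Dom K g)" "Comp K h l = Comp K i u"
      "Comp K g h = Comp K j v"
      using has_liftingE[OF rlpD[OF assms(1) lS] l g comp_hom[OF u i] comp_hom[OF v j]]
      by blast
    have "Comp K (Comp K r h) l = u"
      using assoc[OF l h(1) r] h assoc[OF u i r] e ident_left[OF u] by simp
    moreover have "Comp K f (Comp K r h) = v"
      using assoc[OF h(1) r f] e assoc[OF h(1) g s] h assoc[OF v j s] ident_left[OF v] by simp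
    ultimately show "\<exists>h \<in> hom K (Cod K l) (Dom K f). Comp K h l = u \<and> Comp K f h = v"
      using comp_hom[OF h(1) r] by blast
  qed
  then show ?thesis using assms by (simp add: rlp_def)
qed

text \<open>The lift is found in two stages: first against q, then against p with the first lift as
  bottom edge.\<close>

lemma rlp_comp:
  assumes "p \<in> rlp K S" "q \<in> rlp K S" "S \<subseteq> Arr K" and p: "p \<in> hom K a b" and q: "q \<in> hom K b c"
  shows "Comp K q p \<in> rlp K S"
proof -
  note qp = comp_hom[OF p q]
  have "has_lifting K l (Comp K q p)" if lS: "l \<in> S" for l
  proof (rule has_liftingI, unfold homD[OF qp])
    fix u v assume u: "u \<in> hom K (Dom K l) a" and v: "v \<in> hom K (Cod K l) c"
      and eq: "Comp K (Comp K q p) u = Comp K v l"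
    have l: "l \<in> hom K (Dom K l) (Cod K l)" using lS assms by (auto simp: hom_arr)
    have "Comp K q (Comp K p u) = Comp K v l" using assoc[OF u p q] eq by simp
    then obtain h where h: "h \<in> hom K (Cod K l) b" "Comp K h l = Comp K p u" "Comp K q h = v"
      using has_liftingE[OF rlpD[OF assms(2) lS] l q comp_hom[OF u p] v] by blast
    then obtain k where k: "k \<in> hom K (Cod K l) a" "Comp K k l = u" "Comp K p k = h"
      using has_liftingE[OF rlpD[OF assms(1) lS] l p u h(1)] by metis
    have "Comp K (Comp K q p) k = v" using assoc[OF k(1) p q] k h by simp
    then show "\<exists>h \<in> hom K (Cod K l) a. Comp K h l = u \<and> Comp K (Comp K q p) h = v"
      using k by blast
  qed
  then show ?thesis using qp by (simp add: rlp_def homD)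
qed

section \<open>Closure properties of local equivalences for an arbitrary class D\<close>

lemma local_equivsI:
  assumes "f \<in> hom K a b"
    "\<And>z u v. z \<in> D \<Longrightarrow> u \<in> hom K b z \<Longrightarrow> v \<in> hom K b z \<Longrightarrow> Comp K u f = Comp K v f \<Longrightarrow> u = v"
    "\<And>z t. z \<in> D \<Longrightarrow> t \<in> hom K a z \<Longrightarrow> \<exists>u\<in>hom K b z. Comp K u f = t"
  shows "f \<in> local_equivs K D"
  using assms comp_hom unfolding local_equivs_def bij_betw_def inj_on_def
  by (auto simp: hom_def image_iff; metis)

lemma local_equivs_inj:
  assumes "f \<in> local_equivs K D" "f \<in> hom K a b" "z \<in> D" "u \<in> hom K b z" "v \<in> hom K b z"
    "Comp K u f = Comp K v f"
  shows "u = v"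
  using assms unfolding local_equivs_def bij_betw_def inj_on_def by (auto simp: hom_def)

lemma local_equivs_ex:
  assumes "f \<in> local_equivs K D" "f \<in> hom K a b" "z \<in> D" "t \<in> hom K a z"
  obtains u where "u \<in> hom K b z" "Comp K u f = t"
proof -
  have "t \<in> (\<lambda>u. Comp K u f) ` hom K b z"
    using assms homD[OF assms(2)] unfolding local_equivs_def bij_betw_def by auto
  then show ?thesis using that by auto
qed

lemma local_equivs_arr: "local_equivs K D \<subseteq> Arr K"
  by (auto simp: local_equivs_def)

text \<open>Precomposition with g f is precomposition with g followed by precomposition with f, so
  the claim is two-out-of-three for bijections of hom sets.\<close>

lemma two_of_three_local: "two_of_three K (local_equivs K D)"
  unfolding two_of_three_def
proof (intro ballI impI)
  fix f g assume fa: "f \<in> Arr K" and ga: "g \<in> Arr K" and dc: "Dom K g = Cod K f"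
  define a b c where "a = Dom K f" and "b = Cod K f" and "c = Cod K g"
  have f: "f \<in> hom K a b" and g: "g \<in> hom K b c"
    using fa ga dc by (auto simp: hom_def a_def b_def c_def)
  note gf = comp_hom[OF f g]
  have F: "(\<lambda>u. Comp K u g) ` hom K c z \<subseteq> hom K b z" for z using comp_hom[OF g] by blast
  have *: "bij_betw (\<lambda>u. Comp K u (Comp K g f)) (hom K c z) (hom K a z) \<longleftrightarrow>
    bij_betw ((\<lambda>u. Comp K u f) \<circ> (\<lambda>u. Comp K u g)) (hom K c z) (hom K a z)" for z
    by (rule bij_betw_cong) (simp add: assoc[OF f g])
  have a: "bij_betw (\<lambda>u. Comp K u g) (hom K c z) (hom K b z) \<Longrightarrow>
    bij_betw (\<lambda>u. Comp K u f) (hom K b z) (hom K a z) \<longleftrightarrow>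
    bij_betw (\<lambda>u. Comp K u (Comp K g f)) (hom K c z) (hom K a z)" for z
    unfolding * by (rule bij_betw_comp_iff)
  have b: "bij_betw (\<lambda>u. Comp K u f) (hom K b z) (hom K a z) \<Longrightarrow>
    bij_betw (\<lambda>u. Comp K u g) (hom K c z) (hom K b z) \<longleftrightarrow>
    bij_betw (\<lambda>u. Comp K u (Comp K g f)) (hom K c z) (hom K a z)" for z
    unfolding * by (rule bij_betw_comp_iff2[OF _ F])
  show "(f \<in> local_equivs K D \<and> g \<in> local_equivs K D \<longrightarrow> Comp K g f \<in> local_equivs K D) \<and>
      (f \<in> local_equivs K D \<and> Comp K g f \<in> local_equivs K D \<longrightarrow> g \<in> local_equivs K D) \<and>
      (g \<in> local_equivs K D \<and> Comp K g f \<in> local_equivs K D \<longrightarrow> f \<in> local_equivs K D)"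
    unfolding local_equivs_def mem_Collect_eq homD[OF f] homD[OF g] homD[OF gf]
    using a b fa ga homD(1)[OF gf] by blast
qed

text \<open>Injectivity is tested after composing with s, where the property of g applies, and s is
  then cancelled by its section j. An extension of t along f is an extension of t r along g,
  restricted along j.\<close>

lemma retract_closed_local: "retract_closed K (local_equivs K D)"
  unfolding retract_closed_def
proof (intro ballI impI)
  fix f g assume fa: "f \<in> Arr K" and gl: "g \<in> local_equivs K D" and ret: "retract_of K f g"
  obtain i r j s where
    i: "i \<in> hom K (Dom K f) (Dom K g)" and r: "r \<in> hom K (Dom K g) (Dom K f)" and
    j: "j \<in> hom K (Cod K f) (Cod K g)" and s: "s \<in> hom K (Cod K g) (Cod K f)" and
    e: "Comp K r i = Ident K (Dom K f)" "Comp K s j = Ident K (Cod K f)"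
      "Comp K g i = Comp K j f" "Comp K f r = Comp K s g"
    using ret by (auto simp: retract_of_def)
  note f = hom_arr[OF fa]
  have g: "g \<in> hom K (Dom K g) (Cod K g)" using gl by (simp add: hom_arr local_equivs_def)
  show "f \<in> local_equivs K D"
  proof (rule local_equivsI[OF f])
    fix z u v assume z: "z \<in> D" and u: "u \<in> hom K (Cod K f) z" and v: "v \<in> hom K (Cod K f) z"
      and eq: "Comp K u f = Comp K v f"
    have "Comp K (Comp K u s) g = Comp K (Comp K u f) r"
      by (simp only: assoc[OF g s u, symmetric] e(4)[symmetric] assoc[OF r f u])
    moreover have "Comp K (Comp K v s) g = Comp K (Comp K v f) r"
      by (simp only: assoc[OF g s v, symmetric] e(4)[symmetric] assoc[OF r f v])
    ultimately have "Comp K (Comp K u s) g = Comp K (Comp K v s) g" using eq by simp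
    then have "Comp K u s = Comp K v s"
      using local_equivs_inj[OF gl g z] comp_hom[OF s] u v by blast
    then show "u = v"
      using assoc[OF j s u] assoc[OF j s v] e ident_right[OF u] ident_right[OF v] by simp
  next
    fix z t assume z: "z \<in> D" and t: "t \<in> hom K (Dom K f) z"
    obtain u where u: "u \<in> hom K (Cod K g) z" "Comp K u g = Comp K t r"
      using local_equivs_ex[OF gl g z comp_hom[OF r t]] by blast
    have "Comp K (Comp K u j) f = Comp K (Comp K u g) i"
      by (simp only: assoc[OF f j u(1), symmetric] e(3)[symmetric] assoc[OF i g u(1)])
    also have "\<dots> = t" using u(2) assoc[OF i r t] e(1) ident_right[OF t] by simp
    finally have "Comp K (Comp K u j) f = t" .
    then show "\<exists>u\<in>hom K (Cod K f) z. Comp K u f = t" using comp_hom[OF j u(1)] by blast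
  qed
qed

lemma iso_local_equiv:
  assumes "is_iso K f"
  shows "f \<in> local_equivs K D"
proof -
  have f: "f \<in> hom K (Dom K f) (Cod K f)" using assms by (simp add: is_iso_def hom_arr)
  obtain g where g: "g \<in> hom K (Cod K f) (Dom K f)" "Comp K g f = Ident K (Dom K f)"
    "Comp K f g = Ident K (Cod K f)" using is_isoE assms f by metis
  show ?thesis
  proof (rule local_equivsI[OF f])
    fix z u v assume u: "u \<in> hom K (Cod K f) z" and v: "v \<in> hom K (Cod K f) z"
      and eq: "Comp K u f = Comp K v f"
    then show "u = v"
      using assoc[OF g(1) f u] assoc[OF g(1) f v] g ident_right[OF u] ident_right[OF v] by simp
  next
    fix z t assume t: "t \<in> hom K (Dom K f) z"
    show "\<exists>u\<in>hom K (Cod K f) z. Comp K u f = t"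
      by (rule bexI[OF _ comp_hom[OF g(1) t]])
        (use assoc[OF f g(1) t] g ident_right[OF t] in simp)
  qed
qed

text \<open>The identity of a extends along f because a lies in D, which gives a left inverse; it is
  also a right inverse because extensions along f into b are unique.\<close>

lemma local_equiv_local_objects_iso:
  assumes f: "f \<in> hom K a b" and W: "f \<in> local_equivs K D" and "a \<in> D" "b \<in> D"
  shows "is_iso K f"
proof -
  have o: "a \<in> Obj K" "b \<in> Obj K" using hom_obj f by auto
  obtain g where g: "g \<in> hom K b a" "Comp K g f = Ident K a"
    using local_equivs_ex[OF W f \<open>a \<in> D\<close> ident_hom[OF o(1)]] by blast
  have "Comp K (Comp K f g) f = Comp K (Ident K b) f"
    using assoc[OF f g(1) f] g ident_left[OF f] ident_right[OF f] by simp
  then have "Comp K f g = Ident K b"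
    using local_equivs_inj[OF W f \<open>b \<in> D\<close>] comp_hom[OF g(1) f] ident_hom[OF o(2)] by blast
  then show ?thesis using f g is_isoI by blast
qed

section \<open>The local model structure, its fibrant objects and its uniqueness\<close>

lemma retract_closed_all: "retract_closed K (Arr K)"
  by (auto simp: retract_closed_def)

text \<open>All axioms except the assumed factorization hold for an arbitrary D. A local equivalence
  in the lifting class lifts against itself, hence is an isomorphism; so the other factorization is
  f followed by an identity.\<close>

lemma model_structure_local:
  assumes "factorizes K (local_equivs K D) (rlp K (local_equivs K D))"
  shows "model_structure K (local_model K D)"
proof -
  let ?W = "local_equivs K D"
  have iso: "is_iso K p" if "p \<in> rlp K ?W \<inter> ?W" for p
    using that self_lifting_iso by (auto simp: rlp_def)
  have fac: "factorizes K (Arr K) (rlp K ?W \<inter> ?W)"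
    unfolding factorizes_def
  proof
    fix f assume f: "f \<in> Arr K"
    let ?i = "Ident K (Cod K f)"
    have i: "is_iso K ?i" using f cod_obj is_iso_ident by blast
    then have "?i \<in> rlp K ?W" "?i \<in> ?W"
      using iso_local_equiv iso_has_lifting_right[OF i] local_equivs_arr
      unfolding rlp_def by blast+
    then have "?i \<in> rlp K ?W \<inter> ?W" by simp
    moreover have "Dom K ?i = Cod K f" "Comp K ?i f = f"
      using ident_hom[OF cod_obj[OF f]] ident_left[OF hom_arr[OF f]] by (auto simp: hom_def)
    ultimately show "\<exists>i\<in>Arr K. \<exists>p\<in>rlp K ?W \<inter> ?W. Cod K i = Dom K p \<and> Comp K p i = f"
      using f by metis
  qed
  have "retract_closed K (rlp K ?W)"
    using retract_rlp local_equivs_arr by (auto simp: retract_closed_def)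
  moreover have "Arr K \<inter> ?W = ?W" "rlp K ?W \<subseteq> Arr K" using local_equivs_arr by (auto simp: rlp_def)
  moreover have "\<forall>i\<in>Arr K. \<forall>p\<in>rlp K ?W \<inter> ?W. has_lifting K i p"
    using iso iso_has_lifting_right by blast
  ultimately show ?thesis
    using fac assms two_of_three_local retract_closed_local retract_closed_all
      category_axioms local_equivs_arr
    unfolding model_structure_def local_model_def by (simp add: rlp_def)
qed

text \<open>Parallel arrows into a terminal object agree, so the square commutes by itself and the
  lower triangle is automatic; lifting against i is then mere extension along i.\<close>

lemma fibrant_iff_lifting:
  assumes t: "terminal K t"
    and F: "Fib M = rlp K S" "S \<subseteq> Arr K" and z: "z \<in> Obj K"
  shows "fibrant K M z \<longleftrightarrow> (\<forall>i\<in>S. \<forall>u\<in>hom K (Dom K i) z. \<exists>h\<in>hom K (Cod K i) z. Comp K h i = u)"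
proof -
  \<comment> \<open>\<open>fibrant\<close> asks only for some terminal object, so the claim is made
    for every terminal t and not just for the given one.\<close>
  have lift: "has_lifting K i f \<longleftrightarrow> (\<forall>u\<in>hom K (Dom K i) z. \<exists>h\<in>hom K (Cod K i) z. Comp K h i = u)"
    if t: "terminal K t" and f: "f \<in> hom K z t" and i: "i \<in> S" for t f i
  proof -
    have i': "i \<in> hom K (Dom K i) (Cod K i)" using i F(2) by (auto simp: hom_arr)
    have uniq: "g = g'" if "g \<in> hom K x t" "g' \<in> hom K x t" for g g' x
      using t that hom_obj unfolding terminal_def by blast
    obtain v where v: "v \<in> hom K (Cod K i) t" using t hom_obj[OF i'] unfolding terminal_def by blast
    have "Comp K f u = Comp K v' i" if "u \<in> hom K (Dom K i) z" "v' \<in> hom K (Cod K i) t" for u v'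
      using uniq comp_hom[OF that(1) f] comp_hom[OF i' that(2)] by blast
    moreover have "Comp K f h = v'" if "h \<in> hom K (Cod K i) z" "v' \<in> hom K (Cod K i) t" for h v'
      using uniq comp_hom[OF that(1) f] that(2) by blast
    ultimately show ?thesis
      unfolding has_lifting_def homD[OF f] using v by blast
  qed
  obtain f where f: "f \<in> hom K z t" using t z unfolding terminal_def by blast
  show ?thesis
  proof
    assume "fibrant K M z"
    then show "\<forall>i\<in>S. \<forall>u\<in>hom K (Dom K i) z. \<exists>h\<in>hom K (Cod K i) z. Comp K h i = u"
      using lift unfolding fibrant_def F(1) rlp_def by blast
  next
    assume R: "\<forall>i\<in>S. \<forall>u\<in>hom K (Dom K i) z. \<exists>h\<in>hom K (Cod K i) z. Comp K h i = u"
    then have "f \<in> rlp K S" using lift[OF t f] homD(1)[OF f] by (auto simp: rlp_def)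
    then show "fibrant K M z" using t f unfolding fibrant_def F(1) by blast
  qed
qed

text \<open>For fibrant z the identity extends along the reflection z -> e, and the extension
  inverts the reflection because self-maps of e are determined by their restriction to z.
  Conversely, objects of D have extensions by the definition of local equivalence.\<close>

lemma fibrant_local_model:
  assumes "terminal K t"
    and refl: "\<And>x. x \<in> Obj K \<Longrightarrow> \<exists>e\<in>D. \<exists>i\<in>hom K x e. i \<in> local_equivs K D"
    and isoclosed: "\<And>x y f. f \<in> hom K x y \<Longrightarrow> is_iso K f \<Longrightarrow> y \<in> D \<Longrightarrow> x \<in> D"
    and z: "z \<in> Obj K"
  shows "fibrant K (local_model K D) z \<longleftrightarrow> z \<in> D"
proof -
  let ?W = "local_equivs K D"
  have "fibrant K (local_model K D) z \<longleftrightarrow>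
    (\<forall>i\<in>?W. \<forall>u\<in>hom K (Dom K i) z. \<exists>h\<in>hom K (Cod K i) z. Comp K h i = u)"
    by (rule fibrant_iff_lifting[OF assms(1) _ _ z]) (auto simp: local_model_def local_equivs_def)
  also have "\<dots> \<longleftrightarrow> z \<in> D"
  proof
    assume R: "\<forall>i\<in>?W. \<forall>u\<in>hom K (Dom K i) z. \<exists>h\<in>hom K (Cod K i) z. Comp K h i = u"
    obtain e i where e: "e \<in> D" and i: "i \<in> hom K z e" "i \<in> ?W" using refl z by blast
    have eo: "e \<in> Obj K" using i hom_obj by blast
    obtain h where h: "h \<in> hom K e z" "Comp K h i = Ident K z"
      using R i ident_hom[OF z] homD[OF i(1)] by metis
    have "Comp K (Comp K i h) i = Comp K (Ident K e) i"
      using assoc[OF i(1) h(1) i(1)] h ident_left[OF i(1)] ident_right[OF i(1)] by simp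
    then have "Comp K i h = Ident K e"
      using local_equivs_inj[OF i(2,1) e] comp_hom[OF h(1) i(1)] ident_hom[OF eo] by blast
    then have "is_iso K i" using h i is_isoI by blast
    then show "z \<in> D" using isoclosed i e by blast
  next
    assume "z \<in> D"
    then show "\<forall>i\<in>?W. \<forall>u\<in>hom K (Dom K i) z. \<exists>h\<in>hom K (Cod K i) z. Comp K h i = u"
      using local_equivs_ex hom_arr local_equivs_arr by (metis subsetD)
  qed
  finally show ?thesis .
qed

text \<open>The retract argument: f is p after a trivial cofibration i, lifts against i, and so is a
  retract of the fibration p.\<close>

lemma model_fib_eq_rlp:
  assumes "model_structure K M"
  shows "Fib M = rlp K (Cofib M \<inter> Weq M)"
proof
  show "Fib M \<subseteq> rlp K (Cofib M \<inter> Weq M)"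
    using assms by (auto simp: model_structure_def rlp_def)
  show "rlp K (Cofib M \<inter> Weq M) \<subseteq> Fib M"
  proof
    fix f assume f: "f \<in> rlp K (Cofib M \<inter> Weq M)"
    then have fa: "f \<in> Arr K" by (simp add: rlp_def)
    then obtain i p where i: "i \<in> Cofib M \<inter> Weq M" and p: "p \<in> Fib M"
      and cd: "Cod K i = Dom K p" and fe: "Comp K p i = f"
      using assms unfolding model_structure_def factorizes_def by meson
    have ia: "i \<in> Arr K" and pa: "p \<in> Arr K" using i p assms by (auto simp: model_structure_def)
    have ih: "i \<in> hom K (Dom K i) (Dom K p)" and ph: "p \<in> hom K (Dom K p) (Cod K p)"
      using ia pa cd by (auto simp: hom_def)
    have fh: "f \<in> hom K (Dom K i) (Cod K p)" using comp_hom[OF ih ph] fe by simp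
    have "Comp K f (Ident K (Dom K i)) = Comp K p i" using ident_right[OF fh] fe by simp
    then obtain h where h: "h \<in> hom K (Dom K p) (Dom K i)"
      "Comp K h i = Ident K (Dom K i)" "Comp K f h = p"
      using has_liftingE[OF rlpD[OF f i] ih fh ident_hom[OF hom_obj(1)[OF ih]] ph] by blast
    have co: "Cod K p \<in> Obj K" using ph hom_obj by blast
    have "retract_of K f p"
      unfolding retract_of_def homD[OF fh]
      by (rule bexI[OF _ ih], rule bexI[OF _ h(1)], rule bexI[OF _ ident_hom[OF co]],
          rule bexI[OF _ ident_hom[OF co]])
        (use h fe ident_left[OF fh] ident_left[OF ph] ident_left[OF ident_hom[OF co]] in auto)
    then show "f \<in> Fib M" using assms fa p by (auto simp: model_structure_def retract_closed_def)
  qed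
qed

text \<open>A weak equivalence between fibrant objects has a retraction, because it is also a cofibration;
  the retraction is again a weak equivalence between fibrant objects, so it has a retraction too.\<close>

lemma all_cofib_model_unique:
  assumes M: "model_structure K M" and cof: "Cofib M = Arr K"
    and fibr: "\<And>z. z \<in> Obj K \<Longrightarrow> fibrant K M z \<longleftrightarrow> z \<in> D"
    and t: "terminal K t"
    and refl: "\<And>x. x \<in> Obj K \<Longrightarrow> \<exists>e\<in>D. \<exists>i\<in>hom K x e. i \<in> local_equivs K D"
  shows "M = local_model K D"
proof -
  let ?W = "local_equivs K D"
  note ma = M[unfolded model_structure_def]
  have WA: "Weq M \<subseteq> Arr K" using ma by simp
  have CW: "Cofib M \<inter> Weq M = Weq M" using WA cof by auto
  have Fib: "Fib M = rlp K (Weq M)" using model_fib_eq_rlp[OF M] CW by simp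
  have D_ext: "\<exists>h\<in>hom K b z. Comp K h i = u"
    if "i \<in> Weq M" "i \<in> hom K a b" "z \<in> D" "z \<in> Obj K" "u \<in> hom K a z" for i a b z u
    using that fibr[OF that(4)] fibrant_iff_lifting[OF t Fib WA that(4)] homD[OF that(2)] by metis
  have tot: "Comp K g f \<in> Weq M" if "f \<in> Weq M" "g \<in> Weq M" "f \<in> hom K a b" "g \<in> hom K b c"
    for f g a b c using ma that unfolding two_of_three_def hom_def by blast
  have tot1: "g \<in> Weq M" if "f \<in> Weq M" "Comp K g f \<in> Weq M" "f \<in> hom K a b" "g \<in> hom K b c"
    for f g a b c using ma that unfolding two_of_three_def hom_def by blast
  have tot2: "f \<in> Weq M" if "g \<in> Weq M" "Comp K g f \<in> Weq M" "f \<in> hom K a b" "g \<in> hom K b c"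
    for f g a b c using ma that unfolding two_of_three_def hom_def by blast
  have tfib: "is_iso K p" if "p \<in> Fib M \<inter> Weq M" for p
    using that ma cof self_lifting_iso by blast
  \<comment> \<open>The axioms do not list identities among the weak equivalences. Factor the
    identity as a trivial fibration p after some i; this exhibits the identity as a retract of
    p.\<close>
  have ident_w: "Ident K x \<in> Weq M" if x: "x \<in> Obj K" for x
  proof -
    have ia: "Ident K x \<in> Arr K" "Cod K (Ident K x) = x" "Dom K (Ident K x) = x"
      using ident_hom[OF x] by (auto simp: hom_def)
    obtain i p where i: "i \<in> Arr K" and p: "p \<in> Fib M \<inter> Weq M"
      and cd: "Cod K i = Dom K p" and e: "Comp K p i = Ident K x"
      using ma ia(1) unfolding factorizes_def cof by meson
    have ph: "p \<in> hom K (Dom K p) (Cod K p)" using p WA by (auto simp: hom_arr)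
    have ih: "i \<in> hom K (Dom K i) (Dom K p)" using i cd by (auto simp: hom_def)
    have "Cod K p = x" "Dom K i = x" using comp_hom[OF ih ph] e ia by (auto simp: hom_def)
    then have px: "p \<in> hom K (Dom K p) x" "i \<in> hom K x (Dom K p)" using ph ih by auto
    have "Comp K p (Comp K i p) = p" using assoc[OF px(1,2,1)] e ident_left[OF px(1)] by simp
    moreover note ip = comp_hom[OF px]
    moreover obtain q where q: "q \<in> hom K x (Dom K p)" "Comp K q p = Ident K (Dom K p)"
      using is_isoE[OF tfib[OF p] px(1)] by metis
    ultimately have "Comp K i p = Ident K (Dom K p)"
      using assoc[OF ip px(1) q(1)] ident_left[OF ip] by simp
    then have "retract_of K (Ident K x) p"
      unfolding retract_of_def ia homD(3)[OF px(1)]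
      by (intro bexI[of _ i] bexI[of _ p] bexI[of _ "Ident K x"])
        (use e px ident_hom[OF x] ident_left[OF px(1)] ident_left[OF ident_hom[OF x]] in auto)
    then show ?thesis using ma ia(1) p unfolding retract_closed_def by blast
  qed
  \<comment> \<open>An isomorphism is a retract of the identity of its domain.\<close>
  have iso_w: "f \<in> Weq M" if f: "is_iso K f" for f
  proof -
    have fh: "f \<in> hom K (Dom K f) (Cod K f)" using f by (simp add: is_iso_def hom_arr)
    obtain g where g: "g \<in> hom K (Cod K f) (Dom K f)" "Comp K g f = Ident K (Dom K f)"
      "Comp K f g = Ident K (Cod K f)" using is_isoE f fh by metis
    have d: "Dom K f \<in> Obj K" using fh hom_obj by blast
    note id = ident_hom[OF d]
    have "retract_of K f (Ident K (Dom K f))"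
      unfolding retract_of_def homD[OF id]
      by (intro bexI[of _ "Ident K (Dom K f)"] bexI[of _ f] bexI[of _ g])
        (use g fh id ident_left[OF id] ident_left[OF fh] ident_right[OF fh] in auto)
    then show ?thesis using ma ident_w[OF d] fh unfolding retract_closed_def by (meson homD(1))
  qed
  have retr: "\<exists>r\<in>hom K b a. Comp K r f = Ident K a \<and> r \<in> Weq M"
    if f: "f \<in> Weq M" "f \<in> hom K a b" and ab: "a \<in> D" "b \<in> D" for f a b
  proof -
    have o: "a \<in> Obj K" using hom_obj[OF f(2)] by auto
    obtain r where r: "r \<in> hom K b a" "Comp K r f = Ident K a"
      using D_ext[OF f ab(1) o ident_hom[OF o]] by blast
    then show ?thesis using tot1[OF f(1) _ f(2) r(1)] ident_w[OF o] by auto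
  qed
  have D_iso: "is_iso K f" if f: "f \<in> Weq M" "f \<in> hom K a b" and ab: "a \<in> D" "b \<in> D" for f a b
  proof -
    obtain r where r: "r \<in> hom K b a" "Comp K r f = Ident K a" "r \<in> Weq M"
      using retr[OF f ab] by blast
    obtain s where s: "s \<in> hom K a b" "Comp K s r = Ident K b"
      using retr[OF r(3,1) ab(2,1)] by blast
    have "is_iso K r" using is_iso_two_sided[OF r(1) s(1) f(2) s(2) r(2)] .
    then show ?thesis using is_iso_cancel_left[OF _ _ f(2) r(1)] r is_iso_ident hom_obj[OF f(2)]
      by simp
  qed
  \<comment> \<open>Factor f as a fibration p after a weak equivalence i. The middle object w maps
    by a fibration to the fibrant z, so it is fibrant and lies in D. Hence i extends along f to some
    k : z -> w, and the rest shows that k inverts p.\<close>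
  have refl_w: "f \<in> Weq M" if f: "f \<in> ?W" "f \<in> hom K x z" and z: "z \<in> D" for f x z
  proof -
    have zo: "z \<in> Obj K" using hom_obj f by blast
    obtain i p where i: "i \<in> Weq M" and p: "p \<in> Fib M"
      and cd: "Cod K i = Dom K p" and e: "Comp K p i = f"
      using ma f WA unfolding factorizes_def CW by (meson homD(1))
    have ph: "p \<in> hom K (Dom K p) (Cod K p)" using p ma by (auto simp: hom_arr)
    have ih: "i \<in> hom K (Dom K i) (Dom K p)" using i cd WA by (auto simp: hom_def)
    have "Cod K p = z" "Dom K i = x" using comp_hom[OF ih ph] e f by (auto simp: hom_def)
    then obtain w where w: "p \<in> hom K w z" "i \<in> hom K x w" using ph ih by auto
    have wo: "w \<in> Obj K" using hom_obj w by blast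
    have "fibrant K M w"
    proof -
      have "fibrant K M z" using fibr zo z by blast
      then obtain t' g where g: "terminal K t'" "g \<in> hom K z t'" "g \<in> Fib M"
        unfolding fibrant_def by blast
      have "Comp K g p \<in> Fib M" using rlp_comp[OF _ _ WA w(1) g(2)] p g Fib by auto
      then show ?thesis using g comp_hom[OF w(1) g(2)] unfolding fibrant_def by blast
    qed
    then have wD: "w \<in> D" using fibr wo by blast
    obtain k where k: "k \<in> hom K z w" "Comp K k f = i"
      using local_equivs_ex[OF f wD w(2)] by blast
    have "Comp K (Comp K p k) f = Comp K (Ident K z) f"
      using assoc[OF f(2) k(1) w(1)] k e ident_left[OF f(2)] by simp
    then have pk: "Comp K p k = Ident K z"
      using local_equivs_inj[OF f z] comp_hom[OF k(1) w(1)] ident_hom[OF zo] by blast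
    let ?e = "Comp K k p"
    have eh: "?e \<in> hom K w w" using comp_hom k w by blast
    have "Comp K ?e i = i" using assoc[OF w(2,1) k(1)] e k by simp
    then have "?e \<in> Weq M" using tot1[OF i _ w(2) eh] i by simp
    then have "is_iso K ?e" using D_iso eh wD by blast
    then obtain e' where e': "e' \<in> hom K w w" "Comp K e' ?e = Ident K w" using is_isoE eh by metis
    \<comment> \<open>As p k is the identity, k p is idempotent, and an invertible idempotent is an
      identity.\<close>
    have "Comp K ?e ?e = ?e"
      using assoc[OF eh w(1) k(1)] assoc[OF w(1) k(1) w(1)] pk ident_left[OF w(1)] by simp
    then have "?e = Ident K w" using assoc[OF eh eh e'(1)] e' ident_left[OF eh] by simp
    then have "is_iso K p" using is_isoI[OF w(1) k(1)] pk by blast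
    then show ?thesis using tot[OF i iso_w w(2,1)] e by simp
  qed
  \<comment> \<open>Reflect both ends of f into D. The two reflections are weak as well as local
    equivalences, so two-out-of-three moves either property between f and the induced arrow g; for
    g, between objects of D, both properties mean being invertible.\<close>
  have "f \<in> Weq M \<longleftrightarrow> f \<in> ?W" if fA: "f \<in> Arr K" for f
  proof -
    obtain x y where f: "f \<in> hom K x y" using hom_arr[OF fA] by blast
    have o: "x \<in> Obj K" "y \<in> Obj K" using f hom_obj by auto
    obtain e i where i: "e \<in> D" "i \<in> hom K x e" "i \<in> ?W" using refl o by metis
    obtain e' j where j: "e' \<in> D" "j \<in> hom K y e'" "j \<in> ?W" using refl o by metis
    obtain g where g: "g \<in> hom K e e'" "Comp K g i = Comp K j f"
      using local_equivs_ex[OF i(3,2) j(1) comp_hom[OF f j(2)]] by blast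
    have iw: "i \<in> Weq M" "j \<in> Weq M" using refl_w i j by auto
    have tW: "two_of_three K ?W" by (rule two_of_three_local)
    have "f \<in> Weq M \<longleftrightarrow> g \<in> Weq M"
      using tot[OF _ iw(2) f j(2)] tot2[OF iw(2) _ f j(2)] tot[OF iw(1) _ i(2) g(1)]
        tot1[OF iw(1) _ i(2) g(1)] g(2) by metis
    also have "\<dots> \<longleftrightarrow> is_iso K g" using D_iso g i j iso_w by blast
    also have "\<dots> \<longleftrightarrow> g \<in> ?W"
      using local_equiv_local_objects_iso[OF g(1) _ i(1) j(1)] iso_local_equiv by blast
    also have "\<dots> \<longleftrightarrow> f \<in> ?W"
      using tW i(2,3) j(2,3) f g unfolding two_of_three_def
      by (metis homD)
    finally show ?thesis .
  qed
  then have "Weq M = ?W" using WA local_equivs_arr by blast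
  then show ?thesis using cof Fib by (simp add: local_model_def)
qed

text \<open>Lifting is only ever needed against isomorphisms, and each factorization uses an
  identity as its weak equivalence.\<close>

lemma model_structure_trivial:
  assumes N: "N = \<lparr>Weq = {f \<in> Arr K. is_iso K f}, Cofib = Arr K, Fib = Arr K\<rparr>"
  shows "model_structure K N"
proof -
  have 1: "two_of_three K {f \<in> Arr K. is_iso K f}"
    unfolding two_of_three_def
  proof (intro ballI impI)
    fix f g assume "f \<in> Arr K" "g \<in> Arr K" "Dom K g = Cod K f"
    then have f: "f \<in> hom K (Dom K f) (Cod K f)" and g: "g \<in> hom K (Cod K f) (Cod K g)"
      by (auto simp: hom_def)
    show "(f \<in> {f \<in> Arr K. is_iso K f} \<and> g \<in> {f \<in> Arr K. is_iso K f} \<longrightarrow>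
          Comp K g f \<in> {f \<in> Arr K. is_iso K f}) \<and>
        (f \<in> {f \<in> Arr K. is_iso K f} \<and> Comp K g f \<in> {f \<in> Arr K. is_iso K f} \<longrightarrow>
          g \<in> {f \<in> Arr K. is_iso K f}) \<and>
        (g \<in> {f \<in> Arr K. is_iso K f} \<and> Comp K g f \<in> {f \<in> Arr K. is_iso K f} \<longrightarrow>
          f \<in> {f \<in> Arr K. is_iso K f})"
      using is_iso_comp[OF _ _ f g] is_iso_cancel_left[OF _ _ f g] is_iso_cancel_right[OF _ _ f g]
        homD(1)[OF f] homD(1)[OF g] homD(1)[OF comp_hom[OF f g]] by blast
  qed
  have 2: "retract_closed K {f \<in> Arr K. is_iso K f}"
    using is_iso_retract by (auto simp: retract_closed_def)
  have id: "Ident K a \<in> Arr K \<inter> {f \<in> Arr K. is_iso K f}" if "a \<in> Obj K" for a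
    using that is_iso_ident by (auto simp: is_iso_def)
  have "\<exists>i\<in>Arr K \<inter> {f \<in> Arr K. is_iso K f}. \<exists>p\<in>Arr K. Cod K i = Dom K p \<and> Comp K p i = f"
    if f: "f \<in> Arr K" for f
    by (rule bexI[OF _ id[OF dom_obj[OF f]]], rule bexI[OF _ f])
      (use ident_right[OF hom_arr[OF f]] ident_hom[OF dom_obj[OF f]] in \<open>auto simp: hom_def\<close>)
  moreover have "\<exists>i\<in>Arr K. \<exists>p\<in>Arr K \<inter> {f \<in> Arr K. is_iso K f}. Cod K i = Dom K p \<and> Comp K p i = f"
    if f: "f \<in> Arr K" for f
    by (rule bexI[OF _ f], rule bexI[OF _ id[OF cod_obj[OF f]]])
      (use ident_left[OF hom_arr[OF f]] ident_hom[OF cod_obj[OF f]] in \<open>auto simp: hom_def\<close>)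
  ultimately show ?thesis
    unfolding model_structure_def N factorizes_def
    using 1 2 retract_closed_all category_axioms iso_has_lifting_left iso_has_lifting_right
    by auto
qed

end


section \<open>Adjunctions with fully faithful right adjoint\<close>

text \<open>Functoriality of \<open>L\<close> follows from uniqueness: both sides of each functor
  law become equal after applying \<open>R\<close> and precomposing with the universal
  arrow.\<close>

lemma adjunctionI_universal:
  assumes R: "is_functor B A R"
    and Lobj: "\<And>x. x \<in> Obj A \<Longrightarrow> fobj L x \<in> Obj B"
    and eta: "\<And>x. x \<in> Obj A \<Longrightarrow> \<eta> x \<in> hom A x (fobj R (fobj L x))"
    and univ: "\<And>x y f. x \<in> Obj A \<Longrightarrow> y \<in> Obj B \<Longrightarrow> f \<in> hom A x (fobj R y) \<Longrightarrow>
      \<exists>!g. g \<in> hom B (fobj L x) y \<and> Comp A (farr R g) (\<eta> x) = f"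
    and Larr: "\<And>h x x'. h \<in> hom A x x' \<Longrightarrow> farr L h \<in> hom B (fobj L x) (fobj L x')"
    and nat: "\<And>h x x'. h \<in> hom A x x' \<Longrightarrow>
      Comp A (farr R (farr L h)) (\<eta> x) = Comp A (\<eta> x') h"
  shows "adjunction A B L R (\<lambda>x y f. Comp A (farr R f) (\<eta> x))"
proof -
  interpret R: is_functor B A R by fact
  note A = R.B.category_axioms and B = R.A.category_axioms
  have uniq: "g = g'" if "x \<in> Obj A" "g \<in> hom B (fobj L x) y" "g' \<in> hom B (fobj L x) y"
    "Comp A (farr R g) (\<eta> x) = Comp A (farr R g') (\<eta> x)" for x y g g'
    using univ[OF that(1) R.A.hom_obj(2)[OF that(2)] R.B.comp_hom[OF eta[OF that(1)] R.map_hom[OF that(3)]]]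
      that by auto
  have "is_functor A B L"
  proof (intro is_functor.intro is_functor_axioms.intro A B)
    fix a assume a: "a \<in> Obj A"
    then show "fobj L a \<in> Obj B" by (rule Lobj)
    note La = R.A.ident_hom[OF Lobj[OF a]] and ia = R.B.ident_hom[OF a]
    show "farr L (Ident A a) = Ident B (fobj L a)"
      by (rule uniq[OF a Larr[OF ia] La])
        (simp add: nat[OF ia] R.map_ident[OF Lobj[OF a]] R.B.ident_left[OF eta[OF a]]
          R.B.ident_right[OF eta[OF a]])
  next
    fix f a b assume "f \<in> hom A a b" then show "farr L f \<in> hom B (fobj L a) (fobj L b)" by (rule Larr)
  next
    fix f a b g c assume f: "f \<in> hom A a b" and g: "g \<in> hom A b c"
    note gf = R.B.comp_hom[OF f g]
    note ab = R.B.hom_obj[OF f] and c = R.B.hom_obj(2)[OF g]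
    have "Comp A (farr R (Comp B (farr L g) (farr L f))) (\<eta> a) =
      Comp A (farr R (farr L g)) (Comp A (farr R (farr L f)) (\<eta> a))"
      using R.map_comp[OF Larr[OF f] Larr[OF g]]
        R.B.assoc[OF eta[OF ab(1)] R.map_hom[OF Larr[OF f]] R.map_hom[OF Larr[OF g]]] by simp
    also have "\<dots> = Comp A (Comp A (\<eta> c) g) f"
      using nat[OF f] nat[OF g] R.B.assoc[OF f eta[OF ab(2)] R.map_hom[OF Larr[OF g]]] by simp
    also have "\<dots> = Comp A (farr R (farr L (Comp A g f))) (\<eta> a)"
      using nat[OF gf] R.B.assoc[OF f g eta[OF c]] by simp
    finally show "farr L (Comp A g f) = Comp B (farr L g) (farr L f)"
      using uniq[OF ab(1) Larr[OF gf] R.A.comp_hom[OF Larr[OF f] Larr[OF g]]] by simp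
  qed
  moreover have "bij_betw (\<lambda>f. Comp A (farr R f) (\<eta> x)) (hom B (fobj L x) y) (hom A x (fobj R y))"
    if "x \<in> Obj A" "y \<in> Obj B" for x y
    unfolding bij_betw_iff_ex1
    using univ[OF that] R.B.comp_hom[OF eta[OF that(1)] R.map_hom] by blast
  moreover have "Comp A (farr R (Comp B k (Comp B f (farr L h)))) (\<eta> x') =
      Comp A (farr R k) (Comp A (Comp A (farr R f) (\<eta> x)) h)"
    if h: "h \<in> hom A x' x" and f: "f \<in> hom B (fobj L x) y" and k: "k \<in> hom B y y'"
    for x x' y y' h f k
  proof -
    note o = R.B.hom_obj[OF h] and Lh = Larr[OF h]
    note fL = R.A.comp_hom[OF Lh f]
    have "Comp A (farr R (Comp B k (Comp B f (farr L h)))) (\<eta> x') =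
      Comp A (Comp A (farr R k) (Comp A (farr R f) (farr R (farr L h)))) (\<eta> x')"
      using R.map_comp[OF fL k] R.map_comp[OF Lh f] by simp
    also have "\<dots> = Comp A (farr R k) (Comp A (farr R f) (Comp A (farr R (farr L h)) (\<eta> x')))"
      using R.B.assoc[OF eta[OF o(1)] R.B.comp_hom[OF R.map_hom[OF Lh] R.map_hom[OF f]] R.map_hom[OF k]]
        R.B.assoc[OF eta[OF o(1)] R.map_hom[OF Lh] R.map_hom[OF f]] by simp
    also have "\<dots> = Comp A (farr R k) (Comp A (Comp A (farr R f) (\<eta> x)) h)"
      using nat[OF h] R.B.assoc[OF h eta[OF o(2)] R.map_hom[OF f]] by simp
    finally show ?thesis .
  qed
  ultimately show ?thesis using R unfolding adjunction_def by blast
qed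

text \<open>The bijection \<phi> stays arbitrary because the theorem speaks of every adjunction
  between the two functors; the unit is recovered by evaluating \<phi> at identities.\<close>

locale reflective_adjunction =
  fixes A :: "('o, 'm) cat" and B :: "('p, 'n) cat" and L R \<phi> D
  assumes adj: "adjunction A B L R \<phi>"
    and ff: "\<And>F G. F \<in> Obj B \<Longrightarrow> G \<in> Obj B \<Longrightarrow>
      bij_betw (farr R) (hom B F G) (hom A (fobj R F) (fobj R G))"
    and ess_image: "\<And>z. z \<in> D \<longleftrightarrow> (\<exists>F\<in>Obj B. \<exists>h\<in>hom A z (fobj R F). is_iso A h)"
begin

sublocale L: is_functor A B L using adj by (simp add: adjunction_def)
sublocale R: is_functor B A R using adj by (simp add: adjunction_def)

definition unit where "unit x = \<phi> x (fobj L x) (Ident B (fobj L x))"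

lemma phi_nat:
  assumes "h \<in> hom A x' x" "f \<in> hom B (fobj L x) y" "k \<in> hom B y y'"
  shows "\<phi> x' y' (Comp B k (Comp B f (farr L h))) = Comp A (farr R k) (Comp A (\<phi> x y f) h)"
  using adj assms L.A.hom_obj[OF assms(1)] L.B.hom_obj[OF assms(3)] unfolding adjunction_def by blast

lemma phi_bij:
  assumes "x \<in> Obj A" "y \<in> Obj B"
  shows "bij_betw (\<phi> x y) (hom B (fobj L x) y) (hom A x (fobj R y))"
  using adj assms unfolding adjunction_def by blast

lemma phi_hom: "x \<in> Obj A \<Longrightarrow> f \<in> hom B (fobj L x) y \<Longrightarrow> \<phi> x y f \<in> hom A x (fobj R y)"
  using phi_bij L.B.hom_obj(2) unfolding bij_betw_def by blast

lemma phi_inj: "x \<in> Obj A \<Longrightarrow> f \<in> hom B (fobj L x) y \<Longrightarrow> g \<in> hom B (fobj L x) y \<Longrightarrow>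
    \<phi> x y f = \<phi> x y g \<Longrightarrow> f = g"
  using phi_bij L.B.hom_obj(2) unfolding bij_betw_def inj_on_def by blast

lemma phi_surj:
  assumes "y \<in> Obj B" "t \<in> hom A x (fobj R y)"
  obtains f where "f \<in> hom B (fobj L x) y" "\<phi> x y f = t"
  using phi_bij[OF L.A.hom_obj(1)[OF assms(2)] assms(1)] assms(2) that
  unfolding bij_betw_def by (metis imageE)

lemma unit_hom: "x \<in> Obj A \<Longrightarrow> unit x \<in> hom A x (fobj R (fobj L x))"
  unfolding unit_def by (intro phi_hom L.B.ident_hom L.map_obj)

lemma phi_precomp:
  assumes h: "h \<in> hom A x' x" and f: "f \<in> hom B (fobj L x) y"
  shows "\<phi> x' y (Comp B f (farr L h)) = Comp A (\<phi> x y f) h"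
proof -
  have y: "y \<in> Obj B" using f L.B.hom_obj by blast
  have x: "x \<in> Obj A" using h L.A.hom_obj by blast
  show ?thesis
    using phi_nat[OF h f L.B.ident_hom[OF y]] L.B.ident_left[OF L.B.comp_hom[OF L.map_hom[OF h] f]]
      L.A.ident_left[OF L.A.comp_hom[OF h phi_hom[OF x f]]] R.map_ident[OF y] by simp
qed

lemma phi_unit:
  assumes x: "x \<in> Obj A" and f: "f \<in> hom B (fobj L x) y"
  shows "\<phi> x y f = Comp A (farr R f) (unit x)"
proof -
  note Lx = L.B.ident_hom[OF L.map_obj[OF x]]
  show ?thesis
    using phi_nat[OF L.A.ident_hom[OF x] Lx f] L.map_ident[OF x] L.B.ident_right[OF f]
      L.B.ident_left[OF Lx] L.A.ident_right[OF unit_hom[OF x]] by (simp add: unit_def)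
qed

lemma image_local: "F \<in> Obj B \<Longrightarrow> fobj R F \<in> D"
  unfolding ess_image using R.map_obj L.A.ident_hom L.A.is_iso_ident by blast

text \<open>An object of D may be replaced by an isomorphic \<open>fobj R F\<close>. Arrows from R
  (L x) to R F are the images of arrows L x -> F, and precomposing these images with the unit is the
  bijection \<phi>.\<close>

lemma unit_local_equiv:
  assumes x: "x \<in> Obj A"
  shows "unit x \<in> local_equivs A D"
proof (rule L.A.local_equivsI[OF unit_hom[OF x]])
  have Lx: "fobj L x \<in> Obj B" using L.map_obj x .
  note ux = unit_hom[OF x]
  fix z u v assume z: "z \<in> D" and u: "u \<in> hom A (fobj R (fobj L x)) z"
    and v: "v \<in> hom A (fobj R (fobj L x)) z" and eq: "Comp A u (unit x) = Comp A v (unit x)"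
  obtain F h where F: "F \<in> Obj B" and h: "h \<in> hom A z (fobj R F)" "is_iso A h"
    using z ess_image by blast
  obtain h' where h': "h' \<in> hom A (fobj R F) z" "Comp A h' h = Ident A z"
    using L.A.is_isoE[OF h(2,1)] by blast
  obtain a where a: "a \<in> hom B (fobj L x) F" "farr R a = Comp A h u"
    using ff[OF Lx F] L.A.comp_hom[OF u h(1)] unfolding bij_betw_def by (metis imageE)
  obtain b where b: "b \<in> hom B (fobj L x) F" "farr R b = Comp A h v"
    using ff[OF Lx F] L.A.comp_hom[OF v h(1)] unfolding bij_betw_def by (metis imageE)
  have "\<phi> x F a = \<phi> x F b"
    using phi_unit[OF x a(1)] phi_unit[OF x b(1)] a b eq L.A.assoc[OF ux u h(1)]
      L.A.assoc[OF ux v h(1)] by simp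
  then have "Comp A h u = Comp A h v" using phi_inj[OF x a(1) b(1)] a b by simp
  moreover have "Comp A h' (Comp A h u) = u"
    using L.A.assoc[OF u h(1) h'(1)] h'(2) L.A.ident_left[OF u] by simp
  moreover have "Comp A h' (Comp A h v) = v"
    using L.A.assoc[OF v h(1) h'(1)] h'(2) L.A.ident_left[OF v] by simp
  ultimately show "u = v" by metis
next
  have Lx: "fobj L x \<in> Obj B" using L.map_obj x .
  note ux = unit_hom[OF x]
  fix z t assume z: "z \<in> D" and t: "t \<in> hom A x z"
  obtain F h where F: "F \<in> Obj B" and h: "h \<in> hom A z (fobj R F)" "is_iso A h"
    using z ess_image by blast
  obtain h' where h': "h' \<in> hom A (fobj R F) z" "Comp A h' h = Ident A z"
    using L.A.is_isoE[OF h(2,1)] by blast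
  obtain a where a: "a \<in> hom B (fobj L x) F" "\<phi> x F a = Comp A h t"
    using phi_surj[OF F L.A.comp_hom[OF t h(1)]] by blast
  have "Comp A (Comp A h' (farr R a)) (unit x) = Comp A h' (Comp A h t)"
    using L.A.assoc[OF ux R.map_hom[OF a(1)] h'(1)] phi_unit[OF x a(1)] a(2) by simp
  also have "\<dots> = t" using L.A.assoc[OF t h(1) h'(1)] h'(2) L.A.ident_left[OF t] by simp
  finally show "\<exists>u\<in>hom A (fobj R (fobj L x)) z. Comp A u (unit x) = t"
    using L.A.comp_hom[OF R.map_hom[OF a(1)] h'(1)] by blast
qed

text \<open>The unit at a extends along w because R (L a) lies in D, and the transpose of this
  extension is the inverse of L w. The second inverse law is checked after transposing, where
  precomposition with w is injective.\<close>

lemma L_local_equiv: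
  assumes W: "w \<in> local_equivs A D"
  shows "is_iso B (farr L w)"
proof -
  obtain a b where w: "w \<in> hom A a b" using W local_equivs_def hom_arr by fast
  note o = L.A.hom_obj[OF w]
  note La = L.map_obj[OF o(1)] and Lb = L.map_obj[OF o(2)] and Lw = L.map_hom[OF w]
  obtain t where t: "t \<in> hom A b (fobj R (fobj L a))" "Comp A t w = unit a"
    using L.A.local_equivs_ex[OF W w image_local[OF La] unit_hom[OF o(1)]] by blast
  obtain g where g: "g \<in> hom B (fobj L b) (fobj L a)" "\<phi> b (fobj L a) g = t"
    using phi_surj[OF La t(1)] by blast
  have "\<phi> a (fobj L a) (Comp B g (farr L w)) = \<phi> a (fobj L a) (Ident B (fobj L a))"
    using phi_precomp[OF w g(1)] g(2) t(2) by (simp add: unit_def)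
  then have 1: "Comp B g (farr L w) = Ident B (fobj L a)"
    using phi_inj[OF o(1) L.B.comp_hom[OF Lw g(1)] L.B.ident_hom[OF La]] by blast
  note wg = L.B.comp_hom[OF g(1) Lw] and ib = L.B.ident_hom[OF Lb]
  have "Comp B (Comp B (farr L w) g) (farr L w) = Comp B (Ident B (fobj L b)) (farr L w)"
    using L.B.assoc[OF Lw g(1) Lw] 1 L.B.ident_right[OF Lw] L.B.ident_left[OF Lw] by simp
  then have "Comp A (\<phi> b (fobj L b) (Comp B (farr L w) g)) w =
      Comp A (\<phi> b (fobj L b) (Ident B (fobj L b))) w"
    using phi_precomp[OF w wg] phi_precomp[OF w ib] by simp
  then have "\<phi> b (fobj L b) (Comp B (farr L w) g) = \<phi> b (fobj L b) (Ident B (fobj L b))"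
    using L.A.local_equivs_inj[OF W w image_local[OF Lb] phi_hom[OF o(2) wg] phi_hom[OF o(2) ib]]
    by blast
  then have "Comp B (farr L w) g = Ident B (fobj L b)" using phi_inj[OF o(2) wg ib] by blast
  then show ?thesis using 1 L.B.is_isoI[OF Lw g(1)] by blast
qed

lemma R_reflects_iso:
  assumes f: "f \<in> hom B F G" and iso: "is_iso A (farr R f)"
  shows "is_iso B f"
proof -
  note o = L.B.hom_obj[OF f]
  have inj: "a = b" if "a \<in> hom B X Y" "b \<in> hom B X Y" "farr R a = farr R b" for a b X Y
    using ff[OF L.B.hom_obj(1)[OF that(1)] L.B.hom_obj(2)[OF that(1)]] that
    unfolding bij_betw_def inj_on_def by blast
  obtain g' where g': "g' \<in> hom A (fobj R G) (fobj R F)"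
    "Comp A g' (farr R f) = Ident A (fobj R F)" "Comp A (farr R f) g' = Ident A (fobj R G)"
    using L.A.is_isoE[OF iso R.map_hom[OF f]] by blast
  obtain g where g: "g \<in> hom B G F" "farr R g = g'"
    using ff[OF o(2,1)] g'(1) unfolding bij_betw_def by (metis imageE)
  have "Comp B g f = Ident B F"
    by (rule inj[OF L.B.comp_hom[OF f g(1)] L.B.ident_hom[OF o(1)]])
      (simp add: R.map_comp[OF f g(1)] g g' R.map_ident[OF o(1)])
  moreover have "Comp B f g = Ident B G"
    by (rule inj[OF L.B.comp_hom[OF g(1) f] L.B.ident_hom[OF o(2)]])
      (simp add: R.map_comp[OF g(1) f] g g' R.map_ident[OF o(2)])
  ultimately show ?thesis using L.B.is_isoI[OF f g(1)] by blast
qed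

lemma R_preserves_iso:
  assumes f: "f \<in> hom B F G" and iso: "is_iso B f"
  shows "is_iso A (farr R f)"
proof -
  note o = L.B.hom_obj[OF f]
  obtain g where g: "g \<in> hom B G F" "Comp B g f = Ident B F" "Comp B f g = Ident B G"
    using L.B.is_isoE[OF iso f] by blast
  show ?thesis
    by (rule L.A.is_isoI[OF R.map_hom[OF f] R.map_hom[OF g(1)]])
      (use R.map_comp[OF f g(1)] R.map_comp[OF g(1) f] g R.map_ident o in auto)
qed

lemma quillen_equivalence_local_model:
  assumes M: "model_structure A (local_model A D)"
    and N: "N = \<lparr>Weq = {f \<in> Arr B. is_iso B f}, Cofib = Arr B, Fib = Arr B\<rparr>"
  shows "quillen_equivalence A (local_model A D) B N L R \<phi>"
proof -
  let ?W = "local_equivs A D"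
  have NM: "model_structure B N" using L.B.model_structure_trivial[OF N] .
  have La: "farr L f \<in> Arr B" if "f \<in> Arr A" for f using L.map_hom[OF hom_arr[OF that]] by (rule homD)
  have "f \<in> Weq N \<longleftrightarrow> \<phi> x y f \<in> ?W"
    if x: "x \<in> Obj A" and y: "y \<in> Obj B" and f: "f \<in> hom B (fobj L x) y" for x y f
  proof -
    note Lx = L.map_obj[OF x] and Rf = R.map_hom[OF f] and ux = unit_hom[OF x]
    have tW: "two_of_three A ?W" by (rule L.A.two_of_three_local)
    have "f \<in> Weq N \<longleftrightarrow> is_iso A (farr R f)"
      using R_preserves_iso[OF f] R_reflects_iso[OF f] homD(1)[OF f] by (auto simp: N)
    also have "\<dots> \<longleftrightarrow> farr R f \<in> ?W"
      using L.A.local_equiv_local_objects_iso[OF Rf _ image_local[OF Lx] image_local[OF y]]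
        L.A.iso_local_equiv by blast
    also have "\<dots> \<longleftrightarrow> \<phi> x y f \<in> ?W"
      using tW unit_local_equiv[OF x] homD[OF ux] homD[OF Rf] phi_unit[OF x f]
      unfolding two_of_three_def by metis
    finally show ?thesis .
  qed
  then show ?thesis
    unfolding quillen_equivalence_def quillen_adjunction_def
    using M NM adj La L_local_equiv local_equivs_def[of A D] by (auto simp: local_model_def N)
qed

end

section \<open>Slice, functor and set categories\<close>

lemma (in category) category_op_cat: "category (op_cat K)"
  using dom_obj cod_obj ident_hom comp_hom ident_left ident_right assoc
  by (unfold_locales) (auto simp: op_cat_def hom_def)

lemma hom_op_cat [simp]: "hom (op_cat K) a b = hom K b a"
  by (auto simp: hom_def op_cat_def)

lemma op_cat_simps [simp]: "Obj (op_cat K) = Obj K" "Arr (op_cat K) = Arr K"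
  "Dom (op_cat K) = Cod K" "Cod (op_cat K) = Dom K" "Ident (op_cat K) = Ident K"
  "Comp (op_cat K) g f = Comp K f g"
  by (simp_all add: op_cat_def)

lemma mor_eqI: "src f = src g \<Longrightarrow> mp f = mp g \<Longrightarrow> tgt f = tgt g \<Longrightarrow> f = g"
  by (cases f; cases g) simp

lemma slice_simps [simp]:
  "Dom (slice K c) = src" "Cod (slice K c) = tgt"
  "Obj (slice K c) = {p \<in> Arr K. Cod K p = c}"
  "Ident (slice K c) p = Mor p (Ident K (Dom K p)) p"
  "Comp (slice K c) g f = Mor (src f) (Comp K (mp g) (mp f)) (tgt g)"
  by (simp_all add: slice_def)

lemma hom_slice: "h \<in> hom (slice K c) p q \<longleftrightarrow> src h = p \<and> tgt h = q \<and>
    p \<in> Arr K \<and> Cod K p = c \<and> q \<in> Arr K \<and> Cod K q = c \<and>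
    mp h \<in> hom K (Dom K p) (Dom K q) \<and> Comp K q (mp h) = p"
  by (cases h) (auto simp: hom_def slice_def)

lemma (in category) category_slice: "category (slice K c)"
proof
  fix f assume "f \<in> Arr (slice K c)"
  then show "Dom (slice K c) f \<in> Obj (slice K c)" "Cod (slice K c) f \<in> Obj (slice K c)"
    by (auto simp: slice_def)
next
  fix a assume "a \<in> Obj (slice K c)"
  then show "Ident (slice K c) a \<in> hom (slice K c) a a"
    using ident_hom[OF dom_obj] ident_right[OF hom_arr] by (auto simp: hom_slice)
next
  fix f p q g r assume f: "f \<in> hom (slice K c) p q" and g: "g \<in> hom (slice K c) q r"
  then show "Comp (slice K c) g f \<in> hom (slice K c) p r"
    using comp_hom[of "mp f" "Dom K p" "Dom K q" "mp g" "Dom K r"]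
      assoc[of "mp f" "Dom K p" "Dom K q" "mp g" "Dom K r" r c] hom_arr[of r K]
    by (simp add: hom_slice)
next
  fix f p q assume "f \<in> hom (slice K c) p q"
  then show "Comp (slice K c) (Ident (slice K c) q) f = f" "Comp (slice K c) f (Ident (slice K c) p) = f"
    using ident_left ident_right by (auto simp: hom_slice intro: mor_eqI)
next
  fix f p q g r h s
  assume "f \<in> hom (slice K c) p q" "g \<in> hom (slice K c) q r" "h \<in> hom (slice K c) r s"
  then show "Comp (slice K c) h (Comp (slice K c) g f) = Comp (slice K c) (Comp (slice K c) h g) f"
    by (simp add: hom_slice assoc[of "mp f" "Dom K p" "Dom K q" "mp g" "Dom K r" "mp h" "Dom K s"])
qed

section \<open>Composition of functors and the category of small categories\<close>

lemma fctr_eqI: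
  fixes F G :: "('o, 'm, 'p, 'n) fctr"
  assumes "ext_functor A F" "ext_functor A G"
    "\<And>a. a \<in> Obj A \<Longrightarrow> fobj F a = fobj G a" "\<And>f. f \<in> Arr A \<Longrightarrow> farr F f = farr G f"
  shows "F = G"
proof -
  have "fobj F = fobj G" "farr F = farr G"
    using assms by (auto simp: ext_functor_def intro: extensionalityI)
  then show ?thesis by simp
qed

text \<open>Normalised off the carriers so that it is literally the functor part of a composite in
  \<open>Cat_cat\<close>.\<close>

definition fun_comp ::
  "('o, 'm) cat \<Rightarrow> ('p, 'n, 'q, 'l) fctr \<Rightarrow> ('o, 'm, 'p, 'n) fctr \<Rightarrow> ('o, 'm, 'q, 'l) fctr" where
  "fun_comp A G F = \<lparr>fobj = (\<lambda>a \<in> Obj A. fobj G (fobj F a)), farr = (\<lambda>f \<in> Arr A. farr G (farr F f))\<rparr>"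

definition fun_id :: "('o, 'm) cat \<Rightarrow> ('o, 'm, 'o, 'm) fctr" where
  "fun_id A = \<lparr>fobj = (\<lambda>a \<in> Obj A. a), farr = (\<lambda>f \<in> Arr A. f)\<rparr>"

lemma fun_simps [simp]:
  "a \<in> Obj A \<Longrightarrow> fobj (fun_comp A G F) a = fobj G (fobj F a)"
  "f \<in> Arr A \<Longrightarrow> farr (fun_comp A G F) f = farr G (farr F f)"
  "a \<in> Obj A \<Longrightarrow> fobj (fun_id A) a = a"
  "f \<in> Arr A \<Longrightarrow> farr (fun_id A) f = f"
  "ext_functor A (fun_comp A G F)" "ext_functor A (fun_id A)"
  by (auto simp: fun_comp_def fun_id_def ext_functor_def)

lemma (in is_functor) map_arr: "f \<in> Arr A \<Longrightarrow> farr F f \<in> Arr B"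
  "f \<in> Arr A \<Longrightarrow> Dom B (farr F f) = fobj F (Dom A f)"
  "f \<in> Arr A \<Longrightarrow> Cod B (farr F f) = fobj F (Cod A f)"
  using map_hom[OF hom_arr] by (auto simp: hom_def)

lemma (in category) comp_arr:
  assumes "f \<in> Arr K" "g \<in> Arr K" "Dom K g = Cod K f"
  shows "Comp K g f \<in> Arr K" "Dom K (Comp K g f) = Dom K f" "Cod K (Comp K g f) = Cod K g"
  using comp_hom[of f "Dom K f" "Cod K f" g "Cod K g"] assms by (auto simp: hom_def)

lemma (in category) ident_arr: "a \<in> Obj K \<Longrightarrow> Ident K a \<in> Arr K"
  "a \<in> Obj K \<Longrightarrow> Dom K (Ident K a) = a" "a \<in> Obj K \<Longrightarrow> Cod K (Ident K a) = a"
  using ident_hom by (auto simp: hom_def)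

lemma is_functor_comp:
  assumes "is_functor A B F" "is_functor B C G"
  shows "is_functor A C (fun_comp A G F)"
proof -
  interpret F: is_functor A B F by fact
  interpret G: is_functor B C G by fact
  show ?thesis
  proof
    fix a assume "a \<in> Obj A" then show "fobj (fun_comp A G F) a \<in> Obj C"
      using F.map_obj G.map_obj by simp
  next
    fix f a b assume f: "f \<in> hom A a b"
    then show "farr (fun_comp A G F) f \<in> hom C (fobj (fun_comp A G F) a) (fobj (fun_comp A G F) b)"
      using F.A.hom_obj[OF f] homD(1)[OF f] G.map_hom F.map_hom[OF f] by simp
  next
    fix a assume "a \<in> Obj A"
    then show "farr (fun_comp A G F) (Ident A a) = Ident C (fobj (fun_comp A G F) a)"
      using F.map_ident G.map_ident F.map_obj F.A.ident_arr by simp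
  next
    fix f a b g c assume f: "f \<in> hom A a b" and g: "g \<in> hom A b c"
    then show "farr (fun_comp A G F) (Comp A g f) =
        Comp C (farr (fun_comp A G F) g) (farr (fun_comp A G F) f)"
      using F.map_comp[OF f g] G.map_comp[OF F.map_hom[OF f] F.map_hom[OF g]]
        homD(1)[OF F.A.comp_hom[OF f g]] homD(1)[OF f] homD(1)[OF g] by simp
  qed
qed

lemma (in category) is_functor_id: "is_functor K K (fun_id K)"
  using ident_arr homD(1)[OF comp_hom]
  by unfold_locales (auto simp: hom_obj homD(1))

lemma Cat_cat_simps:
  "Obj (Cat_cat U) = {A. small_category U A}"
  "Dom (Cat_cat U) = src" "Cod (Cat_cat U) = tgt"
  "Ident (Cat_cat U) A = Mor A (fun_id A) A"
  "Comp (Cat_cat U) G F = Mor (src F) (fun_comp (src F) (mp G) (mp F)) (tgt G)"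
  by (simp_all add: Cat_cat_def fun_id_def fun_comp_def)

lemma Arr_Cat_cat: "F \<in> Arr (Cat_cat U) \<longleftrightarrow> small_category U (src F) \<and> small_category U (tgt F) \<and>
    is_functor (src F) (tgt F) (mp F) \<and> ext_functor (src F) (mp F)"
  by (cases F) (auto simp: Cat_cat_def)

lemma category_Cat_cat: "category (Cat_cat U)"
proof
  fix F assume "F \<in> Arr (Cat_cat U)"
  then show "Dom (Cat_cat U) F \<in> Obj (Cat_cat U)" "Cod (Cat_cat U) F \<in> Obj (Cat_cat U)"
    by (simp_all add: Cat_cat_simps Arr_Cat_cat)
next
  fix A assume "A \<in> Obj (Cat_cat U)"
  then show "Ident (Cat_cat U) A \<in> hom (Cat_cat U) A A"
    using category.is_functor_id by (auto simp: Cat_cat_simps Arr_Cat_cat hom_def small_category_def)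
next
  fix F A B G C assume "F \<in> hom (Cat_cat U) A B" "G \<in> hom (Cat_cat U) B C"
  then show "Comp (Cat_cat U) G F \<in> hom (Cat_cat U) A C"
    using is_functor_comp by (auto simp: Cat_cat_simps Arr_Cat_cat hom_def)
next
  fix F A B assume F: "F \<in> hom (Cat_cat U) A B"
  then interpret is_functor A B "mp F" by (auto simp: Cat_cat_simps Arr_Cat_cat hom_def)
  have e: "ext_functor A (mp F)" "src F = A" "tgt F = B"
    using F by (auto simp: Cat_cat_simps Arr_Cat_cat hom_def)
  have "fun_comp A (fun_id B) (mp F) = mp F" "fun_comp A (mp F) (fun_id A) = mp F"
    by (rule fctr_eqI[of A]; simp add: e map_obj map_arr)+
  then show "Comp (Cat_cat U) (Ident (Cat_cat U) B) F = F" "Comp (Cat_cat U) F (Ident (Cat_cat U) A) = F"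
    using e by (auto simp: Cat_cat_simps intro: mor_eqI)
next
  fix F A B G C H D assume F: "F \<in> hom (Cat_cat U) A B" and G: "G \<in> hom (Cat_cat U) B C"
    and H: "H \<in> hom (Cat_cat U) C D"
  interpret is_functor A B "mp F" using F by (auto simp: Cat_cat_simps Arr_Cat_cat hom_def)
  have "fun_comp A (mp H) (fun_comp A (mp G) (mp F)) = fun_comp A (fun_comp B (mp H) (mp G)) (mp F)"
    by (rule fctr_eqI[of A]; simp add: map_obj map_arr)
  then show "Comp (Cat_cat U) H (Comp (Cat_cat U) G F) = Comp (Cat_cat U) (Comp (Cat_cat U) H G) F"
    using F G by (auto simp: Cat_cat_simps Arr_Cat_cat hom_def)
qed

section \<open>Small sets and functor categories\<close>

lemma Set_cat_simps [simp]:
  "Obj (Set_cat U) = U" "Dom (Set_cat U) = src" "Cod (Set_cat U) = tgt"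
  "Ident (Set_cat U) A = Mor A (\<lambda>x \<in> A. x) A"
  "Comp (Set_cat U) g f = Mor (src f) (\<lambda>x \<in> src f. mp g (mp f x)) (tgt g)"
  by (simp_all add: Set_cat_def)

lemma hom_Set_cat: "f \<in> hom (Set_cat U) A B \<longleftrightarrow> src f = A \<and> tgt f = B \<and> A \<in> U \<and> B \<in> U \<and> mp f \<in> A \<rightarrow>\<^sub>E B"
  by (cases f) (auto simp: Set_cat_def hom_def)

lemma category_Set_cat: "category (Set_cat U)"
proof
  fix f assume "f \<in> Arr (Set_cat U)"
  then show "Dom (Set_cat U) f \<in> Obj (Set_cat U)" "Cod (Set_cat U) f \<in> Obj (Set_cat U)"
    by (auto simp: Set_cat_def)
next
  fix f A B assume f: "f \<in> hom (Set_cat U) A B"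
  have "(\<lambda>x \<in> A. (\<lambda>y \<in> B. y) (mp f x)) = mp f" "(\<lambda>x \<in> A. mp f ((\<lambda>y \<in> A. y) x)) = mp f"
    using f by (auto simp: hom_Set_cat fun_eq_iff extensional_def PiE_iff)
  then show "Comp (Set_cat U) (Ident (Set_cat U) B) f = f" "Comp (Set_cat U) f (Ident (Set_cat U) A) = f"
    using f by (auto simp: hom_Set_cat intro: mor_eqI)
next
  fix f A B g C h D
  assume "f \<in> hom (Set_cat U) A B" "g \<in> hom (Set_cat U) B C" "h \<in> hom (Set_cat U) C D"
  then show "Comp (Set_cat U) h (Comp (Set_cat U) g f) = Comp (Set_cat U) (Comp (Set_cat U) h g) f"
    by (auto simp: hom_Set_cat fun_eq_iff PiE_iff)
qed (auto simp: hom_Set_cat PiE_iff)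

lemma functor_cat_simps:
  "Obj (functor_cat A B) = {F. is_functor A B F \<and> ext_functor A F}"
  "Dom (functor_cat A B) = src" "Cod (functor_cat A B) = tgt"
  "Ident (functor_cat A B) F = Mor F (\<lambda>a \<in> Obj A. Ident B (fobj F a)) F"
  "Comp (functor_cat A B) \<beta> \<alpha> = Mor (src \<alpha>) (\<lambda>a \<in> Obj A. Comp B (mp \<beta> a) (mp \<alpha> a)) (tgt \<beta>)"
  by (simp_all add: functor_cat_def)

lemma hom_functor_cat: "\<alpha> \<in> hom (functor_cat A B) F G \<longleftrightarrow> src \<alpha> = F \<and> tgt \<alpha> = G \<and>
    is_functor A B F \<and> ext_functor A F \<and> is_functor A B G \<and> ext_functor A G \<and>
    natural A B F G (mp \<alpha>) \<and> mp \<alpha> \<in> extensional (Obj A)"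
  by (cases \<alpha>) (auto simp: functor_cat_def hom_def)

lemma category_functor_cat:
  assumes "category A" "category B"
  shows "category (functor_cat A B)"
proof -
  interpret A: category A by fact
  interpret B: category B by fact
  show ?thesis
  proof
    fix \<alpha> assume "\<alpha> \<in> Arr (functor_cat A B)"
    then show "Dom (functor_cat A B) \<alpha> \<in> Obj (functor_cat A B)"
      "Cod (functor_cat A B) \<alpha> \<in> Obj (functor_cat A B)" by (auto simp: functor_cat_def)
  next
    fix F assume F: "F \<in> Obj (functor_cat A B)"
    then interpret F: is_functor A B F by (simp add: functor_cat_simps)
    show "Ident (functor_cat A B) F \<in> hom (functor_cat A B) F F"
      using F F.map_obj B.ident_hom A.dom_obj A.cod_obj B.ident_left[OF F.map_hom[OF hom_arr]]
        B.ident_right[OF F.map_hom[OF hom_arr]]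
      by (auto simp: hom_functor_cat functor_cat_simps natural_def)
  next
    fix \<alpha> F G \<beta> H assume a: "\<alpha> \<in> hom (functor_cat A B) F G" and b: "\<beta> \<in> hom (functor_cat A B) G H"
    interpret F: is_functor A B F using a by (simp add: hom_functor_cat)
    interpret G: is_functor A B G using a by (simp add: hom_functor_cat)
    interpret H: is_functor A B H using b by (simp add: hom_functor_cat)
    have ac: "mp \<alpha> a \<in> hom B (fobj F a) (fobj G a)" and bc: "mp \<beta> a \<in> hom B (fobj G a) (fobj H a)"
      if "a \<in> Obj A" for a using a b that by (auto simp: hom_functor_cat natural_def)
    have "Comp B (Comp B (mp \<beta> (Cod A f)) (mp \<alpha> (Cod A f))) (farr F f) =
      Comp B (farr H f) (Comp B (mp \<beta> (Dom A f)) (mp \<alpha> (Dom A f)))" if f: "f \<in> Arr A" for f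
    proof -
      note d = A.dom_obj[OF f] and c = A.cod_obj[OF f]
      note Ff = F.map_hom[OF hom_arr[OF f]] and Gf = G.map_hom[OF hom_arr[OF f]]
        and Hf = H.map_hom[OF hom_arr[OF f]]
      have na: "Comp B (mp \<alpha> (Cod A f)) (farr F f) = Comp B (farr G f) (mp \<alpha> (Dom A f))"
        and nb: "Comp B (mp \<beta> (Cod A f)) (farr G f) = Comp B (farr H f) (mp \<beta> (Dom A f))"
        using a b f by (auto simp: hom_functor_cat natural_def)
      have "Comp B (Comp B (mp \<beta> (Cod A f)) (mp \<alpha> (Cod A f))) (farr F f) =
          Comp B (Comp B (mp \<beta> (Cod A f)) (farr G f)) (mp \<alpha> (Dom A f))"
        using B.assoc[OF Ff ac[OF c] bc[OF c]] B.assoc[OF ac[OF d] Gf bc[OF c]] na by simp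
      then show ?thesis using nb B.assoc[OF ac[OF d] bc[OF d] Hf] by simp
    qed
    then show "Comp (functor_cat A B) \<beta> \<alpha> \<in> hom (functor_cat A B) F H"
      using a b B.comp_hom[OF ac bc] A.dom_obj A.cod_obj
      by (simp add: hom_functor_cat functor_cat_simps natural_def)
  next
    fix \<alpha> F G assume a: "\<alpha> \<in> hom (functor_cat A B) F G"
    have ac: "mp \<alpha> a \<in> hom B (fobj F a) (fobj G a)" if "a \<in> Obj A" for a
      using a that by (auto simp: hom_functor_cat natural_def)
    have "(\<lambda>a\<in>Obj A. Comp B ((\<lambda>a\<in>Obj A. Ident B (fobj G a)) a) (mp \<alpha> a)) = mp \<alpha>"
      "(\<lambda>a\<in>Obj A. Comp B (mp \<alpha> a) ((\<lambda>a\<in>Obj A. Ident B (fobj F a)) a)) = mp \<alpha>"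
      using a B.ident_left[OF ac] B.ident_right[OF ac]
      by (auto simp: hom_functor_cat fun_eq_iff extensional_def)
    then show "Comp (functor_cat A B) (Ident (functor_cat A B) G) \<alpha> = \<alpha>"
      "Comp (functor_cat A B) \<alpha> (Ident (functor_cat A B) F) = \<alpha>"
      using a by (auto simp: hom_functor_cat functor_cat_simps intro: mor_eqI)
  next
    fix \<alpha> F G \<beta> H \<gamma> J assume a: "\<alpha> \<in> hom (functor_cat A B) F G"
      and b: "\<beta> \<in> hom (functor_cat A B) G H" and c: "\<gamma> \<in> hom (functor_cat A B) H J"
    have "Comp B (mp \<gamma> x) (Comp B (mp \<beta> x) (mp \<alpha> x)) = Comp B (Comp B (mp \<gamma> x) (mp \<beta> x)) (mp \<alpha> x)"
      if "x \<in> Obj A" for x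
      by (rule B.assoc) (use a b c that in \<open>auto simp: hom_functor_cat natural_def\<close>)
    then show "Comp (functor_cat A B) \<gamma> (Comp (functor_cat A B) \<beta> \<alpha>) =
        Comp (functor_cat A B) (Comp (functor_cat A B) \<gamma> \<beta>) \<alpha>"
      by (auto simp: functor_cat_simps fun_eq_iff)
  qed
qed

text \<open>Componentwise inverses are natural, by conjugating the naturality squares. This
  identifies the weak equivalences of \<open>proj_model\<close> with the isomorphisms of
  presheaves.\<close>

lemma is_iso_functor_cat:
  assumes cA: "category A" and cB: "category B" and a: "\<alpha> \<in> Arr (functor_cat A B)"
  shows "is_iso (functor_cat A B) \<alpha> \<longleftrightarrow> (\<forall>c \<in> Obj A. is_iso B (mp \<alpha> c))"
proof -
  interpret A: category A by fact
  interpret B: category B by fact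
  obtain F G where a: "\<alpha> \<in> hom (functor_cat A B) F G" using hom_arr[OF a] by blast
  interpret F: is_functor A B F using a by (simp add: hom_functor_cat)
  interpret G: is_functor A B G using a by (simp add: hom_functor_cat)
  have ac: "mp \<alpha> c \<in> hom B (fobj F c) (fobj G c)" if "c \<in> Obj A" for c
    using a that by (auto simp: hom_functor_cat natural_def)
  have na: "Comp B (mp \<alpha> (Cod A f)) (farr F f) = Comp B (farr G f) (mp \<alpha> (Dom A f))"
    if "f \<in> Arr A" for f using a that by (auto simp: hom_functor_cat natural_def)
  show ?thesis
  proof
    assume "is_iso (functor_cat A B) \<alpha>"
    then obtain \<beta> where b: "\<beta> \<in> hom (functor_cat A B) G F"
      "Comp (functor_cat A B) \<beta> \<alpha> = Ident (functor_cat A B) F"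
      "Comp (functor_cat A B) \<alpha> \<beta> = Ident (functor_cat A B) G"
      using category.is_isoE[OF category_functor_cat[OF cA cB] _ a] by blast
    have bc: "mp \<beta> c \<in> hom B (fobj G c) (fobj F c)" if "c \<in> Obj A" for c
      using b that by (auto simp: hom_functor_cat natural_def)
    have "Comp B (mp \<beta> c) (mp \<alpha> c) = Ident B (fobj F c)"
      "Comp B (mp \<alpha> c) (mp \<beta> c) = Ident B (fobj G c)" if "c \<in> Obj A" for c
      using that b(2,3) by (auto simp: functor_cat_simps fun_eq_iff restrict_def split: if_splits)
    then show "\<forall>c \<in> Obj A. is_iso B (mp \<alpha> c)" using B.is_isoI[OF ac bc] by blast
  next
    assume "\<forall>c \<in> Obj A. is_iso B (mp \<alpha> c)"
    then have "\<forall>c \<in> Obj A. \<exists>g. g \<in> hom B (fobj G c) (fobj F c) \<and>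
        Comp B g (mp \<alpha> c) = Ident B (fobj F c) \<and> Comp B (mp \<alpha> c) g = Ident B (fobj G c)"
      using B.is_isoE ac by metis
    then obtain b where b: "\<And>c. c \<in> Obj A \<Longrightarrow> b c \<in> hom B (fobj G c) (fobj F c)"
      "\<And>c. c \<in> Obj A \<Longrightarrow> Comp B (b c) (mp \<alpha> c) = Ident B (fobj F c)"
      "\<And>c. c \<in> Obj A \<Longrightarrow> Comp B (mp \<alpha> c) (b c) = Ident B (fobj G c)" by metis
    let ?b = "Mor G (\<lambda>c\<in>Obj A. b c) F"
    have "Comp B (b (Cod A f)) (farr G f) = Comp B (farr F f) (b (Dom A f))" if f: "f \<in> Arr A" for f
    proof -
      note d = A.dom_obj[OF f] and c = A.cod_obj[OF f]
      note Ff = F.map_hom[OF hom_arr[OF f]] and Gf = G.map_hom[OF hom_arr[OF f]]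
      have "Comp B (b (Cod A f)) (farr G f) =
        Comp B (b (Cod A f)) (Comp B (Comp B (farr G f) (mp \<alpha> (Dom A f))) (b (Dom A f)))"
        using B.assoc[OF b(1)[OF d] ac[OF d] Gf] b(3)[OF d] B.ident_right[OF Gf] by simp
      also have "\<dots> = Comp B (Comp B (Comp B (b (Cod A f)) (mp \<alpha> (Cod A f))) (farr F f)) (b (Dom A f))"
        using na[OF f] B.assoc[OF Ff ac[OF c] b(1)[OF c]]
          B.assoc[OF b(1)[OF d] B.comp_hom[OF Ff ac[OF c]] b(1)[OF c]] by simp
      also have "\<dots> = Comp B (farr F f) (b (Dom A f))"
        using b(2)[OF c] B.ident_left[OF Ff] by simp
      finally show ?thesis .
    qed
    then have bh: "?b \<in> hom (functor_cat A B) G F"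
      using a b(1) A.dom_obj A.cod_obj by (auto simp: hom_functor_cat natural_def)
    show "is_iso (functor_cat A B) \<alpha>"
      by (rule category.is_isoI[OF category_functor_cat[OF cA cB] a bh])
        (use a b in \<open>auto simp: functor_cat_simps hom_functor_cat fun_eq_iff\<close>)
  qed
qed

section \<open>Small categories over a base\<close>

abbreviation ob :: "'u over \<Rightarrow> 'u set" where "ob x \<equiv> Obj (src x)"
abbreviation ar :: "'u over \<Rightarrow> 'u set" where "ar x \<equiv> Arr (src x)"
abbreviation po :: "'u over \<Rightarrow> 'u \<Rightarrow> 'u" where "po x \<equiv> fobj (mp x)"
abbreviation pa :: "'u over \<Rightarrow> 'u \<Rightarrow> 'u" where "pa x \<equiv> farr (mp x)"

definition over_fun :: "'u over \<Rightarrow> 'u over \<Rightarrow> 'u sfun \<Rightarrow> bool" where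
  "over_fun x y H \<longleftrightarrow> is_functor (src x) (src y) H \<and> ext_functor (src x) H \<and>
    (\<forall>a \<in> ob x. po y (fobj H a) = po x a) \<and> (\<forall>g \<in> ar x. pa y (farr H g) = pa x g)"

text \<open>Two layers: the outer \<open>Mor\<close> is the arrow of the slice, the inner one the
  underlying arrow of \<open>Cat_cat\<close>.\<close>

definition over_arr :: "'u over \<Rightarrow> 'u over \<Rightarrow> 'u sfun \<Rightarrow> ('u over, 'u over) mor" where
  "over_arr x y H = Mor x (Mor (src x) H (src y)) y"

lemma over_arr_simps [simp]: "src (over_arr x y H) = x" "tgt (over_arr x y H) = y"
  "mp (over_arr x y H) = Mor (src x) H (src y)" "over_arr x y H = over_arr x' y' H' \<longleftrightarrow> x = x' \<and> y = y' \<and> H = H'"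
  by (auto simp: over_arr_def)

section \<open>The universe, codes of pairs, and the slice over C in elementary terms\<close>

locale small_base =
  fixes U :: "'u set set" and C :: "'u scat"
  assumes universe: "universe U" and small: "small_category U C"
begin

lemma infinite_UNIV: "infinite (UNIV :: 'u set)"
  using universe by (simp add: universe_def)

text \<open>An infinite type is in bijection with its square, so the \<open>SOME\<close> in
  \<open>upair\<close> does pick an injection.\<close>

lemma upair_inject [simp]: "upair a b = upair c d \<longleftrightarrow> a = c \<and> b = (d :: 'u)"
proof -
  obtain f :: "'u \<times> 'u \<Rightarrow> 'u" where "bij f"
    using card_of_Times_same_infinite[OF infinite_UNIV] unfolding card_of_ordIso[symmetric] by auto
  then have "\<exists>c :: 'u \<times> 'u \<Rightarrow> 'u. inj c" by (auto simp: bij_def)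
  then have i: "inj (SOME c :: 'u \<times> 'u \<Rightarrow> 'u. inj c)" by (rule someI_ex)
  show ?thesis unfolding upair_def inj_eq[OF i] by simp
qed

lemma upair_sel [simp]: "ufst (upair a b) = (a :: 'u)" "usnd (upair a b) = b"
  by (auto simp: ufst_def usnd_def)

lemma utriple_inject [simp]: "utriple a b c = utriple a' b' c' \<longleftrightarrow> a = a' \<and> b = b' \<and> c = (c' :: 'u)"
  by (simp add: utriple_def)

lemma utriple_sel [simp]: "usrc (utriple a b c) = (a :: 'u)" "uarr (utriple a b c) = b"
  "utgt (utriple a b c) = c"
  by (auto simp: usrc_def uarr_def utgt_def utriple_def)

lemma U_subset: "A \<in> U \<Longrightarrow> B \<subseteq> A \<Longrightarrow> B \<in> U"
  using universe by (auto simp: universe_def)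

lemma U_finite: "finite A \<Longrightarrow> A \<in> U"
  using universe by (auto simp: universe_def)

lemma U_UN: "A \<in> U \<Longrightarrow> (\<And>a. a \<in> A \<Longrightarrow> B a \<in> U) \<Longrightarrow> (\<Union>a\<in>A. B a) \<in> U"
  using universe by (auto simp: universe_def)

text \<open>Replacement is closure under small unions, applied to singletons.\<close>

lemma U_image:
  assumes "A \<in> U" shows "f ` A \<in> U"
proof -
  have "(\<Union>a\<in>A. {f a}) \<in> U" by (rule U_UN[OF assms]) (simp add: U_finite)
  moreover have "(\<Union>a\<in>A. {f a}) = f ` A" by auto
  ultimately show ?thesis by simp
qed

lemma U_pairs:
  assumes "A \<in> U" "B \<in> U" shows "{f a b | a b. a \<in> A \<and> b \<in> B} \<in> U"
proof -
  have "(\<Union>a\<in>A. f a ` B) \<in> U" by (rule U_UN[OF assms(1)]) (rule U_image[OF assms(2)])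
  moreover have "(\<Union>a\<in>A. f a ` B) = {f a b | a b. a \<in> A \<and> b \<in> B}" by auto
  ultimately show ?thesis by simp
qed

sublocale C: category C using small by (simp add: small_category_def)

abbreviation K where "K \<equiv> Cat_over U C"
abbreviation Psh where "Psh \<equiv> presheaves U C"

sublocale K: category K by (rule category.category_slice[OF category_Cat_cat])

sublocale Psh: category Psh
  by (intro category_functor_cat C.category_op_cat category_Set_cat)

definition over :: "'u over \<Rightarrow> bool" where
  "over x \<longleftrightarrow> small_category U (src x) \<and> tgt x = C \<and> is_functor (src x) C (mp x) \<and>
    ext_functor (src x) (mp x)"

lemma overD:
  assumes "over x"
  shows "category (src x)" "is_functor (src x) C (mp x)" "tgt x = C" "ob x \<in> U" "ar x \<in> U"
    "ext_functor (src x) (mp x)" "ext_cat (src x)"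
  using assms by (auto simp: over_def small_category_def)

lemma Obj_K: "x \<in> Obj K \<longleftrightarrow> over x"
  using small by (auto simp: Arr_Cat_cat Cat_cat_simps over_def)

text \<open>The commuting triangle of the slice is split into its values on objects and on arrows,
  so that functors over C can be handled without composites.\<close>

lemma hom_K: "h \<in> hom K x y \<longleftrightarrow> over x \<and> over y \<and> (\<exists>H. over_fun x y H \<and> h = over_arr x y H)"
proof
  assume h: "h \<in> hom K x y"
  then have o: "over x" "over y" using K.hom_obj Obj_K by blast+
  have m: "mp h \<in> hom (Cat_cat U) (src x) (src y)" "Comp (Cat_cat U) y (mp h) = x"
    "src h = x" "tgt h = y"
    using h by (auto simp: hom_slice Cat_cat_simps)
  have e: "mp x = fun_comp (src x) (mp y) (mp (mp h))" "src (mp h) = src x" "tgt (mp h) = src y"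
    using m(1) arg_cong[OF m(2), of mp] by (auto simp: Cat_cat_simps hom_def)
  have po: "po x a = po y (fobj (mp (mp h)) a)" if "a \<in> ob x" for a
    using that by (subst e(1)) simp
  have pa: "pa x a = pa y (farr (mp (mp h)) a)" if "a \<in> ar x" for a
    using that by (subst e(1)) simp
  have "over_fun x y (mp (mp h))"
    using m(1) po pa unfolding over_fun_def by (auto simp: hom_def Arr_Cat_cat Cat_cat_simps)
  moreover have "h = over_arr x y (mp (mp h))"
    using m(3,4) e(2,3) by (intro mor_eqI) (auto intro: mor_eqI)
  ultimately show "over x \<and> over y \<and> (\<exists>H. over_fun x y H \<and> h = over_arr x y H)" using o by blast
next
  assume "over x \<and> over y \<and> (\<exists>H. over_fun x y H \<and> h = over_arr x y H)"
  then obtain H where o: "over x" "over y" and H: "over_fun x y H" and h: "h = over_arr x y H" by blast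
  have "fun_comp (src x) (mp y) H = mp x"
    by (rule fctr_eqI[of "src x"]) (use H overD[OF o(1)] in \<open>auto simp: over_fun_def\<close>)
  then show "h \<in> hom K x y"
    using o H unfolding h hom_slice
    by (auto simp: Arr_Cat_cat Cat_cat_simps over_def small over_fun_def hom_def intro: mor_eqI)
qed

lemma hom_KI: "over x \<Longrightarrow> over y \<Longrightarrow> over_fun x y H \<Longrightarrow> over_arr x y H \<in> hom K x y"
  by (auto simp: hom_K)

lemma hom_KE:
  assumes "h \<in> hom K x y"
  obtains H where "over x" "over y" "over_fun x y H" "h = over_arr x y H"
  using assms hom_K by blast

lemma Comp_K: "Comp K (over_arr y z G) (over_arr x y' F) = over_arr x z (fun_comp (src x) G F)"
  by (simp add: Cat_cat_simps) (simp add: over_arr_def)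

lemma Ident_K: "Ident K x = over_arr x x (fun_id (src x))"
  by (simp add: Cat_cat_simps over_arr_def)

lemma over_funD:
  assumes "over_fun x y H"
  shows "a \<in> ob x \<Longrightarrow> fobj H a \<in> ob y" "f \<in> ar x \<Longrightarrow> farr H f \<in> ar y"
    "f \<in> ar x \<Longrightarrow> Dom (src y) (farr H f) = fobj H (Dom (src x) f)"
    "f \<in> ar x \<Longrightarrow> Cod (src y) (farr H f) = fobj H (Cod (src x) f)"
    "a \<in> ob x \<Longrightarrow> po y (fobj H a) = po x a" "f \<in> ar x \<Longrightarrow> pa y (farr H f) = pa x f"
    "ext_functor (src x) H"
proof -
  interpret is_functor "src x" "src y" H using assms by (simp add: over_fun_def)
  show "a \<in> ob x \<Longrightarrow> fobj H a \<in> ob y" by (rule map_obj)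
  show "f \<in> ar x \<Longrightarrow> farr H f \<in> ar y"
    "f \<in> ar x \<Longrightarrow> Dom (src y) (farr H f) = fobj H (Dom (src x) f)"
    "f \<in> ar x \<Longrightarrow> Cod (src y) (farr H f) = fobj H (Cod (src x) f)" by (rule map_arr; simp)+
qed (use assms in \<open>auto simp: over_fun_def\<close>)

lemma over_funI:
  assumes x: "over x" and y: "over y" and "ext_functor (src x) H"
    and "\<And>a. a \<in> ob x \<Longrightarrow> fobj H a \<in> ob y \<and> po y (fobj H a) = po x a"
    and "\<And>f. f \<in> ar x \<Longrightarrow> farr H f \<in> ar y \<and> pa y (farr H f) = pa x f \<and>
      Dom (src y) (farr H f) = fobj H (Dom (src x) f) \<and> Cod (src y) (farr H f) = fobj H (Cod (src x) f)"
    and "\<And>a. a \<in> ob x \<Longrightarrow> farr H (Ident (src x) a) = Ident (src y) (fobj H a)"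
    and "\<And>f g. f \<in> ar x \<Longrightarrow> g \<in> ar x \<Longrightarrow> Dom (src x) g = Cod (src x) f \<Longrightarrow>
      farr H (Comp (src x) g f) = Comp (src y) (farr H g) (farr H f)"
  shows "over_fun x y H"
proof -
  have "is_functor (src x) (src y) H"
    by (intro is_functor.intro is_functor_axioms.intro overD[OF x] overD[OF y])
      (use assms in \<open>auto simp: hom_def\<close>)
  then show ?thesis using assms by (auto simp: over_fun_def)
qed

lemma over_arr_ident: "over x \<Longrightarrow> a \<in> ob x \<Longrightarrow>
    pa x (Ident (src x) a) = Ident C (po x a)"
  using is_functor.map_ident[OF overD(2)] by blast

lemma over_arr_comp: "over x \<Longrightarrow> f \<in> ar x \<Longrightarrow> g \<in> ar x \<Longrightarrow> Dom (src x) g = Cod (src x) f \<Longrightarrow>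
    pa x (Comp (src x) g f) = Comp C (pa x g) (pa x f)"
  using is_functor.map_comp[OF overD(2), of x f _ _ g] by (auto simp: hom_def)

lemma over_map:
  assumes "over x"
  shows "a \<in> ob x \<Longrightarrow> po x a \<in> Obj C" "f \<in> ar x \<Longrightarrow> pa x f \<in> Arr C"
    "f \<in> ar x \<Longrightarrow> Dom C (pa x f) = po x (Dom (src x) f)"
    "f \<in> ar x \<Longrightarrow> Cod C (pa x f) = po x (Cod (src x) f)"
    "f \<in> ar x \<Longrightarrow> Dom (src x) f \<in> ob x" "f \<in> ar x \<Longrightarrow> Cod (src x) f \<in> ob x"
  using is_functor.map_obj[OF overD(2)[OF assms]] is_functor.map_arr[OF overD(2)[OF assms]]
    category.dom_obj[OF overD(1)[OF assms]] category.cod_obj[OF overD(1)[OF assms]] by blast+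

section \<open>Discrete fibrations over C\<close>

abbreviation disc :: "'u over \<Rightarrow> bool" where "disc x \<equiv> discrete_fibration (src x) C (mp x)"

abbreviation D where "D \<equiv> {x. over x \<and> disc x}"

lemma disc_lift:
  assumes "disc x" "a \<in> ob x" "f \<in> Arr C" "Cod C f = po x a"
  shows "\<exists>!g. g \<in> ar x \<and> Cod (src x) g = a \<and> pa x g = f"
  using assms by (auto simp: discrete_fibration_def)

lemma disc_arr_eq:
  assumes "disc x" "over x" "f \<in> ar x" "g \<in> ar x" "Cod (src x) f = Cod (src x) g" "pa x f = pa x g"
  shows "f = g"
  using disc_lift[OF assms(1), of "Cod (src x) f" "pa x f"] over_map[OF assms(2)] assms by metis

text \<open>An arrow of a discrete fibration is determined by its codomain and its image in C, and a
  functor over C prescribes both once its object part is known. Equalities of arrows into D are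
  therefore checked on objects only.\<close>

lemma disc_fun_eq:
  assumes "disc z" "over z" "over x" and H: "over_fun x z H" and H': "over_fun x z H'"
    and eq: "\<And>a. a \<in> ob x \<Longrightarrow> fobj H a = fobj H' a"
  shows "H = H'"
proof (rule fctr_eqI[of "src x"])
  fix f assume f: "f \<in> ar x"
  show "farr H f = farr H' f"
    by (rule disc_arr_eq[OF assms(1,2)])
      (use f over_funD[OF H] over_funD[OF H'] eq over_map[OF \<open>over x\<close>] in auto)
qed (use over_funD[OF H] over_funD[OF H'] eq in auto)

text \<open>The inverse maps respect sources, targets, identities and composites because H does and
  is injective.\<close>

lemma over_arr_isoI:
  assumes x: "over x" and y: "over y" and H: "over_fun x y H"
    and bo: "bij_betw (fobj H) (ob x) (ob y)" and ba: "bij_betw (farr H) (ar x) (ar y)"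
  shows "is_iso K (over_arr x y H)"
proof -
  define io ia where "io = inv_into (ob x) (fobj H)" and "ia = inv_into (ar x) (farr H)"
  let ?G = "\<lparr>fobj = restrict io (ob y), farr = restrict ia (ar y)\<rparr>"
  have io: "io b \<in> ob x" "fobj H (io b) = b" if "b \<in> ob y" for b
    using bo that unfolding io_def bij_betw_def by (auto simp: inv_into_into f_inv_into_f)
  have ia: "ia g \<in> ar x" "farr H (ia g) = g" if "g \<in> ar y" for g
    using ba that unfolding ia_def bij_betw_def by (auto simp: inv_into_into f_inv_into_f)
  have io': "io (fobj H a) = a" if "a \<in> ob x" for a
    using bo that unfolding io_def bij_betw_def by auto
  have ia': "ia (farr H a) = a" if "a \<in> ar x" for a
    using ba that unfolding ia_def bij_betw_def by auto
  interpret x: category "src x" using overD[OF x] by simp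
  interpret y: category "src y" using overD[OF y] by simp
  interpret H: is_functor "src x" "src y" H using H by (simp add: over_fun_def)
  note H' = over_funD[OF H]
  have G: "over_fun y x ?G"
  proof (rule over_funI[OF y x])
    fix f assume f: "f \<in> ar y"
    have "Dom (src x) (ia f) = io (Dom (src y) f)" "Cod (src x) (ia f) = io (Cod (src y) f)"
      using H'(3,4)[of "ia f"] ia[OF f] io' x.dom_obj x.cod_obj by metis+
    then show "farr ?G f \<in> ar x \<and> pa x (farr ?G f) = pa y f \<and>
      Dom (src x) (farr ?G f) = fobj ?G (Dom (src y) f) \<and> Cod (src x) (farr ?G f) = fobj ?G (Cod (src y) f)"
      using f ia[OF f] H'(6)[of "ia f"] y.dom_obj y.cod_obj by simp
  next
    fix a assume a: "a \<in> ob y"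
    then show "fobj ?G a \<in> ob x \<and> po x (fobj ?G a) = po y a" using io H'(5)[of "io a"] by auto
    have "ia (Ident (src y) a) = Ident (src x) (io a)"
      using H.map_ident[OF io(1)[OF a]] ia'[OF x.ident_arr(1)[OF io(1)[OF a]]] io[OF a] by simp
    then show "farr ?G (Ident (src y) a) = Ident (src x) (fobj ?G a)" using a y.ident_arr by simp
  next
    fix f g assume f: "f \<in> ar y" and g: "g \<in> ar y" and d: "Dom (src y) g = Cod (src y) f"
    have d': "Dom (src x) (ia g) = Cod (src x) (ia f)"
      using H'(3,4)[of "ia g"] H'(3,4)[of "ia f"] ia[OF f] ia[OF g] io' x.dom_obj x.cod_obj d by metis
    have "farr H (Comp (src x) (ia g) (ia f)) = Comp (src y) g f"
      using H.map_comp[of "ia f" _ _ "ia g"] ia f g d' by (auto simp: hom_def)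
    then have "ia (Comp (src y) g f) = Comp (src x) (ia g) (ia f)"
      using ia'[OF x.comp_arr(1)[OF ia(1)[OF f] ia(1)[OF g] d']] by simp
    then show "farr ?G (Comp (src y) g f) = Comp (src x) (farr ?G g) (farr ?G f)"
      using f g y.comp_arr(1)[OF f g d] by simp
  qed (simp add: ext_functor_def)
  have "fun_comp (src x) ?G H = fun_id (src x)"
    by (rule fctr_eqI[of "src x"]) (auto simp: H' io' ia')
  moreover have "fun_comp (src y) H ?G = fun_id (src y)"
    by (rule fctr_eqI[of "src y"]) (auto simp: io ia)
  ultimately show ?thesis
    by (intro K.is_isoI[OF hom_KI[OF x y H] hom_KI[OF y x G]]) (simp_all only: Comp_K Ident_K)
qed

text \<open>A lift is found in y and carried back by the inverse functor; it is unique because F is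
  injective on arrows.\<close>

lemma disc_iso:
  assumes f: "f \<in> hom K x y" "is_iso K f" and y: "disc y"
  shows "disc x"
proof -
  obtain F where F: "over x" "over y" "over_fun x y F" "f = over_arr x y F" using hom_KE[OF f(1)] .
  obtain g where g: "g \<in> hom K y x" "Comp K g f = Ident K x" using K.is_isoE[OF f(2,1)] .
  obtain G where G: "over_fun y x G" "g = over_arr y x G" using hom_KE[OF g(1)] .
  have GF: "fun_comp (src x) G F = fun_id (src x)" using g(2) unfolding F G Comp_K Ident_K by simp
  have o: "fobj G (fobj F a) = a" if "a \<in> ob x" for a
    using arg_cong[OF GF, of "\<lambda>H. fobj H a"] that by simp
  have a: "farr G (farr F a) = a" if "a \<in> ar x" for a
    using arg_cong[OF GF, of "\<lambda>H. farr H a"] that by simp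
  note FD = over_funD[OF F(3)] and GD = over_funD[OF G(1)]
  show ?thesis
    unfolding discrete_fibration_def
  proof (intro conjI ballI impI)
    show "is_functor (src x) C (mp x)" using overD F by blast
    fix b h assume b: "b \<in> ob x" and h: "h \<in> Arr C" "Cod C h = po x b"
    obtain k where k: "k \<in> ar y" "Cod (src y) k = fobj F b" "pa y k = h"
      using disc_lift[OF y FD(1)[OF b] h(1)] h(2) FD(5)[OF b] by auto
    show "\<exists>!g. g \<in> ar x \<and> Cod (src x) g = b \<and> pa x g = h"
    proof (rule ex1I[of _ "farr G k"])
      show "farr G k \<in> ar x \<and> Cod (src x) (farr G k) = b \<and> pa x (farr G k) = h"
        using GD(2,4,6)[OF k(1)] k o[OF b] by simp
    next
      fix l assume l: "l \<in> ar x \<and> Cod (src x) l = b \<and> pa x l = h"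
      then have "farr F l = k"
        using disc_arr_eq[OF y F(2), of "farr F l" k] FD(2,4,6)[of l] k by auto
      then show "l = farr G k" using a l by auto
    qed
  qed
qed

definition terminal_over :: "'u over" where
  "terminal_over = Mor C (fun_id C) C"

lemma over_terminal: "over terminal_over"
  using small C.is_functor_id by (simp add: over_def terminal_over_def)

lemma terminal_K: "terminal K terminal_over"
proof -
  have "\<exists>!f. f \<in> hom K x terminal_over" if x: "over x" for x
  proof (rule ex1I[of _ "over_arr x terminal_over (mp x)"])
    show "over_arr x terminal_over (mp x) \<in> hom K x terminal_over"
      by (rule hom_KI[OF x over_terminal])
        (use over_map[OF x] overD[OF x] in \<open>auto simp: over_fun_def terminal_over_def\<close>)
  next
    fix h assume "h \<in> hom K x terminal_over"
    then obtain H where H: "over_fun x terminal_over H" "h = over_arr x terminal_over H"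
      using hom_KE by metis
    have "H = mp x"
      by (rule fctr_eqI[of "src x"])
        (use over_funD[OF H(1)] overD[OF x] in \<open>auto simp: terminal_over_def\<close>)
    then show "h = over_arr x terminal_over (mp x)" using H by simp
  qed
  then show ?thesis using over_terminal Obj_K unfolding terminal_def by blast
qed

end

section \<open>Presheaves and categories of elements\<close>

definition act :: "'u psh \<Rightarrow> 'u \<Rightarrow> 'u \<Rightarrow> 'u" where
  "act F f y = mp (farr F f) y"

definition app :: "'u pshmor \<Rightarrow> 'u \<Rightarrow> 'u \<Rightarrow> 'u" where
  "app \<alpha> c x = mp (mp \<alpha> c) x"

context small_base
begin

section \<open>Presheaves as families of sets with an action of C\<close>

lemma psh_functor: "F \<in> Obj Psh \<Longrightarrow> is_functor (op_cat C) (Set_cat U) F"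
  "F \<in> Obj Psh \<Longrightarrow> ext_functor (op_cat C) F"
  by (simp_all add: functor_cat_simps)

lemma psh_farr:
  assumes "F \<in> Obj Psh" "f \<in> Arr C"
  shows "farr F f = Mor (fobj F (Cod C f)) (mp (farr F f)) (fobj F (Dom C f))"
    "mp (farr F f) \<in> fobj F (Cod C f) \<rightarrow>\<^sub>E fobj F (Dom C f)"
  using is_functor.map_hom[OF psh_functor(1)[OF assms(1)], of f "Cod C f" "Dom C f"] assms(2)
  by (auto simp: hom_Set_cat hom_arr intro: mor_eqI)

lemma psh_U: "F \<in> Obj Psh \<Longrightarrow> c \<in> Obj C \<Longrightarrow> fobj F c \<in> U"
  using is_functor.map_obj[OF psh_functor(1)] by fastforce

lemma act_in: "F \<in> Obj Psh \<Longrightarrow> f \<in> Arr C \<Longrightarrow> y \<in> fobj F (Cod C f) \<Longrightarrow> act F f y \<in> fobj F (Dom C f)"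
  using psh_farr(2) by (fastforce simp: act_def)

lemma act_ident:
  assumes F: "F \<in> Obj Psh" and c: "c \<in> Obj C" and y: "y \<in> fobj F c"
  shows "act F (Ident C c) y = y"
  using is_functor.map_ident[OF psh_functor(1)[OF F], of c] c y by (simp add: act_def)

lemma act_comp:
  assumes F: "F \<in> Obj Psh" and f: "f \<in> Arr C" and g: "g \<in> Arr C" and d: "Dom C g = Cod C f"
    and y: "y \<in> fobj F (Cod C g)"
  shows "act F (Comp C g f) y = act F f (act F g y)"
proof -
  have "farr F (Comp C g f) = Comp (Set_cat U) (farr F f) (farr F g)"
    using is_functor.map_comp[OF psh_functor(1)[OF F], of g "Cod C g" "Dom C g" f "Dom C f"] f g d
    by (simp add: hom_def)
  moreover have "src (farr F g) = fobj F (Cod C g)" using psh_farr(1)[OF F g] by (metis mor.sel(1))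
  ultimately show ?thesis using y by (simp add: act_def)
qed

definition mk_psh :: "('u \<Rightarrow> 'u set) \<Rightarrow> ('u \<Rightarrow> 'u \<Rightarrow> 'u) \<Rightarrow> 'u psh" where
  "mk_psh S a = \<lparr>fobj = (\<lambda>c \<in> Obj C. S c),
    farr = (\<lambda>f \<in> Arr C. Mor (S (Cod C f)) (\<lambda>y \<in> S (Cod C f). a f y) (S (Dom C f)))\<rparr>"

lemma mk_psh_simps [simp]: "c \<in> Obj C \<Longrightarrow> fobj (mk_psh S a) c = S c"
  "f \<in> Arr C \<Longrightarrow> y \<in> S (Cod C f) \<Longrightarrow> act (mk_psh S a) f y = a f y"
  by (simp_all add: mk_psh_def act_def)

lemma mk_psh:
  assumes "\<And>c. c \<in> Obj C \<Longrightarrow> S c \<in> U"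
    and a: "\<And>f y. f \<in> Arr C \<Longrightarrow> y \<in> S (Cod C f) \<Longrightarrow> a f y \<in> S (Dom C f)"
    and id: "\<And>c y. c \<in> Obj C \<Longrightarrow> y \<in> S c \<Longrightarrow> a (Ident C c) y = y"
    and comp: "\<And>f g y. f \<in> Arr C \<Longrightarrow> g \<in> Arr C \<Longrightarrow> Dom C g = Cod C f \<Longrightarrow> y \<in> S (Cod C g) \<Longrightarrow>
      a (Comp C g f) y = a f (a g y)"
  shows "mk_psh S a \<in> Obj Psh"
proof -
  have "is_functor (op_cat C) (Set_cat U) (mk_psh S a)"
  proof (intro is_functor.intro is_functor_axioms.intro C.category_op_cat category_Set_cat)
    fix c assume "c \<in> Obj (op_cat C)"
    then show "fobj (mk_psh S a) c \<in> Obj (Set_cat U)" using assms(1) by simp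
  next
    fix f c d assume "f \<in> hom (op_cat C) c d"
    then have f: "f \<in> Arr C" "Cod C f = c" "Dom C f = d" by (auto simp: hom_def)
    then show "farr (mk_psh S a) f \<in> hom (Set_cat U) (fobj (mk_psh S a) c) (fobj (mk_psh S a) d)"
      using assms(1) C.dom_obj[OF f(1)] C.cod_obj[OF f(1)] a[OF f(1)]
      by (auto simp: hom_Set_cat mk_psh_def)
  next
    fix c assume "c \<in> Obj (op_cat C)"
    then show "farr (mk_psh S a) (Ident (op_cat C) c) = Ident (Set_cat U) (fobj (mk_psh S a) c)"
      using C.ident_arr id by (auto simp: mk_psh_def fun_eq_iff)
  next
    fix f b c g d assume "f \<in> hom (op_cat C) b c" "g \<in> hom (op_cat C) c d"
    then have f: "f \<in> Arr C" "g \<in> Arr C" "Cod C f = b" "Dom C f = c" "Cod C g = c" "Dom C g = d"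
      by (auto simp: hom_def)
    have "Dom C f = Cod C g" using f by simp
    note fg = C.comp_arr[OF f(2,1) this]
    show "farr (mk_psh S a) (Comp (op_cat C) g f) =
        Comp (Set_cat U) (farr (mk_psh S a) g) (farr (mk_psh S a) f)"
      using fg f comp[OF f(2,1)] a[OF f(1)] by (auto simp: mk_psh_def fun_eq_iff)
  qed
  then show ?thesis by (simp add: functor_cat_simps ext_functor_def mk_psh_def)
qed

definition nat_mor :: "'u psh \<Rightarrow> 'u psh \<Rightarrow> ('u \<Rightarrow> 'u \<Rightarrow> 'u) \<Rightarrow> 'u pshmor" where
  "nat_mor F G t = Mor F (\<lambda>c \<in> Obj C. Mor (fobj F c) (\<lambda>x \<in> fobj F c. t c x) (fobj G c)) G"

definition is_nat :: "'u psh \<Rightarrow> 'u psh \<Rightarrow> ('u \<Rightarrow> 'u \<Rightarrow> 'u) \<Rightarrow> bool" where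
  "is_nat F G t \<longleftrightarrow> (\<forall>c \<in> Obj C. \<forall>x \<in> fobj F c. t c x \<in> fobj G c) \<and>
    (\<forall>f \<in> Arr C. \<forall>y \<in> fobj F (Cod C f). t (Dom C f) (act F f y) = act G f (t (Cod C f) y))"

lemma app_nat_mor [simp]: "c \<in> Obj C \<Longrightarrow> x \<in> fobj F c \<Longrightarrow> app (nat_mor F G t) c x = t c x"
  by (simp add: app_def nat_mor_def)

lemma nat_mor_cong: "(\<And>c x. c \<in> Obj C \<Longrightarrow> x \<in> fobj F c \<Longrightarrow> t c x = t' c x) \<Longrightarrow>
    nat_mor F G t = nat_mor F G t'"
  by (auto simp: nat_mor_def fun_eq_iff)

lemma nat_mor_hom:
  assumes F: "F \<in> Obj Psh" and G: "G \<in> Obj Psh" and t: "is_nat F G t"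
  shows "nat_mor F G t \<in> hom Psh F G"
proof -
  have "Comp (Set_cat U) (mp (nat_mor F G t) (Dom C f)) (farr F f) =
      Comp (Set_cat U) (farr G f) (mp (nat_mor F G t) (Cod C f))" if f: "f \<in> Arr C" for f
    using C.dom_obj[OF f] C.cod_obj[OF f] act_in[OF F f] t f psh_farr(2)[OF F f]
    by (subst psh_farr(1)[OF F f], subst psh_farr(1)[OF G f])
      (auto simp: nat_mor_def is_nat_def fun_eq_iff act_def)
  moreover have "mp (nat_mor F G t) c \<in> hom (Set_cat U) (fobj F c) (fobj G c)" if "c \<in> Obj C" for c
    using that t psh_U[OF F] psh_U[OF G] by (auto simp: nat_mor_def hom_Set_cat is_nat_def)
  ultimately have "natural (op_cat C) (Set_cat U) F G (mp (nat_mor F G t))"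
    unfolding natural_def op_cat_simps by blast
  then show ?thesis
    using psh_functor[OF F] psh_functor[OF G] by (auto simp: hom_functor_cat nat_mor_def)
qed

lemma hom_Psh:
  assumes a: "\<alpha> \<in> hom Psh F G"
  shows "F \<in> Obj Psh" "G \<in> Obj Psh" "is_nat F G (app \<alpha>)" "\<alpha> = nat_mor F G (app \<alpha>)"
proof -
  show F: "F \<in> Obj Psh" and G: "G \<in> Obj Psh" using a Psh.hom_obj by blast+
  have c: "mp \<alpha> c \<in> hom (Set_cat U) (fobj F c) (fobj G c)" if "c \<in> Obj C" for c
    using a that by (auto simp: hom_functor_cat natural_def)
  have n: "Comp (Set_cat U) (mp \<alpha> (Dom C f)) (farr F f) = Comp (Set_cat U) (farr G f) (mp \<alpha> (Cod C f))"
    if "f \<in> Arr C" for f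
    using a that unfolding hom_functor_cat natural_def op_cat_simps by blast
  have "app \<alpha> (Dom C f) (act F f y) = act G f (app \<alpha> (Cod C f) y)"
    if f: "f \<in> Arr C" and y: "y \<in> fobj F (Cod C f)" for f y
  proof -
    have "src (farr F f) = fobj F (Cod C f)" using psh_farr(1)[OF F f] by (metis mor.sel(1))
    moreover have "src (mp \<alpha> (Cod C f)) = fobj F (Cod C f)"
      using c[OF C.cod_obj[OF f]] by (simp add: hom_Set_cat)
    ultimately show ?thesis
      using arg_cong[OF n[OF f], of "\<lambda>m. mp m y"] y by (simp add: app_def act_def)
  qed
  then show "is_nat F G (app \<alpha>)"
    using c by (fastforce simp: is_nat_def hom_Set_cat app_def)
  have "mp \<alpha> c = Mor (fobj F c) (\<lambda>x \<in> fobj F c. app \<alpha> c x) (fobj G c)" if "c \<in> Obj C" for c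
    using c[OF that] by (intro mor_eqI) (auto simp: hom_Set_cat app_def fun_eq_iff PiE_def extensional_def)
  then show "\<alpha> = nat_mor F G (app \<alpha>)"
    using a by (intro mor_eqI)
      (auto simp: hom_functor_cat nat_mor_def fun_eq_iff extensional_def)
qed

lemma hom_Psh_eqI:
  assumes "\<alpha> \<in> hom Psh F G" "\<beta> \<in> hom Psh F G"
    "\<And>c x. c \<in> Obj C \<Longrightarrow> x \<in> fobj F c \<Longrightarrow> app \<alpha> c x = app \<beta> c x"
  shows "\<alpha> = \<beta>"
  using hom_Psh(4)[OF assms(1)] hom_Psh(4)[OF assms(2)] nat_mor_cong[of F "app \<alpha>" "app \<beta>" G] assms(3)
  by simp

lemma app_Comp:
  assumes "\<alpha> \<in> hom Psh F G" "c \<in> Obj C" "x \<in> fobj F c"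
  shows "app (Comp Psh \<beta> \<alpha>) c x = app \<beta> c (app \<alpha> c x)"
proof -
  have "mp \<alpha> c \<in> hom (Set_cat U) (fobj F c) (fobj G c)"
    using assms(1,2) by (auto simp: hom_functor_cat natural_def)
  then show ?thesis using assms by (simp add: functor_cat_simps app_def hom_Set_cat)
qed

lemma app_Ident: "c \<in> Obj C \<Longrightarrow> x \<in> fobj F c \<Longrightarrow> app (Ident Psh F) c x = x"
  by (simp add: functor_cat_simps app_def)

lemma app_in: "\<alpha> \<in> hom Psh F G \<Longrightarrow> c \<in> Obj C \<Longrightarrow> x \<in> fobj F c \<Longrightarrow> app \<alpha> c x \<in> fobj G c"
  using hom_Psh(3) unfolding is_nat_def by blast

lemma app_natural: "\<alpha> \<in> hom Psh F G \<Longrightarrow> f \<in> Arr C \<Longrightarrow> y \<in> fobj F (Cod C f) \<Longrightarrow>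
    app \<alpha> (Dom C f) (act F f y) = act G f (app \<alpha> (Cod C f) y)"
  using hom_Psh(3) unfolding is_nat_def by blast

section \<open>The category of elements as a discrete fibration\<close>

definition el_mor :: "'u psh \<Rightarrow> 'u \<Rightarrow> 'u \<Rightarrow> 'u" where
  "el_mor F f y = utriple (upair (Dom C f) (act F f y)) f (upair (Cod C f) y)"

lemma el_mor_simps [simp]: "usrc (el_mor F f y) = upair (Dom C f) (act F f y)"
  "uarr (el_mor F f y) = f" "utgt (el_mor F f y) = upair (Cod C f) y"
  "el_mor F f y = el_mor F g z \<longleftrightarrow> f = g \<and> y = z"
  by (auto simp: el_mor_def)

text \<open>The element at the source is forced to be the restriction of y along f, so f and y
  parametrise the arrows. This is also why lifts along the projection to C are unique.\<close>

lemma el_arr_iff: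
  assumes F: "F \<in> Obj Psh"
  shows "m \<in> el_arr C F \<longleftrightarrow> (\<exists>f y. f \<in> Arr C \<and> y \<in> fobj F (Cod C f) \<and> m = el_mor F f y)"
proof
  assume "m \<in> el_arr C F"
  then show "\<exists>f y. f \<in> Arr C \<and> y \<in> fobj F (Cod C f) \<and> m = el_mor F f y"
    unfolding el_arr_def el_mor_def act_def by (auto simp: hom_def)
next
  assume "\<exists>f y. f \<in> Arr C \<and> y \<in> fobj F (Cod C f) \<and> m = el_mor F f y"
  then show "m \<in> el_arr C F"
    using act_in[OF F] unfolding el_arr_def el_mor_def act_def by (fastforce simp: hom_def)
qed

lemma el_obj_iff [simp]: "upair c x \<in> el_obj C F \<longleftrightarrow> c \<in> Obj C \<and> x \<in> fobj F c"
  by (auto simp: el_obj_def)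

lemma el_objE:
  assumes "z \<in> el_obj C F"
  obtains c x where "c \<in> Obj C" "x \<in> fobj F c" "z = upair c x"
  using assms by (auto simp: el_obj_def)

lemma el_cat_simps:
  "Obj (el_cat C F) = el_obj C F" "Arr (el_cat C F) = el_arr C F"
  by (simp_all add: el_cat_def)

lemma el_mor_arr:
  assumes "F \<in> Obj Psh" "f \<in> Arr C" "y \<in> fobj F (Cod C f)"
  shows "el_mor F f y \<in> el_arr C F" "Dom (el_cat C F) (el_mor F f y) = upair (Dom C f) (act F f y)"
    "Cod (el_cat C F) (el_mor F f y) = upair (Cod C f) y"
proof -
  show *: "el_mor F f y \<in> el_arr C F" using assms el_arr_iff by blast
  show "Dom (el_cat C F) (el_mor F f y) = upair (Dom C f) (act F f y)"
    "Cod (el_cat C F) (el_mor F f y) = upair (Cod C f) y"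
    using * by (simp_all add: el_cat_def)
qed

lemma el_ident:
  assumes "F \<in> Obj Psh" "c \<in> Obj C" "x \<in> fobj F c"
  shows "Ident (el_cat C F) (upair c x) = el_mor F (Ident C c) x"
  using assms act_ident C.ident_arr by (simp add: el_cat_def el_mor_def)

lemma el_comp:
  assumes F: "F \<in> Obj Psh" and f: "f \<in> Arr C" "y \<in> fobj F (Cod C f)" and g: "g \<in> Arr C" "z \<in> fobj F (Cod C g)"
    and d: "Dom C g = Cod C f" "y = act F g z"
  shows "Comp (el_cat C F) (el_mor F g z) (el_mor F f y) = el_mor F (Comp C g f) z"
proof -
  have "Comp (el_cat C F) (el_mor F g z) (el_mor F f y) =
    utriple (upair (Dom C f) (act F f y)) (Comp C g f) (upair (Cod C g) z)"
    using el_mor_arr(1)[OF F f] el_mor_arr(1)[OF F g] d by (simp add: el_cat_def)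
  then show ?thesis using C.comp_arr[OF f(1) g(1)] act_comp[OF F f(1) g(1)] g d
    by (simp add: el_mor_def)
qed

lemma el_arrE:
  assumes "F \<in> Obj Psh" "m \<in> el_arr C F"
  obtains f y where "f \<in> Arr C" "y \<in> fobj F (Cod C f)" "m = el_mor F f y"
  using assms el_arr_iff by blast

lemma category_el_cat:
  assumes F: "F \<in> Obj Psh"
  shows "category (el_cat C F)"
proof
  note simps = el_cat_simps el_mor_arr[OF F]
  fix m assume m: "m \<in> Arr (el_cat C F)"
  then show "Dom (el_cat C F) m \<in> Obj (el_cat C F)" "Cod (el_cat C F) m \<in> Obj (el_cat C F)"
    using C.dom_obj C.cod_obj act_in[OF F]
    by (auto simp: simps elim!: el_arrE[OF F])
next
  fix z assume "z \<in> Obj (el_cat C F)"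
  then show "Ident (el_cat C F) z \<in> hom (el_cat C F) z z"
    using C.ident_arr act_ident[OF F] el_ident[OF F]
    by (auto simp: el_cat_simps el_mor_arr[OF F] hom_def elim!: el_objE)
next
  fix m a b n c assume "m \<in> hom (el_cat C F) a b" "n \<in> hom (el_cat C F) b c"
  then show "Comp (el_cat C F) n m \<in> hom (el_cat C F) a c"
    using C.comp_arr act_comp[OF F] el_comp[OF F]
    by (auto simp: el_cat_simps el_mor_arr[OF F] hom_def elim!: el_arrE[OF F])
next
  fix m a b assume m: "m \<in> hom (el_cat C F) a b"
  then obtain f y where f: "f \<in> Arr C" "y \<in> fobj F (Cod C f)" "m = el_mor F f y"
    by (auto simp: hom_def el_cat_simps elim: el_arrE[OF F])
  then have ab: "a = upair (Dom C f) (act F f y)" "b = upair (Cod C f) y"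
    using m by (auto simp: hom_def el_mor_arr[OF F])
  note id = C.ident_left[OF hom_arr[OF f(1)]] C.ident_right[OF hom_arr[OF f(1)]]
  show "Comp (el_cat C F) (Ident (el_cat C F) b) m = m"
    using f el_ident[OF F] el_comp[OF F, of f "act F (Ident C (Cod C f)) y" "Ident C (Cod C f)" y]
      C.ident_arr C.cod_obj act_ident[OF F] id unfolding ab by simp
  show "Comp (el_cat C F) m (Ident (el_cat C F) a) = m"
    using f el_ident[OF F] el_comp[OF F, of "Ident C (Dom C f)" "act F f y" f y]
      C.ident_arr C.dom_obj act_in[OF F] id unfolding ab by simp
next
  fix m a b n c p d assume "m \<in> hom (el_cat C F) a b" "n \<in> hom (el_cat C F) b c" "p \<in> hom (el_cat C F) c d"
  then obtain f y g z h w where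
    f: "f \<in> Arr C" "y \<in> fobj F (Cod C f)" "m = el_mor F f y" and
    g: "g \<in> Arr C" "z \<in> fobj F (Cod C g)" "n = el_mor F g z" "Dom C g = Cod C f" "y = act F g z" and
    h: "h \<in> Arr C" "w \<in> fobj F (Cod C h)" "p = el_mor F h w" "Dom C h = Cod C g" "z = act F h w"
    by (auto simp: el_cat_simps el_mor_arr[OF F] hom_def elim!: el_arrE[OF F])
  have "Comp C h (Comp C g f) = Comp C (Comp C h g) f"
    using C.assoc[of f "Dom C f" "Cod C f" g "Cod C g" h "Cod C h"] f g h by (auto simp: hom_def)
  then show "Comp (el_cat C F) p (Comp (el_cat C F) n m) = Comp (el_cat C F) (Comp (el_cat C F) p n) m"
    using el_comp[OF F f(1,2) g(1,2,4,5)] el_comp[OF F g(1,2) h(1,2,4,5)]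
      el_comp[OF F, of "Comp C g f" z h w] el_comp[OF F, of f y "Comp C h g" w]
      f g h C.comp_arr act_comp[OF F] by simp
qed

lemma int_obj_simps [simp]: "src (int_obj C F) = el_cat C F" "tgt (int_obj C F) = C"
  "z \<in> el_obj C F \<Longrightarrow> po (int_obj C F) z = ufst z"
  "m \<in> el_arr C F \<Longrightarrow> pa (int_obj C F) m = uarr m"
  by (simp_all add: int_obj_def)

lemma over_int:
  assumes F: "F \<in> Obj Psh"
  shows "over (int_obj C F)"
proof -
  interpret E: category "el_cat C F" by (rule category_el_cat[OF F])
  have "{upair c x | c x. c \<in> Obj C \<and> x \<in> (\<Union>c\<in>Obj C. fobj F c)} \<in> U"
    using small psh_U[OF F] by (intro U_pairs U_UN) (auto simp: small_category_def)
  then have 1: "el_obj C F \<in> U" by (rule U_subset) (auto simp: el_obj_def)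
  \<comment> \<open>Triples are rebracketed as pairs with a coded pair, so that
    \<open>U_pairs\<close> can be applied twice.\<close>
  have "{utriple s f t | s f t. s \<in> el_obj C F \<and> f \<in> Arr C \<and> t \<in> el_obj C F} =
    {utriple s (ufst p) (usnd p) | s p. s \<in> el_obj C F \<and> p \<in> {upair f t | f t. f \<in> Arr C \<and> t \<in> el_obj C F}}"
    by (auto; metis upair_sel)
  also have "\<dots> \<in> U" using small 1 by (intro U_pairs) (auto simp: small_category_def)
  finally have 2: "el_arr C F \<in> U"
    by (rule U_subset) (auto simp: el_arr_def hom_def intro: C.dom_obj C.cod_obj)
  have 3: "ext_cat (el_cat C F)"
    by (auto simp: ext_cat_def el_cat_def restrict_extensional)
  have "is_functor (el_cat C F) C (mp (int_obj C F))"
  proof (intro is_functor.intro is_functor_axioms.intro E.category_axioms C.category_axioms)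
    fix z assume "z \<in> Obj (el_cat C F)"
    then show "po (int_obj C F) z \<in> Obj C" by (auto simp: el_cat_simps elim!: el_objE)
  next
    fix m a b assume "m \<in> hom (el_cat C F) a b"
    then show "pa (int_obj C F) m \<in> hom C (po (int_obj C F) a) (po (int_obj C F) b)"
      using act_in[OF F] C.dom_obj C.cod_obj
      by (auto simp: el_cat_simps el_mor_arr[OF F] hom_def elim!: el_arrE[OF F])
  next
    fix z assume "z \<in> Obj (el_cat C F)"
    then show "pa (int_obj C F) (Ident (el_cat C F) z) = Ident C (po (int_obj C F) z)"
      using C.ident_arr by (auto simp: el_cat_simps el_mor_arr[OF F] el_ident[OF F] elim!: el_objE)
  next
    fix m a b n c assume "m \<in> hom (el_cat C F) a b" "n \<in> hom (el_cat C F) b c"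
    then show "pa (int_obj C F) (Comp (el_cat C F) n m) = Comp C (pa (int_obj C F) n) (pa (int_obj C F) m)"
      using C.comp_arr by (auto simp: el_cat_simps el_mor_arr[OF F] el_comp[OF F] hom_def elim!: el_arrE[OF F])
  qed
  then show ?thesis
    using 1 2 3 E.category_axioms
    by (auto simp: over_def small_category_def el_cat_simps ext_functor_def int_obj_def)
qed

lemma disc_int:
  assumes F: "F \<in> Obj Psh"
  shows "disc (int_obj C F)"
  unfolding discrete_fibration_def
proof (intro conjI ballI impI)
  show "is_functor (src (int_obj C F)) C (mp (int_obj C F))" using overD over_int F by blast
  fix z f assume z: "z \<in> ob (int_obj C F)" and f: "f \<in> Arr C" "Cod C f = po (int_obj C F) z"
  obtain c x where c: "c \<in> Obj C" "x \<in> fobj F c" "z = upair c x" using z by (auto simp: el_cat_simps elim: el_objE)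
  then have cf: "Cod C f = c" using f by simp
  then show "\<exists>!g. g \<in> ar (int_obj C F) \<and> Cod (src (int_obj C F)) g = z \<and> pa (int_obj C F) g = f"
    by (intro ex1I[of _ "el_mor F f x"])
      (use c f in \<open>auto simp: el_cat_simps el_mor_arr[OF F] elim!: el_arrE[OF F]\<close>)
qed

section \<open>Arrows into a category of elements as sections\<close>

definition is_section :: "'u over \<Rightarrow> 'u psh \<Rightarrow> ('u \<Rightarrow> 'u) \<Rightarrow> bool" where
  "is_section x F s \<longleftrightarrow> (\<forall>a \<in> ob x. s a \<in> fobj F (po x a)) \<and>
    (\<forall>g \<in> ar x. s (Dom (src x) g) = act F (pa x g) (s (Cod (src x) g)))"

definition sect_fun :: "'u over \<Rightarrow> 'u psh \<Rightarrow> ('u \<Rightarrow> 'u) \<Rightarrow> 'u sfun" where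
  "sect_fun x F s = \<lparr>fobj = (\<lambda>a \<in> ob x. upair (po x a) (s a)),
    farr = (\<lambda>g \<in> ar x. utriple (upair (po x (Dom (src x) g)) (s (Dom (src x) g))) (pa x g)
      (upair (po x (Cod (src x) g)) (s (Cod (src x) g))))\<rparr>"

definition sect :: "'u over \<Rightarrow> 'u psh \<Rightarrow> ('u \<Rightarrow> 'u) \<Rightarrow> ('u over, 'u over) mor" where
  "sect x F s = over_arr x (int_obj C F) (sect_fun x F s)"

lemma sect_fun_obj [simp]: "a \<in> ob x \<Longrightarrow> fobj (sect_fun x F s) a = upair (po x a) (s a)"
  by (simp add: sect_fun_def)

lemma sect_fun_arr:
  assumes "over x" "is_section x F s" "g \<in> ar x"
  shows "farr (sect_fun x F s) g = el_mor F (pa x g) (s (Cod (src x) g))"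
  using assms over_map[OF assms(1)] by (simp add: sect_fun_def el_mor_def is_section_def)

lemma sect_fun_over:
  assumes x: "over x" and F: "F \<in> Obj Psh" and s: "is_section x F s"
  shows "over_fun x (int_obj C F) (sect_fun x F s)"
proof (rule over_funI[OF x over_int[OF F]])
  note om = over_map[OF x]
  interpret X: category "src x" using overD[OF x] by blast
  show "ext_functor (src x) (sect_fun x F s)" by (simp add: ext_functor_def sect_fun_def)
  fix a assume a: "a \<in> ob x"
  then show "fobj (sect_fun x F s) a \<in> ob (int_obj C F) \<and> po (int_obj C F) (fobj (sect_fun x F s) a) = po x a"
    using s om by (simp add: el_cat_simps is_section_def)
  show "farr (sect_fun x F s) (Ident (src x) a) = Ident (src (int_obj C F)) (fobj (sect_fun x F s) a)"
    using a s X.ident_arr om over_arr_ident[OF x a]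
    by (simp add: sect_fun_arr[OF x s] el_ident[OF F] is_section_def)
next
  note om = over_map[OF x]
  fix g assume g: "g \<in> ar x"
  then have "el_mor F (pa x g) (s (Cod (src x) g)) \<in> el_arr C F"
    using om s el_mor_arr(1)[OF F] by (simp add: is_section_def)
  then show "farr (sect_fun x F s) g \<in> ar (int_obj C F) \<and> pa (int_obj C F) (farr (sect_fun x F s) g) = pa x g \<and>
    Dom (src (int_obj C F)) (farr (sect_fun x F s) g) = fobj (sect_fun x F s) (Dom (src x) g) \<and>
    Cod (src (int_obj C F)) (farr (sect_fun x F s) g) = fobj (sect_fun x F s) (Cod (src x) g)"
    using g om s el_mor_arr[OF F] by (simp add: sect_fun_arr[OF x s] el_cat_simps is_section_def)
next
  note om = over_map[OF x]
  interpret X: category "src x" using overD[OF x] by blast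
  fix f g assume f: "f \<in> ar x" and g: "g \<in> ar x" and d: "Dom (src x) g = Cod (src x) f"
  note gf = X.comp_arr[OF f g d]
  have "s (Cod (src x) f) \<in> fobj F (Cod C (pa x f))" "s (Cod (src x) g) \<in> fobj F (Cod C (pa x g))"
    using f g om s unfolding is_section_def by simp_all
  moreover have "s (Cod (src x) f) = act F (pa x g) (s (Cod (src x) g))"
    using g d s unfolding is_section_def by (simp flip: d)
  moreover have "Dom C (pa x g) = Cod C (pa x f)" using f g d om by simp
  ultimately show "farr (sect_fun x F s) (Comp (src x) g f) =
    Comp (src (int_obj C F)) (farr (sect_fun x F s) g) (farr (sect_fun x F s) f)"
    using f g gf om el_comp[OF F] over_arr_comp[OF x f g d] by (simp add: sect_fun_arr[OF x s])
qed

lemma sect_hom: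
  assumes "over x" "F \<in> Obj Psh" "is_section x F s"
  shows "sect x F s \<in> hom K x (int_obj C F)"
  unfolding sect_def by (intro hom_KI sect_fun_over over_int assms)

lemma sect_eq_iff: "sect x F s = sect x F s' \<longleftrightarrow> (\<forall>a \<in> ob x. s a = s' a)" if x: "over x"
proof
  assume "sect x F s = sect x F s'"
  then have "\<And>a. fobj (sect_fun x F s) a = fobj (sect_fun x F s') a" by (simp add: sect_def)
  then show "\<forall>a \<in> ob x. s a = s' a" by (metis sect_fun_obj upair_inject)
next
  assume "\<forall>a \<in> ob x. s a = s' a"
  then show "sect x F s = sect x F s'"
    using over_map[OF x] by (auto simp: sect_def sect_fun_def fun_eq_iff)
qed

text \<open>The section is the second coordinate of the object part. It determines the whole functor
  since the target is a discrete fibration, and its compatibility with restriction is read off the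
  form \<open>el_mor F f y\<close> of the image arrows.\<close>

lemma over_arr_sect:
  assumes x: "over x" and F: "F \<in> Obj Psh" and H: "over_fun x (int_obj C F) H"
  shows "is_section x F (\<lambda>a. usnd (fobj H a))" "over_arr x (int_obj C F) H = sect x F (\<lambda>a. usnd (fobj H a))"
proof -
  let ?s = "\<lambda>a. usnd (fobj H a)"
  note om = over_map[OF x] and HD = over_funD[OF H]
  have o: "fobj H a = upair (po x a) (?s a) \<and> ?s a \<in> fobj F (po x a)" if "a \<in> ob x" for a
    using HD(1,5)[OF that] by (auto simp: el_cat_simps elim!: el_objE)
  show s: "is_section x F ?s"
    unfolding is_section_def
  proof (intro conjI ballI)
    fix g assume g: "g \<in> ar x"
    obtain f y where f: "f \<in> Arr C" "y \<in> fobj F (Cod C f)" "farr H g = el_mor F f y"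
      using HD(2)[OF g] by (auto simp: el_cat_simps elim: el_arrE[OF F])
    show "?s (Dom (src x) g) = act F (pa x g) (?s (Cod (src x) g))"
      using HD(3,4,6)[OF g] f el_mor_arr[OF F f(1,2)] by (simp flip: HD(3,4)[OF g])
  qed (use o in blast)
  have "H = sect_fun x F ?s"
    by (rule disc_fun_eq[OF disc_int[OF F] over_int[OF F] x H sect_fun_over[OF x F s]]) (use o in simp)
  then show "over_arr x (int_obj C F) H = sect x F ?s" by (simp add: sect_def)
qed

lemma sectE:
  assumes "h \<in> hom K x (int_obj C F)" "F \<in> Obj Psh"
  obtains s where "is_section x F s" "h = sect x F s"
  using hom_KE[OF assms(1)] over_arr_sect[OF _ assms(2)] by metis

lemma sect_comp:
  assumes x: "over x" and y: "over y" and H: "over_fun x y H" and F: "F \<in> Obj Psh" and s: "is_section y F s"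
  shows "Comp K (sect y F s) (over_arr x y H) = sect x F (\<lambda>a. s (fobj H a))"
proof -
  have c: "Comp K (sect y F s) (over_arr x y H) =
      over_arr x (int_obj C F) (fun_comp (src x) (sect_fun y F s) H)"
    unfolding sect_def Comp_K ..
  have "Comp K (sect y F s) (over_arr x y H) \<in> hom K x (int_obj C F)"
    by (rule K.comp_hom[OF hom_KI[OF x y H] sect_hom[OF y F s]])
  then have "over_fun x (int_obj C F) (fun_comp (src x) (sect_fun y F s) H)"
    unfolding c by (auto simp: hom_K)
  from over_arr_sect(2)[OF x F this] show ?thesis
    unfolding c using over_funD(1)[OF H] by (simp add: sect_eq_iff[OF x])
qed

abbreviation int_section :: "'u pshmor \<Rightarrow> 'u \<Rightarrow> 'u" where
  "int_section \<alpha> z \<equiv> app \<alpha> (ufst z) (usnd z)"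

lemma int_section:
  assumes a: "\<alpha> \<in> hom Psh F G"
  shows "is_section (int_obj C F) G (int_section \<alpha>)"
  using app_in[OF a] app_natural[OF a] act_in[OF hom_Psh(1)[OF a]]
  by (auto simp: is_section_def el_cat_simps el_mor_arr[OF hom_Psh(1)[OF a]]
      elim!: el_objE el_arrE[OF hom_Psh(1)[OF a]])

text \<open>With \<alpha> turned into a section over the category of elements of F, functoriality
  and full faithfulness become statements about values on single elements.\<close>

lemma int_arr_sect:
  assumes a: "\<alpha> \<in> hom Psh F G"
  shows "int_arr C \<alpha> = sect (int_obj C F) G (int_section \<alpha>)"
proof -
  note F = hom_Psh(1)[OF a]
  have st: "src \<alpha> = F" "tgt \<alpha> = G" using a by (auto simp: hom_functor_cat)
  show ?thesis
    unfolding int_arr_def Let_def st sect_def over_arr_def sect_fun_def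
    using act_in[OF F] C.dom_obj C.cod_obj
    by (auto simp: el_cat_simps app_def fun_eq_iff el_mor_arr[OF F] elim!: el_arrE[OF F])
qed

lemma int_arr_hom: "\<alpha> \<in> hom Psh F G \<Longrightarrow> int_arr C \<alpha> \<in> hom K (int_obj C F) (int_obj C G)"
  by (simp add: int_arr_sect sect_hom over_int hom_Psh(1,2) int_section)

lemma int_arr_comp_sect:
  assumes x: "over x" and a: "\<alpha> \<in> hom Psh F G" and s: "is_section x F s"
  shows "Comp K (int_arr C \<alpha>) (sect x F s) = sect x G (\<lambda>a. app \<alpha> (po x a) (s a))"
  unfolding int_arr_sect[OF a] unfolding sect_def[of x F s]
    sect_comp[OF x over_int[OF hom_Psh(1)[OF a]] sect_fun_over[OF x hom_Psh(1)[OF a] s]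
      hom_Psh(2)[OF a] int_section[OF a]]
  by (simp add: sect_eq_iff[OF x])

lemma is_functor_int: "is_functor Psh K (int_functor C)"
proof (intro is_functor.intro is_functor_axioms.intro Psh.category_axioms K.category_axioms)
  fix F assume "F \<in> Obj Psh"
  then show "fobj (int_functor C) F \<in> Obj K" unfolding Obj_K by (simp add: int_functor_def over_int)
next
  fix \<alpha> F G assume "\<alpha> \<in> hom Psh F G"
  then show "farr (int_functor C) \<alpha> \<in> hom K (fobj (int_functor C) F) (fobj (int_functor C) G)"
    by (simp only: int_functor_def fctr.simps int_arr_hom)
next
  fix F assume F: "F \<in> Obj Psh"
  note o = over_int[OF F]
  have "over_fun (int_obj C F) (int_obj C F) (fun_id (el_cat C F))"
    using K.ident_hom[of "int_obj C F"] o unfolding Obj_K Ident_K by (auto simp: hom_K)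
  from over_arr_sect(2)[OF o F this]
  have id: "Ident K (int_obj C F) = sect (int_obj C F) F (\<lambda>a. usnd (fobj (fun_id (el_cat C F)) a))"
    unfolding Ident_K by simp
  show "farr (int_functor C) (Ident Psh F) = Ident K (fobj (int_functor C) F)"
    unfolding int_functor_def fctr.simps id int_arr_sect[OF Psh.ident_hom[OF F]] sect_eq_iff[OF o]
    using app_Ident by (auto simp: el_cat_simps elim!: el_objE)
next
  fix \<alpha> F G \<beta> H assume a: "\<alpha> \<in> hom Psh F G" and b: "\<beta> \<in> hom Psh G H"
  note F = hom_Psh(1)[OF a]
  show "farr (int_functor C) (Comp Psh \<beta> \<alpha>) = Comp K (farr (int_functor C) \<beta>) (farr (int_functor C) \<alpha>)"
    unfolding int_functor_def fctr.simps int_arr_sect[OF a] int_arr_comp_sect[OF over_int[OF F] b int_section[OF a]]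
      int_arr_sect[OF Psh.comp_hom[OF a b]] sect_eq_iff[OF over_int[OF F]]
    using app_Comp[OF a] by (auto simp: el_cat_simps elim!: el_objE)
qed

text \<open>A section over the category of elements of F with values in G is a family of maps from F
  c to G c, and its compatibility along \<open>el_mor F f y\<close> is the naturality square of f
  evaluated at y.\<close>

lemma int_fully_faithful:
  assumes F: "F \<in> Obj Psh" and G: "G \<in> Obj Psh"
  shows "bij_betw (int_arr C) (hom Psh F G) (hom K (int_obj C F) (int_obj C G))"
  unfolding bij_betw_def
proof
  note o = over_int[OF F]
  show "inj_on (int_arr C) (hom Psh F G)"
  proof (rule inj_onI)
    fix \<alpha> \<beta> assume a: "\<alpha> \<in> hom Psh F G" and b: "\<beta> \<in> hom Psh F G" and "int_arr C \<alpha> = int_arr C \<beta>"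
    then have "\<forall>z\<in>el_obj C F. int_section \<alpha> z = int_section \<beta> z"
      by (simp add: int_arr_sect sect_eq_iff[OF o] el_cat_simps)
    then have "app \<alpha> c x = app \<beta> c x" if "c \<in> Obj C" "x \<in> fobj F c" for c x
      using that by (auto dest!: bspec[of _ _ "upair c x"])
    then show "\<alpha> = \<beta>" using hom_Psh_eqI a b by blast
  qed
  show "int_arr C ` hom Psh F G = hom K (int_obj C F) (int_obj C G)"
  proof
    show "int_arr C ` hom Psh F G \<subseteq> hom K (int_obj C F) (int_obj C G)" using int_arr_hom by blast
    show "hom K (int_obj C F) (int_obj C G) \<subseteq> int_arr C ` hom Psh F G"
    proof
      fix h assume "h \<in> hom K (int_obj C F) (int_obj C G)"
      then obtain s where s: "is_section (int_obj C F) G s" "h = sect (int_obj C F) G s"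
        using sectE G by blast
      let ?t = "\<lambda>c x. s (upair c x)"
      have "is_nat F G ?t"
        unfolding is_nat_def
      proof (intro conjI ballI)
        fix c x assume "c \<in> Obj C" "x \<in> fobj F c" then show "?t c x \<in> fobj G c"
          using s(1) unfolding is_section_def by (auto simp: el_cat_simps dest!: bspec[of _ _ "upair c x"])
      next
        fix f y assume f: "f \<in> Arr C" "y \<in> fobj F (Cod C f)"
        then show "?t (Dom C f) (act F f y) = act G f (?t (Cod C f) y)"
          using s(1) el_mor_arr[OF F f] unfolding is_section_def
          by (auto simp: el_cat_simps dest!: bspec[of _ _ "el_mor F f y"])
      qed
      then have m: "nat_mor F G ?t \<in> hom Psh F G" using nat_mor_hom F G by blast
      have "int_arr C (nat_mor F G ?t) = h"
        unfolding int_arr_sect[OF m] s(2) sect_eq_iff[OF o] by (auto simp: el_cat_simps elim!: el_objE)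
      then show "h \<in> int_arr C ` hom Psh F G" using m by blast
    qed
  qed
qed

section \<open>Every discrete fibration is isomorphic to a category of elements\<close>

definition fib_lift :: "'u over \<Rightarrow> 'u \<Rightarrow> 'u \<Rightarrow> 'u" where
  "fib_lift z f q = (THE g. g \<in> ar z \<and> Cod (src z) g = q \<and> pa z g = f)"

definition fibre_psh :: "'u over \<Rightarrow> 'u psh" where
  "fibre_psh z = mk_psh (\<lambda>c. {q \<in> ob z. po z q = c}) (\<lambda>f q. Dom (src z) (fib_lift z f q))"

lemma fib_lift:
  assumes "disc z" "q \<in> ob z" "f \<in> Arr C" "Cod C f = po z q"
  shows "fib_lift z f q \<in> ar z" "Cod (src z) (fib_lift z f q) = q" "pa z (fib_lift z f q) = f"
  using theI'[OF disc_lift[OF assms]] unfolding fib_lift_def by auto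

lemma fib_lift_eqI:
  assumes z: "disc z" "over z" and "g \<in> ar z"
  shows "fib_lift z (pa z g) (Cod (src z) g) = g"
  using disc_arr_eq[OF z fib_lift(1)[OF z(1)], of "Cod (src z) g" "pa z g" g]
    fib_lift(2,3)[OF z(1), of "Cod (src z) g" "pa z g"] over_map[OF z(2)] assms by simp

text \<open>Functoriality is uniqueness of lifts: an identity lifts an identity, and a composite of
  lifts lifts the composite.\<close>

lemma fibre_psh:
  assumes z: "disc z" "over z"
  shows "fibre_psh z \<in> Obj Psh"
  unfolding fibre_psh_def
proof (rule mk_psh)
  interpret Z: category "src z" using overD z by blast
  note om = over_map[OF z(2)]
  show "{q \<in> ob z. po z q = c} \<in> U" for c using overD(4)[OF z(2)] by (rule U_subset) auto
  show "Dom (src z) (fib_lift z f q) \<in> {q \<in> ob z. po z q = Dom C f}"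
    if "f \<in> Arr C" "q \<in> {q \<in> ob z. po z q = Cod C f}" for f q
    using fib_lift[OF z(1), of q f] that om(3,5)[of "fib_lift z f q"] by auto
  show "Dom (src z) (fib_lift z (Ident C c) q) = q" if "q \<in> {q \<in> ob z. po z q = c}" for c q
    using fib_lift_eqI[OF z, of "Ident (src z) q"] Z.ident_arr over_arr_ident[OF z(2)] that by auto
  fix f g q assume f: "f \<in> Arr C" and g: "g \<in> Arr C" and d: "Dom C g = Cod C f"
    and q: "q \<in> {q \<in> ob z. po z q = Cod C g}"
  let ?g = "fib_lift z g q" let ?f = "fib_lift z f (Dom (src z) ?g)"
  have g': "?g \<in> ar z" "Cod (src z) ?g = q" "pa z ?g = g" using fib_lift[OF z(1), of q g] q g by auto
  then have "Dom (src z) ?g \<in> ob z" "Cod C f = po z (Dom (src z) ?g)" 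
    using om(3)[OF g'(1)] om(5)[OF g'(1)] d by auto
  then have f': "?f \<in> ar z" "Cod (src z) ?f = Dom (src z) ?g" "pa z ?f = f"
    using fib_lift[OF z(1) _ f] by auto
  have "Comp (src z) ?g ?f \<in> ar z" "Cod (src z) (Comp (src z) ?g ?f) = q"
    "Dom (src z) (Comp (src z) ?g ?f) = Dom (src z) ?f"
    "pa z (Comp (src z) ?g ?f) = Comp C g f"
    using Z.comp_arr[OF f'(1) g'(1)] over_arr_comp[OF z(2) f'(1) g'(1)] f' g' by auto
  then show "Dom (src z) (fib_lift z (Comp C g f) q) = Dom (src z) ?f"
    using fib_lift_eqI[OF z, of "Comp (src z) ?g ?f"] by simp
qed

text \<open>Each object of z is an element of the fibre that contains it, so the identity function
  is a section with values in \<open>fibre_psh z\<close>. The resulting functor is bijective on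
  arrows with inverse given by \<open>fib_lift\<close>.\<close>

lemma disc_ess_image:
  assumes z: "disc z" "over z"
  shows "\<exists>F\<in>Obj Psh. \<exists>h\<in>hom K z (int_obj C F). is_iso K h"
proof -
  let ?F = "fibre_psh z"
  note om = over_map[OF z(2)]
  note F = fibre_psh[OF z]
  have Fo: "fobj ?F c = {q \<in> ob z. po z q = c}" if "c \<in> Obj C" for c
    using that by (simp add: fibre_psh_def)
  have s: "is_section z ?F (\<lambda>a. a)"
    unfolding is_section_def using om fib_lift_eqI[OF z] by (auto simp: Fo fibre_psh_def)
  note S = sect_fun_over[OF z(2) F s] and Sa = sect_fun_arr[OF z(2) s]
  have "is_iso K (sect z ?F (\<lambda>a. a))"
    unfolding sect_def
  proof (rule over_arr_isoI[OF z(2) over_int[OF F] S])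
    show "bij_betw (fobj (sect_fun z ?F (\<lambda>a. a))) (ob z) (ob (int_obj C ?F))"
      unfolding bij_betw_iff_ex1 using om by (auto simp: el_cat_simps Fo elim!: el_objE)
    show "bij_betw (farr (sect_fun z ?F (\<lambda>a. a))) (ar z) (ar (int_obj C ?F))"
      unfolding bij_betw_iff_ex1
    proof (intro conjI ballI)
      show "farr (sect_fun z ?F (\<lambda>a. a)) \<in> ar z \<rightarrow> ar (int_obj C ?F)" using over_funD(2)[OF S] by blast
      fix m assume "m \<in> ar (int_obj C ?F)"
      then obtain f q where f: "f \<in> Arr C" "q \<in> fobj ?F (Cod C f)" "m = el_mor ?F f q"
        by (auto simp: el_cat_simps elim: el_arrE[OF F])
      then have q: "q \<in> ob z" "Cod C f = po z q" using Fo C.cod_obj by auto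
      note l = fib_lift[OF z(1) q(1) f(1) q(2)]
      show "\<exists>!a. a \<in> ar z \<and> farr (sect_fun z ?F (\<lambda>a. a)) a = m"
        by (rule ex1I[of _ "fib_lift z f q"]) (use l Sa f fib_lift_eqI[OF z] in auto)
    qed
  qed
  then show ?thesis using sect_hom[OF z(2) F s] F by blast
qed

lemma D_iff: "z \<in> D \<longleftrightarrow> (\<exists>F\<in>Obj Psh. \<exists>h\<in>hom K z (fobj (int_functor C) F). is_iso K h)"
  using disc_ess_image disc_iso disc_int K.hom_obj(1) Obj_K by (auto simp: int_functor_def; blast)

end

section \<open>Connected components of comma categories\<close>

lemma equiv_connected_rel:
  assumes "\<And>f. f \<in> Arr K \<Longrightarrow> Dom K f \<in> Obj K \<and> Cod K f \<in> Obj K"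
  shows "equiv (Obj K) (connected_rel K)"
proof (rule equivI)
  let ?r = "{(Dom K f, Cod K f) | f. f \<in> Arr K} \<union> {(Cod K f, Dom K f) | f. f \<in> Arr K}"
  show "connected_rel K \<subseteq> Obj K \<times> Obj K" "refl_on (Obj K) (connected_rel K)"
    by (auto simp: connected_rel_def refl_on_def)
  have "sym (?r\<^sup>*)" by (rule sym_rtrancl) (auto simp: sym_def)
  then show "sym (connected_rel K)" by (auto simp: connected_rel_def sym_def)
  show "trans (connected_rel K)" by (auto simp: connected_rel_def trans_def)
qed

lemma connected_rel_arr:
  assumes "f \<in> Arr K" "Dom K f \<in> Obj K" "Cod K f \<in> Obj K"
  shows "(Dom K f, Cod K f) \<in> connected_rel K"
  using assms by (auto simp: connected_rel_def)

lemma connected_rel_invariant: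
  assumes "(x, y) \<in> connected_rel K" "\<And>f. f \<in> Arr K \<Longrightarrow> \<phi> (Dom K f) = \<phi> (Cod K f)"
  shows "\<phi> x = \<phi> y"
proof -
  have "(x, y) \<in> ({(Dom K f, Cod K f) | f. f \<in> Arr K} \<union> {(Cod K f, Dom K f) | f. f \<in> Arr K})\<^sup>*"
    using assms(1) by (simp add: connected_rel_def)
  then show ?thesis by (induction rule: rtrancl_induct) (use assms(2) in fastforce)+
qed

text \<open>The class map followed by the coding. Once \<open>coded_component\<close> is available,
  elements of \<open>T_set\<close> are handled as values of this map, which hides
  \<open>code0\<close> and its inverse.\<close>

definition component :: "'u over \<Rightarrow> 'u \<Rightarrow> 'u \<times> 'u \<Rightarrow> 'u" where
  "component p c x = code0 (connected_rel (comma p c) `` {x})"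

lemma T_set_component: "T_set p c = component p c ` Obj (comma p c)"
  by (auto simp: T_set_def pi0_def quotient_def component_def)

context small_base
begin

text \<open>An arrow of the comma category is given by g and the pair at its source; the pair at its
  target is then forced.\<close>

lemma comma_simps:
  assumes "over p"
  shows "Obj (comma p c) = {(a, f). a \<in> ob p \<and> f \<in> hom C c (po p a)}"
    "Dom (comma p c) = src" "Cod (comma p c) = tgt"
    "m \<in> Arr (comma p c) \<longleftrightarrow> (\<exists>g f. g \<in> ar p \<and> f \<in> hom C c (po p (Dom (src p) g)) \<and>
      m = Mor (Dom (src p) g, f) g (Cod (src p) g, Comp C (pa p g) f))"
proof -
  note t = overD(3)[OF assms] and om = over_map[OF assms]
  show o: "Obj (comma p c) = {(a, f). a \<in> ob p \<and> f \<in> hom C c (po p a)}"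
    "Dom (comma p c) = src" "Cod (comma p c) = tgt"
    by (simp_all add: comma_def Let_def t)
  have "Comp C (pa p g) f \<in> hom C c (po p (Cod (src p) g))"
    if "g \<in> ar p" "f \<in> hom C c (po p (Dom (src p) g))" for g f
    using C.comp_hom[OF that(2)] om that(1) by (auto simp: hom_def)
  then show "m \<in> Arr (comma p c) \<longleftrightarrow> (\<exists>g f. g \<in> ar p \<and> f \<in> hom C c (po p (Dom (src p) g)) \<and>
      m = Mor (Dom (src p) g, f) g (Cod (src p) g, Comp C (pa p g) f))"
    unfolding comma_def Let_def t using om by (auto simp: hom_def)
qed

lemma comma_obj: "over p \<Longrightarrow> (a, f) \<in> Obj (comma p c) \<longleftrightarrow> a \<in> ob p \<and> f \<in> hom C c (po p a)"
  by (simp add: comma_simps(1))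

lemma comma_arr:
  assumes p: "over p" and m: "m \<in> Arr (comma p c)"
  shows "src m \<in> Obj (comma p c)" "tgt m \<in> Obj (comma p c)"
proof -
  obtain g f where g: "g \<in> ar p" "f \<in> hom C c (po p (Dom (src p) g))"
    "m = Mor (Dom (src p) g, f) g (Cod (src p) g, Comp C (pa p g) f)"
    using m unfolding comma_simps(4)[OF p] by blast
  have "Comp C (pa p g) f \<in> hom C c (po p (Cod (src p) g))"
    using C.comp_hom[OF g(2)] over_map[OF p] g(1) by (auto simp: hom_def)
  then show "src m \<in> Obj (comma p c)" "tgt m \<in> Obj (comma p c)"
    using g over_map[OF p] by (auto simp: comma_obj[OF p])
qed

lemma equiv_comma: "over p \<Longrightarrow> equiv (Obj (comma p c)) (connected_rel (comma p c))"
  using equiv_connected_rel[of "comma p c"] comma_arr comma_simps(2,3) by metis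

lemma code0_class:
  assumes p: "over p" and x: "x \<in> Obj (comma p c)"
  obtains a f where "(a, f) \<in> connected_rel (comma p c) `` {x}" "component p c x = upair a f"
proof -
  let ?X = "connected_rel (comma p c) `` {x}"
  have "x \<in> ?X" using equiv_class_self[OF equiv_comma[OF p] x] .
  then have "(SOME y. y \<in> ?X) \<in> ?X" by (rule someI)
  then show ?thesis
    using that by (cases "SOME y. y \<in> ?X") (auto simp: component_def code0_def)
qed

text \<open>The code of a class encodes one of its elements, so equal codes give two classes a
  common element, and classes that meet are equal.\<close>

lemma component_eq_iff:
  assumes p: "over p" and x: "x \<in> Obj (comma p c)" and y: "y \<in> Obj (comma p c)"
  shows "component p c x = component p c y \<longleftrightarrow> (x, y) \<in> connected_rel (comma p c)"
proof
  assume eq: "component p c x = component p c y"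
  obtain a f where "(a, f) \<in> connected_rel (comma p c) `` {x}" "component p c x = upair a f"
    using code0_class[OF p x] .
  moreover obtain b g where "(b, g) \<in> connected_rel (comma p c) `` {y}" "component p c y = upair b g"
    using code0_class[OF p y] .
  ultimately have "(a, f) \<in> connected_rel (comma p c) `` {x} \<inter> connected_rel (comma p c) `` {y}"
    using eq by simp
  then show "(x, y) \<in> connected_rel (comma p c)"
    using equiv_class_nondisjoint[OF equiv_comma[OF p]] by blast
next
  assume "(x, y) \<in> connected_rel (comma p c)"
  then show "component p c x = component p c y"
    using equiv_class_eq[OF equiv_comma[OF p]] by (simp add: component_def)
qed

lemma component_arr:
  assumes p: "over p" and g: "g \<in> ar p" and f: "f \<in> hom C c (po p (Dom (src p) g))"
  shows "component p c (Dom (src p) g, f) = component p c (Cod (src p) g, Comp C (pa p g) f)"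
proof -
  let ?m = "Mor (Dom (src p) g, f) g (Cod (src p) g, Comp C (pa p g) f)"
  have m: "?m \<in> Arr (comma p c)" using comma_simps(4)[OF p] g f by blast
  show ?thesis
    using connected_rel_arr[OF m] comma_arr[OF p m] component_eq_iff[OF p]
    by (simp add: comma_simps[OF p])
qed

lemma component_invariant:
  assumes p: "over p" and x: "x \<in> Obj (comma p c)" and y: "y \<in> Obj (comma p c)"
    and eq: "component p c x = component p c y"
    and inv: "\<And>g f. g \<in> ar p \<Longrightarrow> f \<in> hom C c (po p (Dom (src p) g)) \<Longrightarrow>
      \<phi> (Dom (src p) g, f) = \<phi> (Cod (src p) g, Comp C (pa p g) f)"
  shows "\<phi> x = \<phi> y"
proof (rule connected_rel_invariant[where \<phi> = \<phi>])
  show "(x, y) \<in> connected_rel (comma p c)" using component_eq_iff[OF p x y] eq by simp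
  fix m assume "m \<in> Arr (comma p c)"
  then show "\<phi> (Dom (comma p c) m) = \<phi> (Cod (comma p c) m)"
    using inv unfolding comma_simps(4)[OF p] by (auto simp: comma_simps[OF p])
qed

text \<open>Because a class is coded by one of its own elements, the codes lie among the codes of
  pairs of an object of p and an arrow of C, which form a small set.\<close>

lemma T_set_U:
  assumes p: "over p"
  shows "T_set p c \<in> U"
proof -
  have "{upair a f | a f. a \<in> ob p \<and> f \<in> Arr C} \<in> U"
    using overD(4)[OF p] small by (intro U_pairs) (auto simp: small_category_def)
  moreover have "T_set p c \<subseteq> {upair a f | a f. a \<in> ob p \<and> f \<in> Arr C}"
  proof
    fix z assume "z \<in> T_set p c"
    then obtain x where x: "x \<in> Obj (comma p c)" "z = component p c x" by (auto simp: T_set_component)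
    obtain a f where "(a, f) \<in> connected_rel (comma p c) `` {x}" "z = upair a f"
      using code0_class[OF p x(1)] x(2) by metis
    moreover from this have "(a, f) \<in> Obj (comma p c)" by (auto simp: connected_rel_def)
    ultimately show "z \<in> {upair a f | a f. a \<in> ob p \<and> f \<in> Arr C}"
      by (auto simp: comma_obj[OF p] hom_def)
  qed
  ultimately show ?thesis by (rule U_subset)
qed

text \<open>Invariance along the arrows of the comma category sends a whole class into a single
  class, so the saturation in \<open>pi0_map\<close> is the class of \<open>t x\<close>.\<close>

lemma coded_component:
  assumes p: "over p" and q: "over q" and x: "x \<in> Obj (comma p c)"
    and t: "\<And>y. y \<in> Obj (comma p c) \<Longrightarrow> t y \<in> Obj (comma q d)"
    and inv: "\<And>g f. g \<in> ar p \<Longrightarrow> f \<in> hom C c (po p (Dom (src p) g)) \<Longrightarrow>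
      component q d (t (Dom (src p) g, f)) = component q d (t (Cod (src p) g, Comp C (pa p g) f))"
  shows "mp (coded p c q d t) (component p c x) = component q d (t x)"
proof -
  let ?R = "connected_rel (comma p c)" and ?S = "connected_rel (comma q d)"
  let ?X = "?R `` {x}"
  have "inj_on code0 (pi0 (comma p c))"
  proof (rule inj_onI)
    fix X Y assume "X \<in> pi0 (comma p c)" "Y \<in> pi0 (comma p c)" and eq: "code0 X = code0 Y"
    then obtain y z where y: "y \<in> Obj (comma p c)" "X = ?R `` {y}" and z: "z \<in> Obj (comma p c)" "Y = ?R `` {z}"
      by (auto simp: pi0_def quotient_def)
    then show "X = Y"
      using eq component_eq_iff[OF p y(1) z(1)] equiv_class_eq[OF equiv_comma[OF p]]
      by (auto simp: component_def)
  qed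
  moreover have "?X \<in> pi0 (comma p c)" using x by (auto simp: pi0_def quotient_def)
  ultimately have "inv_into (pi0 (comma p c)) code0 (component p c x) = ?X"
    by (simp add: component_def)
  moreover have "?S `` (t ` ?X) = ?S `` {t x}"
  proof -
    have "?S `` {t y} = ?S `` {t x}" if y: "(x, y) \<in> ?R" for y
    proof -
      have yo: "y \<in> Obj (comma p c)" using y by (simp add: connected_rel_def)
      have "component q d (t x) = component q d (t y)"
        using component_invariant[OF p x yo _ inv] component_eq_iff[OF p x yo] y by blast
      then show ?thesis
        using component_eq_iff[OF q t[OF x] t[OF yo]] equiv_class_eq[OF equiv_comma[OF q]] by metis
    qed
    moreover have "x \<in> ?X" using equiv_class_self[OF equiv_comma[OF p] x] .
    ultimately show ?thesis by blast
  qed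
  ultimately show ?thesis 
    using x by (simp add: coded_def T_set_component component_def pi0_map_def)
qed

text \<open>Associativity makes precomposition with f compatible with the arrows of the comma
  category, so it descends to components.\<close>

lemma T_restrict:
  assumes p: "over p" and f: "f \<in> Arr C" and x: "(a, k) \<in> Obj (comma p (Cod C f))"
  shows "mp (coded p (Cod C f) p (Dom C f) (\<lambda>(a, g). (a, Comp C g f))) (component p (Cod C f) (a, k)) =
      component p (Dom C f) (a, Comp C k f)" "(a, Comp C k f) \<in> Obj (comma p (Dom C f))"
proof -
  note om = over_map[OF p]
  have t: "(a, Comp C k f) \<in> Obj (comma p (Dom C f))" if "(a, k) \<in> Obj (comma p (Cod C f))" for a k
    using that C.comp_hom[OF hom_arr[OF f]] by (auto simp: comma_obj[OF p])
  show "(a, Comp C k f) \<in> Obj (comma p (Dom C f))" using t x .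
  have inv: "component p (Dom C f) (Dom (src p) g, Comp C h f) =
      component p (Dom C f) (Cod (src p) g, Comp C (Comp C (pa p g) h) f)"
    if g: "g \<in> ar p" and h: "h \<in> hom C (Cod C f) (po p (Dom (src p) g))" for g h
  proof -
    have "pa p g \<in> hom C (po p (Dom (src p) g)) (po p (Cod (src p) g))"
      using om g by (auto simp: hom_def)
    then show ?thesis
      using component_arr[OF p g C.comp_hom[OF hom_arr[OF f] h]] C.assoc[OF hom_arr[OF f] h] by simp
  qed
  show "mp (coded p (Cod C f) p (Dom C f) (\<lambda>(a, g). (a, Comp C g f))) (component p (Cod C f) (a, k)) =
      component p (Dom C f) (a, Comp C k f)"
    by (subst coded_component[OF p p x]) (use t inv in auto)
qed

section \<open>The presheaf of components and its functoriality\<close>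

lemma T_obj_mk_psh:
  "T_obj C p = mk_psh (T_set p) (\<lambda>f. mp (coded p (Cod C f) p (Dom C f) (\<lambda>(a, g). (a, Comp C g f))))"
  by (auto simp: T_obj_def mk_psh_def coded_def fun_eq_iff)

lemma T_setE:
  assumes "over p" "z \<in> T_set p c"
  obtains a k where "(a, k) \<in> Obj (comma p c)" "z = component p c (a, k)"
  using assms(2) by (auto simp: T_set_component)

lemma psh_T:
  assumes p: "over p"
  shows "T_obj C p \<in> Obj Psh"
  unfolding T_obj_mk_psh
proof (rule mk_psh)
  show "T_set p c \<in> U" for c using T_set_U[OF p] .
  show "mp (coded p (Cod C f) p (Dom C f) (\<lambda>(a, g). (a, Comp C g f))) z \<in> T_set p (Dom C f)"
    if f: "f \<in> Arr C" and z: "z \<in> T_set p (Cod C f)" for f z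
  proof -
    obtain a k where k: "(a, k) \<in> Obj (comma p (Cod C f))" "z = component p (Cod C f) (a, k)"
      using T_setE[OF p z] .
    show ?thesis
      unfolding k(2) T_restrict(1)[OF p f k(1)] T_set_component using T_restrict(2)[OF p f k(1)] by (rule imageI)
  qed
  show "mp (coded p (Cod C (Ident C c)) p (Dom C (Ident C c)) (\<lambda>(a, g). (a, Comp C g (Ident C c)))) z = z"
    if c: "c \<in> Obj C" "z \<in> T_set p c" for c z
  proof -
    obtain a k where z: "(a, k) \<in> Obj (comma p c)" "z = component p c (a, k)" using T_setE[OF p c(2)] .
    then have "Comp C k (Ident C c) = k" using C.ident_right by (auto simp: comma_obj[OF p])
    then show ?thesis using T_restrict(1)[OF p, of "Ident C c" a k] z C.ident_arr c by simp
  qed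
  fix f g z assume f: "f \<in> Arr C" and g: "g \<in> Arr C" and d: "Dom C g = Cod C f" and z: "z \<in> T_set p (Cod C g)"
  obtain a k where k: "(a, k) \<in> Obj (comma p (Cod C g))" "z = component p (Cod C g) (a, k)" using T_setE[OF p z] .
  note gf = C.comp_arr[OF f g d]
  have gk: "(a, Comp C k g) \<in> Obj (comma p (Cod C f))" using T_restrict(2)[OF p g k(1)] d by simp
  have "Comp C k (Comp C g f) = Comp C (Comp C k g) f"
    using C.assoc[of f "Dom C f" "Cod C f" g "Cod C g" k "po p a"] k f g d by (auto simp: comma_obj[OF p] hom_def)
  then show "mp (coded p (Cod C (Comp C g f)) p (Dom C (Comp C g f)) (\<lambda>(a, h). (a, Comp C h (Comp C g f)))) z =
    mp (coded p (Cod C f) p (Dom C f) (\<lambda>(a, g). (a, Comp C g f)))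
      (mp (coded p (Cod C g) p (Dom C g) (\<lambda>(a, h). (a, Comp C h g))) z)"
    using T_restrict(1)[OF p gf(1), of a k] T_restrict(1)[OF p g k(1)] T_restrict(1)[OF p f gk] gf k d
    by simp
qed

lemma fobj_T [simp]: "c \<in> Obj C \<Longrightarrow> fobj (T_obj C p) c = T_set p c"
  by (simp add: T_obj_mk_psh)

lemma component_in: "x \<in> Obj (comma p c) \<Longrightarrow> component p c x \<in> T_set p c"
  by (simp add: T_set_component)

lemma act_T:
  assumes p: "over p" and f: "f \<in> Arr C" and x: "(a, k) \<in> Obj (comma p (Cod C f))"
  shows "act (T_obj C p) f (component p (Cod C f) (a, k)) = component p (Dom C f) (a, Comp C k f)"
  using T_restrict[OF p f x] f component_in[OF x] by (simp add: T_obj_mk_psh)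

lemma T_arr_component:
  assumes x: "over x" and y: "over y" and H: "over_fun x y H" and c: "c \<in> Obj C"
    and k: "(a, k) \<in> Obj (comma x c)"
  shows "app (T_arr C (over_arr x y H)) c (component x c (a, k)) = component y c (fobj H a, k)"
    "(fobj H a, k) \<in> Obj (comma y c)"
proof -
  note HD = over_funD[OF H] and om = over_map[OF x]
  have t: "(fobj H a, k) \<in> Obj (comma y c)" if "(a, k) \<in> Obj (comma x c)" for a k
    using that HD by (auto simp: comma_obj[OF x] comma_obj[OF y])
  then show "(fobj H a, k) \<in> Obj (comma y c)" using k .
  have inv: "component y c (fobj H (Dom (src x) g), h) =
      component y c (fobj H (Cod (src x) g), Comp C (pa x g) h)"
    if g: "g \<in> ar x" and h: "h \<in> hom C c (po x (Dom (src x) g))" for g h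
    using component_arr[OF y HD(2)[OF g], of h c] HD(3,4,5,6) g h om by simp
  show "app (T_arr C (over_arr x y H)) c (component x c (a, k)) = component y c (fobj H a, k)"
    using coded_component[OF x y k, of "\<lambda>(a, g). (fobj H a, g)" c] t inv c
    by (auto simp: app_def T_arr_def Let_def)
qed

lemma T_arr_hom:
  assumes x: "over x" and y: "over y" and H: "over_fun x y H"
  shows "T_arr C (over_arr x y H) \<in> hom Psh (T_obj C x) (T_obj C y)"
proof -
  let ?t = "\<lambda>c. mp (coded x c y c (\<lambda>(a, g). (fobj H a, g)))"
  have t: "?t c (component x c (a, k)) = component y c (fobj H a, k)" "(fobj H a, k) \<in> Obj (comma y c)"
    if "c \<in> Obj C" "(a, k) \<in> Obj (comma x c)" for c a k
    using T_arr_component[OF x y H that] that(1) by (simp_all add: T_arr_def app_def Let_def)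
  have "T_arr C (over_arr x y H) = nat_mor (T_obj C x) (T_obj C y) ?t"
    by (auto simp: T_arr_def nat_mor_def Let_def coded_def fun_eq_iff)
  moreover have "is_nat (T_obj C x) (T_obj C y) ?t"
    unfolding is_nat_def
  proof (intro conjI ballI)
    fix c z assume "c \<in> Obj C" "z \<in> fobj (T_obj C x) c"
    then show "?t c z \<in> fobj (T_obj C y) c"
      using t component_in[of _ y c] by (auto elim!: T_setE[OF x])
  next
    fix f z assume f: "f \<in> Arr C" and z: "z \<in> fobj (T_obj C x) (Cod C f)"
    obtain a k where k: "(a, k) \<in> Obj (comma x (Cod C f))" "z = component x (Cod C f) (a, k)"
      using z C.cod_obj[OF f] by (auto elim: T_setE[OF x])
    show "?t (Dom C f) (act (T_obj C x) f z) = act (T_obj C y) f (?t (Cod C f) z)"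
      using t[OF C.cod_obj[OF f] k(1)] t[OF C.dom_obj[OF f] T_restrict(2)[OF x f k(1)]]
        act_T[OF x f k(1)] act_T[OF y f] k(2) by simp
  qed
  ultimately show ?thesis using nat_mor_hom psh_T x y by simp
qed

section \<open>The universal arrow and the adjunction\<close>

definition eta_section :: "'u over \<Rightarrow> 'u \<Rightarrow> 'u" where
  "eta_section x a = component x (po x a) (a, Ident C (po x a))"

lemma eta_pair: "over x \<Longrightarrow> a \<in> ob x \<Longrightarrow> (a, Ident C (po x a)) \<in> Obj (comma x (po x a))"
  using C.ident_hom over_map by (simp add: comma_obj)

text \<open>An arrow g of x is itself an arrow of a comma category, from the identity pair at its
  source to the pair of its target and \<open>pa x g\<close>. The latter pair represents the
  restricted value, so the components agree.\<close>

lemma eta_section: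
  assumes x: "over x"
  shows "is_section x (T_obj C x) (eta_section x)"
  unfolding is_section_def
proof (intro conjI ballI)
  note om = over_map[OF x]
  show "eta_section x a \<in> fobj (T_obj C x) (po x a)" if "a \<in> ob x" for a
    using component_in[OF eta_pair[OF x that]] om that by (simp add: eta_section_def)
  fix g assume g: "g \<in> ar x"
  have pg: "pa x g \<in> hom C (po x (Dom (src x) g)) (po x (Cod (src x) g))"
    using om g by (auto simp: hom_def)
  have "act (T_obj C x) (pa x g) (eta_section x (Cod (src x) g)) =
    component x (po x (Dom (src x) g)) (Cod (src x) g, Comp C (Ident C (po x (Cod (src x) g))) (pa x g))"
    using act_T[OF x, of "pa x g" "Cod (src x) g"] eta_pair[OF x, of "Cod (src x) g"] om g
    by (simp add: eta_section_def)
  also have "\<dots> = eta_section x (Dom (src x) g)"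
    using component_arr[OF x g, of "Ident C (po x (Dom (src x) g))"] C.ident_left[OF pg] C.ident_right[OF pg]
      C.ident_hom om g by (simp add: eta_section_def)
  finally show "eta_section x (Dom (src x) g) = act (T_obj C x) (pa x g) (eta_section x (Cod (src x) g))" ..
qed

text \<open>The pair (a, k) is the identity pair at a restricted along k, so a transformation out of
  \<open>T_obj C x\<close> is fixed by its values on \<open>eta_section x\<close>.\<close>

lemma component_eta:
  assumes x: "over x" and k: "(a, k) \<in> Obj (comma x c)"
  shows "component x c (a, k) = act (T_obj C x) k (eta_section x a)"
    "k \<in> Arr C" "Dom C k = c" "Cod C k = po x a" "a \<in> ob x"
proof -
  have k': "k \<in> hom C c (po x a)" "a \<in> ob x" using k by (auto simp: comma_obj[OF x])
  then show ka: "k \<in> Arr C" "Dom C k = c" "Cod C k = po x a" "a \<in> ob x" by (auto simp: hom_def)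
  show "component x c (a, k) = act (T_obj C x) k (eta_section x a)"
    using act_T[OF x ka(1), of a "Ident C (po x a)"] eta_pair[OF x k'(2)] ka C.ident_left[OF k'(1)]
    by (simp add: eta_section_def)
qed

lemma eta_universal:
  assumes x: "over x" and F: "F \<in> Obj Psh" and s: "is_section x F s"
  shows "\<exists>!\<alpha>. \<alpha> \<in> hom Psh (T_obj C x) F \<and> (\<forall>a\<in>ob x. app \<alpha> (po x a) (eta_section x a) = s a)"
proof -
  note om = over_map[OF x]
  \<comment> \<open>The value forced by \<open>component_eta\<close>: \<open>s a\<close> restricted
    along k, for a chosen representative (a, k). The next claim removes the choice, by compatibility
    of s with the arrows of x.\<close>
  define t where "t c z = (let (a, k) = SOME y. y \<in> Obj (comma x c) \<and> component x c y = z in act F k (s a))"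
    for c z
  have t: "t c (component x c (a, k)) = act F k (s a)" if k: "(a, k) \<in> Obj (comma x c)" for c a k
  proof -
    let ?P = "\<lambda>y. y \<in> Obj (comma x c) \<and> component x c y = component x c (a, k)"
    have S: "?P (SOME y. ?P y)" by (rule someI[of ?P "(a, k)"]) (use k in simp)
    have "(\<lambda>(a, k). act F k (s a)) (SOME y. ?P y) = (\<lambda>(a, k). act F k (s a)) (a, k)"
    proof (rule component_invariant[OF x _ k, where \<phi> = "\<lambda>(a, k). act F k (s a)"])
      show "(SOME y. ?P y) \<in> Obj (comma x c)" "component x c (SOME y. ?P y) = component x c (a, k)"
        using S by blast+
      fix g f assume g: "g \<in> ar x" and f: "f \<in> hom C c (po x (Dom (src x) g))"
      have "act F (Comp C (pa x g) f) (s (Cod (src x) g)) = act F f (act F (pa x g) (s (Cod (src x) g)))"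
        by (rule act_comp[OF F]) (use g f om s in \<open>auto simp: is_section_def hom_def\<close>)
      then show "(case (Dom (src x) g, f) of (a, k) \<Rightarrow> act F k (s a)) =
          (case (Cod (src x) g, Comp C (pa x g) f) of (a, k) \<Rightarrow> act F k (s a))"
        using s g by (simp add: is_section_def)
    qed
    then show ?thesis by (simp add: t_def)
  qed
  have sin: "s a \<in> fobj F (po x a)" if "a \<in> ob x" for a using s that by (simp add: is_section_def)
  have "is_nat (T_obj C x) F t"
    unfolding is_nat_def
  proof (intro conjI ballI)
    fix c z assume "c \<in> Obj C" "z \<in> fobj (T_obj C x) c"
    then obtain a k where k: "(a, k) \<in> Obj (comma x c)" "z = component x c (a, k)"
      by (auto elim: T_setE[OF x])
    show "t c z \<in> fobj F c"
      using act_in[OF F component_eta(2)[OF x k(1)]] component_eta(3-5)[OF x k(1)] sin t[OF k(1)] k(2) by simp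
  next
    fix f z assume f: "f \<in> Arr C" and "z \<in> fobj (T_obj C x) (Cod C f)"
    then obtain a k where k: "(a, k) \<in> Obj (comma x (Cod C f))" "z = component x (Cod C f) (a, k)"
      using C.cod_obj by (auto elim: T_setE[OF x])
    show "t (Dom C f) (act (T_obj C x) f z) = act F f (t (Cod C f) z)"
      using act_T[OF x f k(1)] t[OF k(1)] t[OF T_restrict(2)[OF x f k(1)]] k(2)
        act_comp[OF F f component_eta(2)[OF x k(1)]] component_eta(3-5)[OF x k(1)] sin by simp
  qed
  then have n: "nat_mor (T_obj C x) F t \<in> hom Psh (T_obj C x) F" using nat_mor_hom psh_T[OF x] F by blast
  show ?thesis
  proof (rule ex1I[of _ "nat_mor (T_obj C x) F t"], intro conjI ballI n)
    fix a assume a: "a \<in> ob x"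
    have "app (nat_mor (T_obj C x) F t) (po x a) (eta_section x a) = t (po x a) (eta_section x a)"
      using om a component_in[OF eta_pair[OF x a]] by (simp add: eta_section_def)
    also have "\<dots> = act F (Ident C (po x a)) (s a)"
      using t[OF eta_pair[OF x a]] by (simp add: eta_section_def)
    also have "\<dots> = s a" using act_ident[OF F _ sin[OF a]] om a by simp
    finally show "app (nat_mor (T_obj C x) F t) (po x a) (eta_section x a) = s a" .
  next
    fix \<beta> assume b: "\<beta> \<in> hom Psh (T_obj C x) F \<and> (\<forall>a\<in>ob x. app \<beta> (po x a) (eta_section x a) = s a)"
    show "\<beta> = nat_mor (T_obj C x) F t"
    proof (rule hom_Psh_eqI[OF _ n])
      fix c z assume c: "c \<in> Obj C" "z \<in> fobj (T_obj C x) c"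
      then obtain a k where k: "(a, k) \<in> Obj (comma x c)" "z = component x c (a, k)"
        by (auto elim: T_setE[OF x])
      note ce = component_eta[OF x k(1)]
      have "eta_section x a \<in> fobj (T_obj C x) (Cod C k)"
        using eta_section[OF x] ce by (simp add: is_section_def)
      then have "app \<beta> c z = act F k (app \<beta> (po x a) (eta_section x a))"
        using app_natural[of \<beta> "T_obj C x" F k "eta_section x a"] b ce k(2) by simp
      then show "app \<beta> c z = app (nat_mor (T_obj C x) F t) c z"
        using t[OF k(1)] k(2) b ce(5) c by simp
    qed (use b in blast)
  qed
qed

definition eta :: "'u over \<Rightarrow> ('u over, 'u over) mor" where
  "eta x = sect x (T_obj C x) (eta_section x)"

theorem adjunction_T_int:
  "adjunction K Psh (T_functor C) (int_functor C) (\<lambda>x y f. Comp K (farr (int_functor C) f) (eta x))"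
proof (rule adjunctionI_universal[OF is_functor_int])
  fix x assume "x \<in> Obj K"
  then have x: "over x" using Obj_K by blast
  show "fobj (T_functor C) x \<in> Obj Psh" using psh_T[OF x] by (simp add: T_functor_def)
  show "eta x \<in> hom K x (fobj (int_functor C) (fobj (T_functor C) x))"
    using sect_hom[OF x psh_T[OF x] eta_section[OF x]]
    by (simp only: eta_def T_functor_def int_functor_def fctr.simps)
next
  fix x F f assume "x \<in> Obj K" and F: "F \<in> Obj Psh" and f: "f \<in> hom K x (fobj (int_functor C) F)"
  then have x: "over x" using Obj_K by blast
  obtain s where s: "is_section x F s" "f = sect x F s"
    using sectE[OF _ F] f by (auto simp only: int_functor_def fctr.simps)
  \<comment> \<open>Both sides are given by sections, so the equation of arrows is one of values on
    the objects of x.\<close>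
  have "Comp K (farr (int_functor C) \<alpha>) (eta x) = f \<longleftrightarrow> (\<forall>a\<in>ob x. app \<alpha> (po x a) (eta_section x a) = s a)"
    if "\<alpha> \<in> hom Psh (T_obj C x) F" for \<alpha>
    unfolding int_functor_def fctr.simps eta_def int_arr_comp_sect[OF x that eta_section[OF x]] s(2) sect_eq_iff[OF x] ..
  then show "\<exists>!g. g \<in> hom Psh (fobj (T_functor C) x) F \<and> Comp K (farr (int_functor C) g) (eta x) = f"
    using eta_universal[OF x F s(1)] unfolding T_functor_def fctr.simps by (metis (no_types, lifting))
next
  fix h x y assume "h \<in> hom K x y"
  then obtain H where x: "over x" and y: "over y" and H: "over_fun x y H" and h: "h = over_arr x y H"
    using hom_KE by blast
  have T: "T_arr C h \<in> hom Psh (T_obj C x) (T_obj C y)" using T_arr_hom[OF x y H] h by simp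
  then show "farr (T_functor C) h \<in> hom Psh (fobj (T_functor C) x) (fobj (T_functor C) y)"
    by (simp only: T_functor_def fctr.simps)
  show "Comp K (farr (int_functor C) (farr (T_functor C) h)) (eta x) = Comp K (eta y) h"
    unfolding int_functor_def T_functor_def fctr.simps eta_def int_arr_comp_sect[OF x T eta_section[OF x]]
    unfolding h sect_comp[OF x y H psh_T[OF y] eta_section[OF y]] sect_eq_iff[OF x]
    using T_arr_component[OF x y H _ eta_pair[OF x]] over_map[OF x] over_funD[OF H]
    by (simp add: eta_section_def)
qed

end

section \<open>Fibre products and the factorization\<close>

definition pb_obj :: "'u over \<Rightarrow> 'u over \<Rightarrow> 'u set" where
  "pb_obj y e = {upair q b | q b. q \<in> ob y \<and> b \<in> ob e \<and> po y q = po e b}"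

text \<open>The object set is a parameter because the factorization compares the full subcategories
  on several such sets.\<close>

definition pb_arr :: "'u over \<Rightarrow> 'u over \<Rightarrow> 'u set \<Rightarrow> 'u set" where
  "pb_arr y e S = {upair g m | g m. g \<in> ar y \<and> m \<in> ar e \<and> pa y g = pa e m \<and>
    upair (Dom (src y) g) (Dom (src e) m) \<in> S \<and> upair (Cod (src y) g) (Cod (src e) m) \<in> S}"

text \<open>The full subcategory on the object set \<open>S\<close> of the fibre product of \<open>y\<close> and \<open>e\<close> over
  \<open>C\<close>.\<close>

definition pb_cat :: "'u over \<Rightarrow> 'u over \<Rightarrow> 'u set \<Rightarrow> 'u scat" where
  "pb_cat y e S = \<lparr>
    Obj = S,
    Arr = pb_arr y e S,
    Dom = (\<lambda>m \<in> pb_arr y e S. upair (Dom (src y) (ufst m)) (Dom (src e) (usnd m))),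
    Cod = (\<lambda>m \<in> pb_arr y e S. upair (Cod (src y) (ufst m)) (Cod (src e) (usnd m))),
    Ident = (\<lambda>z \<in> S. upair (Ident (src y) (ufst z)) (Ident (src e) (usnd z))),
    Comp = (\<lambda>n m. if m \<in> pb_arr y e S \<and> n \<in> pb_arr y e S \<and>
        Dom (src y) (ufst n) = Cod (src y) (ufst m) \<and> Dom (src e) (usnd n) = Cod (src e) (usnd m)
      then upair (Comp (src y) (ufst n) (ufst m)) (Comp (src e) (usnd n) (usnd m)) else undefined)\<rparr>"

definition pb :: "'u over \<Rightarrow> 'u over \<Rightarrow> 'u set \<Rightarrow> 'u over" where
  "pb y e S = Mor (pb_cat y e S)
    \<lparr>fobj = (\<lambda>z \<in> S. po y (ufst z)), farr = (\<lambda>m \<in> pb_arr y e S. pa y (ufst m))\<rparr> (tgt y)"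

text \<open>Objects and arrows are both coded by \<open>upair\<close>, so a single selector,
  \<open>ufst\<close> or \<open>usnd\<close>, acts on both levels.\<close>

definition pb_proj :: "('u \<Rightarrow> 'u) \<Rightarrow> 'u over \<Rightarrow> 'u over \<Rightarrow> 'u set \<Rightarrow> 'u sfun" where
  "pb_proj r y e S = \<lparr>fobj = (\<lambda>z \<in> S. r z), farr = (\<lambda>m \<in> pb_arr y e S. r m)\<rparr>"

definition pb_pair :: "'u over \<Rightarrow> 'u sfun \<Rightarrow> 'u sfun \<Rightarrow> 'u sfun" where
  "pb_pair x V T = \<lparr>fobj = (\<lambda>a \<in> ob x. upair (fobj V a) (fobj T a)),
    farr = (\<lambda>g \<in> ar x. upair (farr V g) (farr T g))\<rparr>"

abbreviation omap :: "('u over, 'u over) mor \<Rightarrow> 'u \<Rightarrow> 'u" where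
  "omap h \<equiv> fobj (mp (mp h))"

context small_base
begin

lemma pb_arr_iff: "upair g (m :: 'u) \<in> pb_arr y e S \<longleftrightarrow> g \<in> ar y \<and> m \<in> ar e \<and> pa y g = pa e m \<and>
    upair (Dom (src y) g) (Dom (src e) m) \<in> S \<and> upair (Cod (src y) g) (Cod (src e) m) \<in> S"
  by (auto simp: pb_arr_def)

lemma pb_arrE:
  assumes "(z :: 'u) \<in> pb_arr y e S"
  obtains g m where "z = upair g m" "g \<in> ar y" "m \<in> ar e" "pa y g = pa e m"
    "upair (Dom (src y) g) (Dom (src e) m) \<in> S" "upair (Cod (src y) g) (Cod (src e) m) \<in> S"
  using assms by (auto simp: pb_arr_def)

lemma pb_objE:
  assumes "(z :: 'u) \<in> S" "S \<subseteq> pb_obj y e"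
  obtains q b where "z = upair q b" "q \<in> ob y" "b \<in> ob e" "po y q = po e b"
  using assms by (auto simp: pb_obj_def)

lemma pb_simps [simp]:
  "src (pb y e S) = pb_cat y e S" "Obj (pb_cat y e S) = S" "Arr (pb_cat y e S) = pb_arr y e S"
  "z \<in> S \<Longrightarrow> po (pb y e S) z = po y (ufst z)"
  "m \<in> pb_arr y e S \<Longrightarrow> pa (pb y e S) m = pa y (ufst m)"
  "m \<in> pb_arr y e S \<Longrightarrow> Dom (pb_cat y e S) m = upair (Dom (src y) (ufst m)) (Dom (src e) (usnd m))"
  "m \<in> pb_arr y e S \<Longrightarrow> Cod (pb_cat y e S) m = upair (Cod (src y) (ufst m)) (Cod (src e) (usnd m))"
  "z \<in> S \<Longrightarrow> Ident (pb_cat y e S) z = upair (Ident (src y) (ufst z)) (Ident (src e) (usnd z))"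
  by (simp_all add: pb_def pb_cat_def)

lemma pb_comp [simp]:
  assumes "m \<in> pb_arr y e S" "n \<in> pb_arr y e S"
    "Dom (src y) (ufst n) = Cod (src y) (ufst m)" "Dom (src e) (usnd n) = Cod (src e) (usnd m)"
  shows "Comp (pb_cat y e S) n m = upair (Comp (src y) (ufst n) (ufst m)) (Comp (src e) (usnd n) (usnd m))"
  using assms by (simp add: pb_cat_def)

context
  fixes y e S assumes y: "over y" and e: "over e" and S: "S \<subseteq> pb_obj y e"
begin

interpretation Y: category "src y" using overD y by blast
interpretation E: category "src e" using overD e by blast

lemma pb_arr_ident:
  assumes z: "z \<in> S"
  shows "upair (Ident (src y) (ufst z)) (Ident (src e) (usnd z)) \<in> pb_arr y e S"
  using z Y.ident_arr E.ident_arr over_arr_ident[OF y] over_arr_ident[OF e]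
  by (cases rule: pb_objE[OF z S]) (simp add: pb_arr_iff)

lemma pb_arr_comp:
  assumes "m \<in> pb_arr y e S" "n \<in> pb_arr y e S"
    "Dom (src y) (ufst n) = Cod (src y) (ufst m)" "Dom (src e) (usnd n) = Cod (src e) (usnd m)"
  shows "upair (Comp (src y) (ufst n) (ufst m)) (Comp (src e) (usnd n) (usnd m)) \<in> pb_arr y e S"
  using assms Y.comp_arr E.comp_arr over_arr_comp[OF y] over_arr_comp[OF e]
  by (auto simp: pb_arr_iff elim!: pb_arrE)

lemma category_pb_cat: "category (pb_cat y e S)"
proof
  fix m assume "m \<in> Arr (pb_cat y e S)"
  then show "Dom (pb_cat y e S) m \<in> Obj (pb_cat y e S)" "Cod (pb_cat y e S) m \<in> Obj (pb_cat y e S)"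
    by (auto simp: pb_arr_iff elim!: pb_arrE)
next
  fix z assume z: "z \<in> Obj (pb_cat y e S)"
  then obtain q b where q: "z = upair q b" "q \<in> ob y" "b \<in> ob e" by (auto elim: pb_objE[OF _ S])
  then show "Ident (pb_cat y e S) z \<in> hom (pb_cat y e S) z z"
    using z pb_arr_ident[of z] Y.ident_arr E.ident_arr by (simp add: hom_def)
next
  fix m a b n c assume m: "m \<in> hom (pb_cat y e S) a b" and n: "n \<in> hom (pb_cat y e S) b c"
  then have mn: "m \<in> pb_arr y e S" "n \<in> pb_arr y e S" by (auto simp: hom_def)
  have d: "Dom (src y) (ufst n) = Cod (src y) (ufst m)" "Dom (src e) (usnd n) = Cod (src e) (usnd m)"
    using m n mn by (auto simp: hom_def)
  have "Dom (src y) (Comp (src y) (ufst n) (ufst m)) = Dom (src y) (ufst m)"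
    "Cod (src y) (Comp (src y) (ufst n) (ufst m)) = Cod (src y) (ufst n)"
    "Dom (src e) (Comp (src e) (usnd n) (usnd m)) = Dom (src e) (usnd m)"
    "Cod (src e) (Comp (src e) (usnd n) (usnd m)) = Cod (src e) (usnd n)"
    using mn d Y.comp_arr E.comp_arr by (auto simp: pb_arr_iff elim!: pb_arrE)
  then show "Comp (pb_cat y e S) n m \<in> hom (pb_cat y e S) a c"
    using m n mn d pb_arr_comp[OF mn d] by (simp add: hom_def)
next
  fix m a b assume m: "m \<in> hom (pb_cat y e S) a b"
  then have ma: "m \<in> pb_arr y e S" by (auto simp: hom_def)
  then obtain g k where g: "m = upair g k" "g \<in> ar y" "k \<in> ar e"
    "upair (Dom (src y) g) (Dom (src e) k) \<in> S" "upair (Cod (src y) g) (Cod (src e) k) \<in> S"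
    by (auto elim: pb_arrE)
  have ab: "a = upair (Dom (src y) g) (Dom (src e) k)" "b = upair (Cod (src y) g) (Cod (src e) k)"
    using m g(1) ma by (auto simp: hom_def)
  note ids = Y.ident_left[OF hom_arr[OF g(2)]] Y.ident_right[OF hom_arr[OF g(2)]]
    E.ident_left[OF hom_arr[OF g(3)]] E.ident_right[OF hom_arr[OF g(3)]]
  show "Comp (pb_cat y e S) (Ident (pb_cat y e S) b) m = m"
    using g ma pb_arr_ident[OF g(5)] Y.ident_arr E.ident_arr Y.cod_obj E.cod_obj
    by (simp add: ab ids)
  show "Comp (pb_cat y e S) m (Ident (pb_cat y e S) a) = m"
    using g ma pb_arr_ident[OF g(4)] Y.ident_arr E.ident_arr Y.dom_obj E.dom_obj
    by (simp add: ab ids)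
next
  fix m a b n c p d
  assume m: "m \<in> hom (pb_cat y e S) a b" and n: "n \<in> hom (pb_cat y e S) b c" and p: "p \<in> hom (pb_cat y e S) c d"
  then have mnp: "m \<in> pb_arr y e S" "n \<in> pb_arr y e S" "p \<in> pb_arr y e S" by (auto simp: hom_def)
  have d: "Dom (src y) (ufst n) = Cod (src y) (ufst m)" "Dom (src e) (usnd n) = Cod (src e) (usnd m)"
    and d': "Dom (src y) (ufst p) = Cod (src y) (ufst n)" "Dom (src e) (usnd p) = Cod (src e) (usnd n)"
    using m n p mnp by (auto simp: hom_def)
  have a: "ufst m \<in> ar y" "ufst n \<in> ar y" "ufst p \<in> ar y" "usnd m \<in> ar e" "usnd n \<in> ar e" "usnd p \<in> ar e"
    using mnp by (auto elim!: pb_arrE)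
  have "Comp (src y) (ufst p) (Comp (src y) (ufst n) (ufst m)) =
      Comp (src y) (Comp (src y) (ufst p) (ufst n)) (ufst m)"
    by (rule Y.assoc) (use a d d' in \<open>auto simp: hom_def\<close>)
  moreover have "Comp (src e) (usnd p) (Comp (src e) (usnd n) (usnd m)) =
      Comp (src e) (Comp (src e) (usnd p) (usnd n)) (usnd m)"
    by (rule E.assoc) (use a d d' in \<open>auto simp: hom_def\<close>)
  ultimately show "Comp (pb_cat y e S) p (Comp (pb_cat y e S) n m) =
      Comp (pb_cat y e S) (Comp (pb_cat y e S) p n) m"
    using mnp d d' pb_arr_comp[OF mnp(1,2) d] pb_arr_comp[OF mnp(2,3) d'] a Y.comp_arr E.comp_arr by simp
qed

lemma over_pb: "over (pb y e S)"
proof -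
  interpret P: category "pb_cat y e S" by (rule category_pb_cat)
  have 1: "S \<in> U" using S by (rule U_subset[rotated])
    (rule U_subset[OF U_pairs[OF overD(4)[OF y] overD(4)[OF e]]], auto simp: pb_obj_def)
  have 2: "pb_arr y e S \<in> U"
    by (rule U_subset[OF U_pairs[OF overD(5)[OF y] overD(5)[OF e]]]) (auto simp: pb_arr_def)
  have 3: "ext_cat (pb_cat y e S)"
    by (auto simp: ext_cat_def pb_cat_def)
  have "is_functor (pb_cat y e S) C (mp (pb y e S))"
  proof (intro is_functor.intro is_functor_axioms.intro P.category_axioms C.category_axioms)
    fix z assume "z \<in> Obj (pb_cat y e S)"
    then show "po (pb y e S) z \<in> Obj C" using over_map[OF e] by (auto elim!: pb_objE[OF _ S])
  next
    fix m a b assume m: "m \<in> hom (pb_cat y e S) a b"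
    then have ma: "m \<in> pb_arr y e S" by (simp add: hom_def)
    then have "ufst m \<in> ar y" "upair (Dom (src y) (ufst m)) (Dom (src e) (usnd m)) \<in> S"
      "upair (Cod (src y) (ufst m)) (Cod (src e) (usnd m)) \<in> S" by (auto elim!: pb_arrE)
    moreover have "a = upair (Dom (src y) (ufst m)) (Dom (src e) (usnd m))"
      "b = upair (Cod (src y) (ufst m)) (Cod (src e) (usnd m))" using m ma by (auto simp: hom_def)
    ultimately show "pa (pb y e S) m \<in> hom C (po (pb y e S) a) (po (pb y e S) b)"
      using over_map[OF y] ma by (simp add: hom_def)
  next
    fix z assume "z \<in> Obj (pb_cat y e S)"
    then show "pa (pb y e S) (Ident (pb_cat y e S) z) = Ident C (po (pb y e S) z)"
      using pb_arr_ident[of z] over_arr_ident[OF y] by (auto elim!: pb_objE[OF _ S])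
  next
    fix m a b n c assume m: "m \<in> hom (pb_cat y e S) a b" and n: "n \<in> hom (pb_cat y e S) b c"
    then have mn: "m \<in> pb_arr y e S" "n \<in> pb_arr y e S" by (auto simp: hom_def)
    have d: "Dom (src y) (ufst n) = Cod (src y) (ufst m)" "Dom (src e) (usnd n) = Cod (src e) (usnd m)"
      using m n mn by (auto simp: hom_def)
    have a: "ufst m \<in> ar y" "ufst n \<in> ar y" using mn by (auto elim!: pb_arrE)
    show "pa (pb y e S) (Comp (pb_cat y e S) n m) = Comp C (pa (pb y e S) n) (pa (pb y e S) m)"
      using mn d a pb_arr_comp[OF mn d] over_arr_comp[OF y] by simp
  qed
  then show ?thesis
    using 1 2 3 P.category_axioms overD(3)[OF y]
    by (auto simp: over_def small_category_def ext_functor_def pb_def)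
qed

lemma pb_proj_over:
  assumes rt: "(r, t) = (ufst, y) \<or> (r, t) = (usnd, e)"
  shows "over_fun (pb y e S) t (pb_proj r y e S)"
proof (rule over_funI[OF over_pb])
  show "over t" using rt y e by auto
  fix z assume z: "z \<in> ob (pb y e S)"
  then show "fobj (pb_proj r y e S) z \<in> ob t \<and> po t (fobj (pb_proj r y e S) z) = po (pb y e S) z"
    using rt by (auto simp: pb_proj_def elim!: pb_objE[OF _ S])
  show "farr (pb_proj r y e S) (Ident (src (pb y e S)) z) = Ident (src t) (fobj (pb_proj r y e S) z)"
    using rt z pb_arr_ident[of z] by (auto simp: pb_proj_def)
next
  fix m assume "m \<in> ar (pb y e S)"
  then show "farr (pb_proj r y e S) m \<in> ar t \<and> pa t (farr (pb_proj r y e S) m) = pa (pb y e S) m \<and>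
      Dom (src t) (farr (pb_proj r y e S) m) = fobj (pb_proj r y e S) (Dom (src (pb y e S)) m) \<and>
      Cod (src t) (farr (pb_proj r y e S) m) = fobj (pb_proj r y e S) (Cod (src (pb y e S)) m)"
    using rt by (auto simp: pb_proj_def pb_arr_iff elim!: pb_arrE)
next
  fix m n assume "m \<in> ar (pb y e S)" "n \<in> ar (pb y e S)" "Dom (src (pb y e S)) n = Cod (src (pb y e S)) m"
  then show "farr (pb_proj r y e S) (Comp (src (pb y e S)) n m) =
      Comp (src t) (farr (pb_proj r y e S) n) (farr (pb_proj r y e S) m)"
    using rt pb_arr_comp[of m n] by (auto simp: pb_proj_def)
qed (simp add: ext_functor_def pb_proj_def)

lemma pb_pair_over:
  assumes x: "over x" and V: "over_fun x y V" and T: "over_fun x e T"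
    and VT: "\<And>a. a \<in> ob x \<Longrightarrow> upair (fobj V a) (fobj T a) \<in> S"
  shows "over_fun x (pb y e S) (pb_pair x V T)"
proof -
  interpret X: category "src x" using overD x by blast
  interpret V: is_functor "src x" "src y" V using V by (simp add: over_fun_def)
  interpret T: is_functor "src x" "src e" T using T by (simp add: over_fun_def)
  note VD = over_funD[OF V] and TD = over_funD[OF T] and om = over_map[OF x]
  have arr: "upair (farr V g) (farr T g) \<in> pb_arr y e S" if "g \<in> ar x" for g
    using that VD TD om VT by (simp add: pb_arr_iff)
  show ?thesis
  proof (rule over_funI[OF x over_pb])
    fix a assume a: "a \<in> ob x"
    then show "fobj (pb_pair x V T) a \<in> ob (pb y e S) \<and> po (pb y e S) (fobj (pb_pair x V T) a) = po x a"
      using VT VD by (simp add: pb_pair_def)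
    show "farr (pb_pair x V T) (Ident (src x) a) = Ident (src (pb y e S)) (fobj (pb_pair x V T) a)"
      using a VT X.ident_arr V.map_ident T.map_ident by (simp add: pb_pair_def)
  next
    fix g assume g: "g \<in> ar x"
    then show "farr (pb_pair x V T) g \<in> ar (pb y e S) \<and> pa (pb y e S) (farr (pb_pair x V T) g) = pa x g \<and>
      Dom (src (pb y e S)) (farr (pb_pair x V T) g) = fobj (pb_pair x V T) (Dom (src x) g) \<and>
      Cod (src (pb y e S)) (farr (pb_pair x V T) g) = fobj (pb_pair x V T) (Cod (src x) g)"
      using arr[OF g] VD TD om by (simp add: pb_pair_def)
  next
    fix f g assume f: "f \<in> ar x" and g: "g \<in> ar x" and d: "Dom (src x) g = Cod (src x) f"
    have "farr V (Comp (src x) g f) = Comp (src y) (farr V g) (farr V f)"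
      by (rule V.map_comp) (use f g d in \<open>auto simp: hom_def\<close>)
    moreover have "farr T (Comp (src x) g f) = Comp (src e) (farr T g) (farr T f)"
      by (rule T.map_comp) (use f g d in \<open>auto simp: hom_def\<close>)
    ultimately show "farr (pb_pair x V T) (Comp (src x) g f) =
        Comp (src (pb y e S)) (farr (pb_pair x V T) g) (farr (pb_pair x V T) f)"
      using arr[OF f] arr[OF g] X.comp_arr[OF f g d] VD TD f g d by (simp add: pb_pair_def)
  qed (simp add: ext_functor_def pb_pair_def)
qed

definition "pr1 = over_arr (pb y e S) y (pb_proj ufst y e S)"
definition "pr2 = over_arr (pb y e S) e (pb_proj usnd y e S)"

lemma pr_hom: "pr1 \<in> hom K (pb y e S) y" "pr2 \<in> hom K (pb y e S) e"
  unfolding pr1_def pr2_def using hom_KI[OF over_pb] y e pb_proj_over by blast+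

lemma pr_omap: "z \<in> S \<Longrightarrow> omap pr1 z = ufst z" "z \<in> S \<Longrightarrow> omap pr2 z = usnd z"
  by (simp_all add: pr1_def pr2_def pb_proj_def)

text \<open>The universal property of the fibre product; since the subcategory is full, it is enough
  that the pairs of objects lie in S.\<close>

lemma pb_pairing:
  assumes v: "v \<in> hom K x y" and t: "t \<in> hom K x e"
    and vt: "\<And>a. a \<in> ob x \<Longrightarrow> upair (omap v a) (omap t a) \<in> S"
  obtains h where "h \<in> hom K x (pb y e S)" "Comp K pr1 h = v" "Comp K pr2 h = t"
    "\<And>a. a \<in> ob x \<Longrightarrow> omap h a = upair (omap v a) (omap t a)"
proof -
  obtain V where V: "over x" "over_fun x y V" "v = over_arr x y V" using hom_KE[OF v] by blast
  obtain T where T: "over_fun x e T" "t = over_arr x e T" using hom_KE[OF t] by blast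
  have VT: "upair (fobj V a) (fobj T a) \<in> S" if "a \<in> ob x" for a using vt[OF that] V T by simp
  have P: "over_fun x (pb y e S) (pb_pair x V T)" using pb_pair_over[OF V(1,2) T(1) VT] by blast
  note PD = over_funD[OF P]
  have pa: "farr (pb_pair x V T) g \<in> pb_arr y e S" if "g \<in> ar x" for g using PD(2)[OF that] by simp
  have "fun_comp (src x) (pb_proj ufst y e S) (pb_pair x V T) = V"
    by (rule fctr_eqI[of "src x"])
      (use VT pa over_funD(7)[OF V(2)] in \<open>auto simp: pb_proj_def pb_pair_def\<close>)
  moreover have "fun_comp (src x) (pb_proj usnd y e S) (pb_pair x V T) = T"
    by (rule fctr_eqI[of "src x"])
      (use VT pa over_funD(7)[OF T(1)] in \<open>auto simp: pb_proj_def pb_pair_def\<close>)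
  ultimately have "Comp K pr1 (over_arr x (pb y e S) (pb_pair x V T)) = v"
    "Comp K pr2 (over_arr x (pb y e S) (pb_pair x V T)) = t"
    unfolding pr1_def pr2_def Comp_K V(3) T(2) by simp_all
  moreover have "omap (over_arr x (pb y e S) (pb_pair x V T)) a = upair (omap v a) (omap t a)" if "a \<in> ob x" for a
    using that V T by (simp add: pb_pair_def)
  ultimately show ?thesis using that hom_KI[OF V(1) over_pb P] by blast
qed

lemma pr_jointly_monic:
  assumes h: "h \<in> hom K x (pb y e S)" and k: "k \<in> hom K x (pb y e S)"
    and eq: "Comp K pr1 h = Comp K pr1 k" "Comp K pr2 h = Comp K pr2 k"
  shows "h = k"
proof -
  obtain H where H: "over_fun x (pb y e S) H" "h = over_arr x (pb y e S) H" using hom_KE[OF h] by blast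
  obtain G where G: "over_fun x (pb y e S) G" "k = over_arr x (pb y e S) G" using hom_KE[OF k] by blast
  note HD = over_funD[OF H(1)] and GD = over_funD[OF G(1)]
  have eqs: "fun_comp (src x) (pb_proj ufst y e S) H = fun_comp (src x) (pb_proj ufst y e S) G"
    "fun_comp (src x) (pb_proj usnd y e S) H = fun_comp (src x) (pb_proj usnd y e S) G"
    using eq unfolding pr1_def pr2_def H(2) G(2) Comp_K by simp_all
  have "H = G"
  proof (rule fctr_eqI[of "src x"])
    fix a assume a: "a \<in> ob x"
    have "ufst (fobj H a) = ufst (fobj G a)" "usnd (fobj H a) = usnd (fobj G a)"
      using arg_cong[OF eqs(1), of "\<lambda>F. fobj F a"] arg_cong[OF eqs(2), of "\<lambda>F. fobj F a"] a HD(1)[OF a] GD(1)[OF a]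
      by (simp_all add: pb_proj_def)
    then show "fobj H a = fobj G a" using HD(1)[OF a] GD(1)[OF a] by (auto elim!: pb_objE[OF _ S])
  next
    fix a assume a: "a \<in> ar x"
    have "ufst (farr H a) = ufst (farr G a)" "usnd (farr H a) = usnd (farr G a)"
      using arg_cong[OF eqs(1), of "\<lambda>F. farr F a"] arg_cong[OF eqs(2), of "\<lambda>F. farr F a"] a HD(2)[OF a] GD(2)[OF a]
      by (simp_all add: pb_proj_def)
    then show "farr H a = farr G a" using HD(2)[OF a] GD(2)[OF a] by (auto elim!: pb_arrE)
  qed (use HD(7) GD(7) in auto)
  then show ?thesis using H G by simp
qed

end

section \<open>The factorization through a largest full subcategory of the fibre product\<close>

lemma omap_hom:
  assumes "h \<in> hom K x y"
  shows "a \<in> ob x \<Longrightarrow> omap h a \<in> ob y" "a \<in> ob x \<Longrightarrow> po y (omap h a) = po x a"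
  using hom_KE[OF assms] over_funD(1,5) by (metis mor.sel(2) over_arr_simps(3))+

lemma omap_comp: "h \<in> hom K x y \<Longrightarrow> k \<in> hom K y z \<Longrightarrow> a \<in> ob x \<Longrightarrow> omap (Comp K k h) a = omap k (omap h a)"
  by (elim hom_KE) (simp add: Comp_K del: slice_simps)

lemma hom_D_eqI:
  assumes "z \<in> D" "u \<in> hom K x z" "v \<in> hom K x z" "\<And>a. a \<in> ob x \<Longrightarrow> omap u a = omap v a"
  shows "u = v"
proof -
  obtain F where F: "over x" "over_fun x z F" "u = over_arr x z F" using hom_KE[OF assms(2)] by blast
  obtain G where G: "over_fun x z G" "v = over_arr x z G" using hom_KE[OF assms(3)] by blast
  show ?thesis using disc_fun_eq[OF _ _ F(1,2) G(1)] assms(1,4) F G by simp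
qed

text \<open>The middle object is the largest full subcategory of the fibre product of \<open>y\<close> and \<open>e\<close>
  containing the image of \<open>x\<close> on which functors to discrete fibrations are determined by
  their restriction to \<open>x\<close>.  The fibre product itself is in general too large.\<close>

lemma local_factorization:
  assumes f: "f \<in> hom K x y" and j: "j \<in> hom K x e" "j \<in> local_equivs K D" and e: "e \<in> D"
  shows "\<exists>w p. w \<in> local_equivs K D \<and> p \<in> rlp K (local_equivs K D) \<and> Cod K w = Dom K p \<and> Comp K p w = f"
proof -
  let ?W = "local_equivs K D"
  have oy: "over y" and ox: "over x" and oe: "over e" using f j(1) by (auto simp: hom_K)
  define i where "i a = upair (omap f a) (omap j a)" for a
  \<comment> \<open>Only the uniqueness half of being a local equivalence is imposed on x ->
    \<open>pb y e S\<close>; the existence of extensions comes from the projection to e, whatever S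
    is.\<close>
  define good where "good S \<longleftrightarrow> S \<subseteq> pb_obj y e \<and> i ` ob x \<subseteq> S \<and>
    (\<forall>z\<in>D. \<forall>u\<in>hom K (pb y e S) z. \<forall>v\<in>hom K (pb y e S) z.
      (\<forall>a\<in>ob x. omap u (i a) = omap v (i a)) \<longrightarrow> u = v)" for S
  have goodD: "u = v" if "good S" "z \<in> D" "u \<in> hom K (pb y e S) z" "v \<in> hom K (pb y e S) z"
    "\<And>a. a \<in> ob x \<Longrightarrow> omap u (i a) = omap v (i a)" for S z u v
    using that unfolding good_def by blast
  have good_im_in: "i a \<in> S" if "good S" "a \<in> ob x" for S a
    using that unfolding good_def by blast
  have base: "upair (omap v a) (omap t a) \<in> pb_obj y e"
    if "v \<in> hom K x' y" "t \<in> hom K x' e" "a \<in> ob x'" for v t x' a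
    using omap_hom[OF that(1)] omap_hom[OF that(2)] that(3) by (auto simp: pb_obj_def)
  \<comment> \<open>Inclusions of full subcategories, obtained by pairing the two
    projections.\<close>
  have incl: "\<exists>h\<in>hom K (pb y e S) (pb y e S'). Comp K (pr1 y e S') h = pr1 y e S \<and>
      Comp K (pr2 y e S') h = pr2 y e S \<and> (\<forall>z\<in>S. omap h z = z)"
    if SS: "S \<subseteq> S'" and S': "S' \<subseteq> pb_obj y e" for S S'
  proof -
    have S: "S \<subseteq> pb_obj y e" using SS S' by blast
    have id: "upair (omap (pr1 y e S) z) (omap (pr2 y e S) z) = z" if z: "z \<in> S" for z
      unfolding pr_omap[OF oy oe S z] by (rule pb_objE[OF z S]) simp
    obtain h where "h \<in> hom K (pb y e S) (pb y e S')" "Comp K (pr1 y e S') h = pr1 y e S"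
      "Comp K (pr2 y e S') h = pr2 y e S"
      "\<And>z. z \<in> ob (pb y e S) \<Longrightarrow> omap h z = upair (omap (pr1 y e S) z) (omap (pr2 y e S) z)"
      using pb_pairing[OF oy oe S' pr_hom[OF oy oe S]] id SS by auto
    then show ?thesis using id by auto
  qed
  \<comment> \<open>On the image of x the condition is immediate, as arrows into objects of D are
    determined on objects. This also puts the image inside the union of all good sets.\<close>
  have good_im: "good (i ` ob x)"
    unfolding good_def
  proof (intro conjI ballI impI)
    show "i ` ob x \<subseteq> pb_obj y e" using base[OF f j(1)] by (auto simp: i_def)
    fix z u v assume z: "z \<in> D" and u: "u \<in> hom K (pb y e (i ` ob x)) z"
      and v: "v \<in> hom K (pb y e (i ` ob x)) z" and uv: "\<forall>a\<in>ob x. omap u (i a) = omap v (i a)"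
    show "u = v" by (rule hom_D_eqI[OF z u v]) (use uv in auto)
  qed simp
  define S where "S = \<Union>{S. good S}"
  have Sb: "S \<subseteq> pb_obj y e" unfolding S_def good_def by blast
  have iS: "i ` ob x \<subseteq> S" unfolding S_def using good_im by blast
  \<comment> \<open>Equality of arrows into an object of D is tested one object at a time, and each
    object of the union already lies in a good set, to which both arrows can be restricted.\<close>
  have good_S: "good S"
    unfolding good_def
  proof (intro conjI ballI impI Sb iS)
    fix z u v assume z: "z \<in> D" and u: "u \<in> hom K (pb y e S) z" and v: "v \<in> hom K (pb y e S) z"
      and uv: "\<forall>a\<in>ob x. omap u (i a) = omap v (i a)"
    show "u = v"
    proof (rule hom_D_eqI[OF z u v])
      fix a assume "a \<in> ob (pb y e S)"
      then obtain S' where S': "good S'" "a \<in> S'" unfolding S_def by auto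
      have "S' \<subseteq> S" unfolding S_def using S'(1) by blast
      then obtain h where h: "h \<in> hom K (pb y e S') (pb y e S)" "\<forall>z\<in>S'. omap h z = z"
        using incl[OF _ Sb] by blast
      have o: "omap (Comp K u h) b = omap u b" "omap (Comp K v h) b = omap v b" if "b \<in> S'" for b
        using omap_comp[OF h(1) u] omap_comp[OF h(1) v] h(2) that by simp_all
      have "Comp K u h = Comp K v h"
        by (rule goodD[OF S'(1) z K.comp_hom[OF h(1) u] K.comp_hom[OF h(1) v]])
          (use o uv good_im_in[OF S'(1)] in \<open>simp del: slice_simps\<close>)
      then show "omap u a = omap v a" using o[OF S'(2)] by (simp only:)
    qed
  qed
  note oP = over_pb[OF oy oe Sb] and pr = pr_hom[OF oy oe Sb]
  obtain w where w: "w \<in> hom K x (pb y e S)" "Comp K (pr1 y e S) w = f" "Comp K (pr2 y e S) w = j"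
    "\<And>a. a \<in> ob x \<Longrightarrow> omap w a = i a"
    using pb_pairing[OF oy oe Sb f j(1)] iS unfolding i_def by blast
  have "w \<in> ?W"
  proof (rule K.local_equivsI[OF w(1)])
    fix z u v assume z: "z \<in> D" and u: "u \<in> hom K (pb y e S) z" and v: "v \<in> hom K (pb y e S) z"
      and eq: "Comp K u w = Comp K v w"
    have "omap u (i a) = omap v (i a)" if "a \<in> ob x" for a
      using omap_comp[OF w(1) u that] omap_comp[OF w(1) v that] eq w(4)[OF that] by simp
    then show "u = v" using goodD[OF good_S z u v] by blast
  next
    \<comment> \<open>Existence of the extension: t extends along j to e, and the second projection
      carries this back to the middle object.\<close>
    fix z t assume z: "z \<in> D" and t: "t \<in> hom K x z"
    obtain t' where t': "t' \<in> hom K e z" "Comp K t' j = t" using K.local_equivs_ex[OF j(2,1) z t] .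
    have "Comp K (Comp K t' (pr2 y e S)) w = t"
      using K.assoc[OF w(1) pr(2) t'(1)] w(3) t'(2) by (simp del: slice_simps)
    then show "\<exists>u\<in>hom K (pb y e S) z. Comp K u w = t" using K.comp_hom[OF pr(2) t'(1)] by blast
  qed
  moreover have "pr1 y e S \<in> rlp K ?W"
    unfolding rlp_def mem_Collect_eq
  proof (intro conjI ballI homD(1)[OF pr(1)])
    fix l assume l: "l \<in> ?W"
    show "has_lifting K l (pr1 y e S)"
    proof (rule has_liftingI, unfold homD(2,3)[OF pr(1)])
      fix u v assume u: "u \<in> hom K (Dom K l) (pb y e S)" and v: "v \<in> hom K (Cod K l) y"
        and eq: "Comp K (pr1 y e S) u = Comp K v l"
      have lh: "l \<in> hom K (Dom K l) (Cod K l)" using l by (simp only: local_equivs_def mem_Collect_eq hom_arr)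
      \<comment> \<open>The second coordinate of the diagonal, which exists because e lies in D and
        l is a local equivalence; the first coordinate has to be v.\<close>
      obtain t where t: "t \<in> hom K (Cod K l) e" "Comp K t l = Comp K (pr2 y e S) u"
        using K.local_equivs_ex[OF l lh e K.comp_hom[OF u pr(2)]] .
      \<comment> \<open>S enlarged by the objects that the candidate diagonal (v, t) reaches. If S'
        is good, maximality of S gives S' = S.\<close>
      define S' where "S' = S \<union> (\<lambda>b. upair (omap v b) (omap t b)) ` ob (Cod K l)"
      have S'b: "S' \<subseteq> pb_obj y e" using Sb base[OF v t(1)] by (auto simp: S'_def)
      have pair: "upair (omap v b) (omap t b) \<in> S'" if "b \<in> ob (Cod K l)" for b
        using that by (simp add: S'_def del: slice_simps)
      obtain h where h: "h \<in> hom K (Cod K l) (pb y e S')" "Comp K (pr1 y e S') h = v"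
        "Comp K (pr2 y e S') h = t" "\<And>b. b \<in> ob (Cod K l) \<Longrightarrow> omap h b = upair (omap v b) (omap t b)"
        using pb_pairing[OF oy oe S'b v t(1) pair] by blast
      obtain n where n: "n \<in> hom K (pb y e S) (pb y e S')" "Comp K (pr1 y e S') n = pr1 y e S"
        "Comp K (pr2 y e S') n = pr2 y e S" "\<forall>z\<in>S. omap n z = z"
        using incl[OF _ S'b, of S] unfolding S'_def by blast
      note pr' = pr_hom[OF oy oe S'b]
      \<comment> \<open>Restricted along l, the candidate is u seen in the larger
        subcategory.\<close>
      have hl: "Comp K h l = Comp K n u"
      proof (rule pr_jointly_monic[OF oy oe S'b K.comp_hom[OF lh h(1)] K.comp_hom[OF u n(1)]])
        show "Comp K (pr1 y e S') (Comp K h l) = Comp K (pr1 y e S') (Comp K n u)"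
          using K.assoc[OF lh h(1) pr'(1)] K.assoc[OF u n(1) pr'(1)] h(2) n(2) eq by (simp del: slice_simps)
        show "Comp K (pr2 y e S') (Comp K h l) = Comp K (pr2 y e S') (Comp K n u)"
          using K.assoc[OF lh h(1) pr'(2)] K.assoc[OF u n(1) pr'(2)] h(3) n(3) t(2) by (simp del: slice_simps)
      qed
      \<comment> \<open>Two arrows out of the larger subcategory that agree on the image of x agree
        on S, because S is good. They then agree on h l, which runs through S, hence on h, because l
        is a local equivalence. S and the image of h exhaust S'.\<close>
      have "good S'"
        unfolding good_def
      proof (intro conjI ballI impI S'b)
        show "i ` ob x \<subseteq> S'" using iS by (auto simp: S'_def)
        fix z a b assume z: "z \<in> D" and a: "a \<in> hom K (pb y e S') z" and b: "b \<in> hom K (pb y e S') z"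
          and ab: "\<forall>c\<in>ob x. omap a (i c) = omap b (i c)"
        have o: "omap (Comp K a n) c = omap a c" "omap (Comp K b n) c = omap b c" if "c \<in> S" for c
          using omap_comp[OF n(1) a] omap_comp[OF n(1) b] n(4) that by simp_all
        have an: "Comp K a n = Comp K b n"
          by (rule goodD[OF good_S z K.comp_hom[OF n(1) a] K.comp_hom[OF n(1) b]])
            (use o ab good_im_in[OF good_S] in \<open>simp del: slice_simps\<close>)
        have "Comp K (Comp K a h) l = Comp K (Comp K b h) l"
          unfolding K.assoc[OF lh h(1) a, symmetric] K.assoc[OF lh h(1) b, symmetric] hl
            K.assoc[OF u n(1) a] K.assoc[OF u n(1) b] an ..
        then have ah: "Comp K a h = Comp K b h"
          using K.local_equivs_inj[OF l lh z K.comp_hom[OF h(1) a] K.comp_hom[OF h(1) b]] by blast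
        show "a = b"
        proof (rule hom_D_eqI[OF z a b])
          fix c assume "c \<in> ob (pb y e S')"
          then consider "c \<in> S" | d where "d \<in> ob (Cod K l)" "c = omap h d"
            using h(4) by (auto simp: S'_def simp del: slice_simps)
          then show "omap a c = omap b c"
          proof cases
            case 1 then show ?thesis using o[OF 1] unfolding an by (simp only:)
          next
            case 2
            then show ?thesis
              using omap_comp[OF h(1) a 2(1)] omap_comp[OF h(1) b 2(1)] unfolding ah by (simp only:)
          qed
        qed
      qed
      then have "S' \<subseteq> S" unfolding S_def by blast
      then have SS: "S' = S" unfolding S'_def by blast
      \<comment> \<open>With S' = S the inclusion has the same projections as the identity, so h
        itself is the diagonal of the original square.\<close>
      have "n = Ident K (pb y e S)"
      proof (rule pr_jointly_monic[OF oy oe Sb n(1)[unfolded SS] K.ident_hom[OF K.hom_obj(1)[OF pr(1)]]])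
        show "Comp K (pr1 y e S) n = Comp K (pr1 y e S) (Ident K (pb y e S))"
          unfolding n(2)[unfolded SS] K.ident_right[OF pr(1)] ..
        show "Comp K (pr2 y e S) n = Comp K (pr2 y e S) (Ident K (pb y e S))"
          unfolding n(3)[unfolded SS] K.ident_right[OF pr(2)] ..
      qed
      then have "Comp K h l = u" unfolding hl using K.ident_left[OF u] by (simp only:)
      then show "\<exists>h\<in>hom K (Cod K l) (pb y e S). Comp K h l = u \<and> Comp K (pr1 y e S) h = v"
        using h(1,2) unfolding SS by blast
    qed
  qed
  moreover have "Cod K w = Dom K (pr1 y e S)" unfolding homD(3)[OF w(1)] homD(2)[OF pr(1)] ..
  ultimately show ?thesis using w(2) by (intro exI[of _ w] exI[of _ "pr1 y e S"] conjI)
qed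

section \<open>Assembling the Quillen equivalence\<close>

lemma reflective:
  assumes "adjunction K Psh (T_functor C) (int_functor C) \<phi>"
  shows "reflective_adjunction K Psh (T_functor C) (int_functor C) \<phi> D"
proof
  show "adjunction K Psh (T_functor C) (int_functor C) \<phi>" by fact
  show "bij_betw (farr (int_functor C)) (hom Psh F G) (hom K (fobj (int_functor C) F) (fobj (int_functor C) G))"
    if "F \<in> Obj Psh" "G \<in> Obj Psh" for F G
    using int_fully_faithful[OF that] by (simp only: int_functor_def fctr.simps)
qed (rule D_iff)

text \<open>The reflection of x is the unit at x of the adjunction built from
  \<open>eta\<close>.\<close>

lemma reflection: "x \<in> Obj K \<Longrightarrow> \<exists>e\<in>D. \<exists>i\<in>hom K x e. i \<in> local_equivs K D"
proof -
  assume x: "x \<in> Obj K"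
  interpret reflective_adjunction K Psh "T_functor C" "int_functor C"
    "\<lambda>x y f. Comp K (farr (int_functor C) f) (eta x)" D
    by (rule reflective[OF adjunction_T_int])
  show ?thesis using unit_local_equiv[OF x] unit_hom[OF x] image_local[OF L.map_obj[OF x]] by blast
qed

lemma model_structure_K: "model_structure K (local_model K D)"
proof (rule K.model_structure_local, unfold factorizes_def, rule ballI)
  fix f assume f: "f \<in> Arr K"
  obtain e j where e: "e \<in> D" and j: "j \<in> hom K (Dom K f) e" "j \<in> local_equivs K D"
    using reflection[OF K.dom_obj[OF f]] by blast
  show "\<exists>i\<in>local_equivs K D. \<exists>p\<in>rlp K (local_equivs K D). Cod K i = Dom K p \<and> Comp K p i = f"
    using local_factorization[OF hom_arr[OF f] j e] by blast
qed

lemma fibrant_K: "z \<in> Obj K \<Longrightarrow> fibrant K (local_model K D) z \<longleftrightarrow> z \<in> D"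
proof (rule K.fibrant_local_model[OF terminal_K reflection])
  fix x y f assume f: "f \<in> hom K x y" "is_iso K f" "y \<in> D"
  then show "x \<in> D" using disc_iso[OF f(1,2)] K.hom_obj(1)[OF f(1)] Obj_K by blast
qed

text \<open>The \<open>THE\<close> is resolved by both halves: existence rests on the factorization,
  and uniqueness on the reflection of every object into D.\<close>

lemma discfib_model_eq: "discfib_model U C = local_model K D"
  unfolding discfib_model_def
proof (rule the_equality)
  show "model_structure K (local_model K D) \<and> Cofib (local_model K D) = Arr K \<and>
    (\<forall>p\<in>Obj K. fibrant K (local_model K D) p \<longleftrightarrow> discrete_fibration (src p) C (mp p))"
    using model_structure_K fibrant_K Obj_K by (simp only: local_model_def model.simps) blast
next
  fix M assume M: "model_structure K M \<and> Cofib M = Arr K \<and>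
    (\<forall>p\<in>Obj K. fibrant K M p \<longleftrightarrow> discrete_fibration (src p) C (mp p))"
  have "fibrant K M z \<longleftrightarrow> z \<in> D" if "z \<in> Obj K" for z using M that Obj_K[of z] by blast
  then show "M = local_model K D"
    using K.all_cofib_model_unique[OF _ _ _ terminal_K reflection] M by blast
qed

lemma proj_model_eq:
  "proj_model U C = \<lparr>Weq = {f \<in> Arr Psh. is_iso Psh f}, Cofib = Arr Psh, Fib = Arr Psh\<rparr>"
  using is_iso_functor_cat[OF C.category_op_cat category_Set_cat] unfolding proj_model_def
  by (auto simp del: Set_cat_simps)

end

theorem theorem3p8:
  fixes U :: "'u set set" and C :: "'u scat"
  assumes "universe U"
    and "small_category U C"
  shows "(\<exists>\<phi>. adjunction (Cat_over U C) (presheaves U C) (T_functor C) (int_functor C) \<phi>) \<and>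
    (\<forall>\<phi>. adjunction (Cat_over U C) (presheaves U C) (T_functor C) (int_functor C) \<phi> \<longrightarrow>
      quillen_equivalence (Cat_over U C) (discfib_model U C)
        (presheaves U C) (proj_model U C) (T_functor C) (int_functor C) \<phi>)"
proof -
  interpret small_base U C using assms by unfold_locales
  show ?thesis
    unfolding discfib_model_eq
    using adjunction_T_int
      reflective_adjunction.quillen_equivalence_local_model[OF reflective model_structure_K proj_model_eq]
    by blast
qed

end
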